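(* Let $X$ be a compact metrizable space with a free interval and let $f:X\to X$ be a (continuous) transitive map. Then exactly one of the following two statements holds. (1) The map $f$ is relatively strongly mixing, non-invertible, has positive topological entropy and dense periodic points (i.e. the set of periodic points of $f$ is dense in $X$). (2) The space $X$ is a disjoint union of finitely many circles, $X=\bigoplus_{i=0}^{n-1}\mathbb{S}^1_i$, which are cyclically permuted by $f$ and, on each of them, $f^n$ is topologically conjugate to the same irrational rotation (of the circle).
   Context: A free interval of a topological space $X$ is an open subset of $X$ homeomorphic to an open interval of the real line. $\mathbb{N}=\{1,2,3,\dots\}$. A continuous map $f:X\to X$ is transitive if for all nonempty open $U,V\subseteq X$ there is $n\in\mathbb{N}$ with $f^n(U)\cap V\neq\emptyset$; it is strongly mixing if for all nonempty open $U,V\subseteq X$ there is $n_0\in\mathbb{N}$ with $f^n(U)\cap V\ne\emptyset$ for every $n\ge n_0$. A set $D\subseteq X$ is regular closed if it is the closure of its interior. A regular periodic decomposition (RPD) for $f$ is a finite sequence $\mathcal{D}=(D_0,\dots,D_{m-1})$ of regular closed subsets of $X$ covering $X$ such that $f(D_i)\subseteq D_{i+1\ (\mathrm{mod}\ m)}$ for $0\le i\le m-1$ and $D_i\cap D_j$ is nowhere dense in $X$ for $i\neq j$. The map $f$ is relatively strongly mixing if it has some RPD $(D_0,\dots,D_{m-1})$ such that $f^m|_{D_i}:D_i\to D_i$ is strongly mixing for every $i$. Topological entropy is the usual (Bowen) topological entropy. $\bigoplus$ denotes topological disjoint union. *)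

theory Defs
  imports "HOL-Analysis.Analysis"
begin

(* An open interval may be bounded or unbounded; it is required to be nonempty, since otherwise
   the empty set would be a free interval of every space. *)
definition free_interval :: "'a topology \<Rightarrow> 'a set \<Rightarrow> bool" where
  "free_interval X U \<longleftrightarrow> openin X U \<and>
     (\<exists>J::real set. open J \<and> is_interval J \<and> J \<noteq> {} \<and>
        subtopology X U homeomorphic_space top_of_set J)"

definition transitive_map :: "'a topology \<Rightarrow> ('a \<Rightarrow> 'a) \<Rightarrow> bool" where
  "transitive_map X f \<longleftrightarrow> continuous_map X X f \<and>
     (\<forall>U V. openin X U \<and> U \<noteq> {} \<and> openin X V \<and> V \<noteq> {} \<longrightarrow>
        (\<exists>n\<ge>1. (f ^^ n) ` U \<inter> V \<noteq> {}))"

definition strongly_mixing :: "'a topology \<Rightarrow> ('a \<Rightarrow> 'a) \<Rightarrow> bool" where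
  "strongly_mixing X f \<longleftrightarrow> continuous_map X X f \<and>
     (\<forall>U V. openin X U \<and> U \<noteq> {} \<and> openin X V \<and> V \<noteq> {} \<longrightarrow>
        (\<exists>n0\<ge>1. \<forall>n\<ge>n0. (f ^^ n) ` U \<inter> V \<noteq> {}))"

definition regular_closed :: "'a topology \<Rightarrow> 'a set \<Rightarrow> bool" where
  "regular_closed X D \<longleftrightarrow> D \<subseteq> topspace X \<and> D = X closure_of (X interior_of D)"

definition nowhere_dense_in :: "'a topology \<Rightarrow> 'a set \<Rightarrow> bool" where
  "nowhere_dense_in X A \<longleftrightarrow> A \<subseteq> topspace X \<and> X interior_of (X closure_of A) = {}"

(* The sequence (D 0, ..., D (m - 1)); values of D outside {..<m} play no role. *)
definition regular_periodic_decomposition ::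
    "'a topology \<Rightarrow> ('a \<Rightarrow> 'a) \<Rightarrow> nat \<Rightarrow> (nat \<Rightarrow> 'a set) \<Rightarrow> bool" where
  "regular_periodic_decomposition X f m D \<longleftrightarrow> m \<ge> 1 \<and>
     (\<forall>i<m. regular_closed X (D i)) \<and>
     (\<Union>i<m. D i) = topspace X \<and>
     (\<forall>i<m. f ` D i \<subseteq> D ((i + 1) mod m)) \<and>
     (\<forall>i<m. \<forall>j<m. i \<noteq> j \<longrightarrow> nowhere_dense_in X (D i \<inter> D j))"

definition relatively_strongly_mixing :: "'a topology \<Rightarrow> ('a \<Rightarrow> 'a) \<Rightarrow> bool" where
  "relatively_strongly_mixing X f \<longleftrightarrow>
     (\<exists>m D. regular_periodic_decomposition X f m D \<and>
        (\<forall>i<m. strongly_mixing (subtopology X (D i)) (f ^^ m)))"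

definition periodic_points :: "'a topology \<Rightarrow> ('a \<Rightarrow> 'a) \<Rightarrow> 'a set" where
  "periodic_points X f = {x \<in> topspace X. \<exists>n\<ge>1. (f ^^ n) x = x}"

(* Distinct points of E are at distance greater than e in the Bowen metric
   d_n(x, y) = max {d(f^k x, f^k y) | 0 <= k < n}. *)
definition bowen_separated :: "'a metric \<Rightarrow> ('a \<Rightarrow> 'a) \<Rightarrow> nat \<Rightarrow> real \<Rightarrow> 'a set \<Rightarrow> bool" where
  "bowen_separated M f n e E \<longleftrightarrow> E \<subseteq> mspace M \<and>
     (\<forall>x\<in>E. \<forall>y\<in>E. x \<noteq> y \<longrightarrow> (\<exists>k<n. mdist M ((f ^^ k) x) ((f ^^ k) y) > e))"

(* Bowen's h_d(f) = lim_{e -> 0} limsup_n (1/n) log s_n(e), where s_n(e) is the largest cardinality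
   of an (n, e)-separated set. The monotone logarithm is moved inside the maximum, and since
   s_n(e) increases as e decreases, the limit over e is a supremum. *)
definition bowen_entropy :: "'a metric \<Rightarrow> ('a \<Rightarrow> 'a) \<Rightarrow> ereal" where
  "bowen_entropy M f =
     (SUP e\<in>{0<..}. limsup (\<lambda>n.
        SUP E\<in>{E. finite E \<and> bowen_separated M f n e E}. ereal (ln (real (card E)) / real n)))"

(* The choice of the compatible metric is irrelevant on compact spaces:
   see topological_entropy_eq. *)
definition topological_entropy :: "'a topology \<Rightarrow> ('a \<Rightarrow> 'a) \<Rightarrow> ereal" where
  "topological_entropy X f = bowen_entropy (SOME M. mtopology_of M = X) f"

lemma bowen_entropy_mono:
  assumes c: "compact_space (mtopology_of M1)"
    and eq: "mtopology_of M1 = mtopology_of M2"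
    and f: "f \<in> mspace M1 \<rightarrow> mspace M1"
  shows "bowen_entropy M2 f \<le> bowen_entropy M1 f"
proof -
  have sp: "mspace M1 = mspace M2"
    using eq by (metis topspace_mtopology_of)
  have "uniformly_continuous_map M1 M2 (\<lambda>x. x)"
    using continuous_imp_uniformly_continuous_map[of M1 M2 "\<lambda>x. x"] c eq by simp
  then have uc: "\<And>e. e > 0 \<Longrightarrow> \<exists>d>0. \<forall>x\<in>mspace M1. \<forall>y\<in>mspace M1.
      mdist M1 y x < d \<longrightarrow> mdist M2 y x < e"
    unfolding uniformly_continuous_map_def by blast
  have it: "(f ^^ k) x \<in> mspace M1" if "x \<in> mspace M1" for k x
    using that f by (induction k) auto
  show ?thesis unfolding bowen_entropy_def
  proof (rule SUP_mono)
    fix e :: real assume "e \<in> {0<..}"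
    then obtain d where d: "d > 0"
      "\<And>x y. x \<in> mspace M1 \<Longrightarrow> y \<in> mspace M1 \<Longrightarrow> mdist M1 y x < d \<Longrightarrow> mdist M2 y x < e"
      using uc[of e] by auto
    have sep: "bowen_separated M1 f n (d/2) E" if sE: "bowen_separated M2 f n e E" for n E
      unfolding bowen_separated_def
    proof (intro conjI ballI impI)
      show "E \<subseteq> mspace M1"
        using sE sp by (simp add: bowen_separated_def)
      fix x y assume xy: "x \<in> E" "y \<in> E" "x \<noteq> y"
      then obtain k where k: "k < n" "mdist M2 ((f ^^ k) x) ((f ^^ k) y) > e"
        using sE unfolding bowen_separated_def by blast
      have "x \<in> mspace M1" "y \<in> mspace M1"
        using xy \<open>E \<subseteq> mspace M1\<close> by auto
      then have "\<not> mdist M1 ((f ^^ k) x) ((f ^^ k) y) < d"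
        using d(2)[OF it it, of y x k k] k(2) by linarith
      then show "\<exists>k<n. mdist M1 ((f ^^ k) x) ((f ^^ k) y) > d/2"
        using k(1) d(1) by (intro exI[of _ k]) auto
    qed
    have "limsup (\<lambda>n. SUP E\<in>{E. finite E \<and> bowen_separated M2 f n e E}.
              ereal (ln (real (card E)) / real n))
        \<le> limsup (\<lambda>n. SUP E\<in>{E. finite E \<and> bowen_separated M1 f n (d/2) E}.
              ereal (ln (real (card E)) / real n))"
      by (intro Limsup_mono always_eventually allI SUP_subset_mono) (auto intro: sep)
    then show "\<exists>d'\<in>{0<..}. limsup (\<lambda>n. SUP E\<in>{E. finite E \<and> bowen_separated M2 f n e E}.
              ereal (ln (real (card E)) / real n))
        \<le> limsup (\<lambda>n. SUP E\<in>{E. finite E \<and> bowen_separated M1 f n d' E}.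
              ereal (ln (real (card E)) / real n))"
      using d(1) by (intro bexI[of _ "d/2"]) auto
  qed
qed

lemma topological_entropy_eq:
  assumes "compact_space X" "continuous_map X X f" "mtopology_of M = X"
  shows "topological_entropy X f = bowen_entropy M f"
proof -
  let ?N = "SOME M. mtopology_of M = X"
  have N: "mtopology_of ?N = X"
    using assms(3) by (rule someI)
  have "f \<in> mspace M \<rightarrow> mspace M" "f \<in> mspace ?N \<rightarrow> mspace ?N"
    using continuous_map_funspace[OF assms(2)] assms(3) N by (metis topspace_mtopology_of)+
  then show ?thesis
    unfolding topological_entropy_def
    using assms N by (intro antisym bowen_entropy_mono) auto
qed

definition topologically_conjugate ::
    "'a topology \<Rightarrow> ('a \<Rightarrow> 'a) \<Rightarrow> 'b topology \<Rightarrow> ('b \<Rightarrow> 'b) \<Rightarrow> bool" where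
  "topologically_conjugate X f Y g \<longleftrightarrow>
     (\<exists>h. homeomorphic_map X Y h \<and> (\<forall>x\<in>topspace X. h (f x) = g (h x)))"

abbreviation circle :: "complex topology" where
  "circle \<equiv> top_of_set (sphere 0 1)"

(* Rotation of the circle by the fraction a of a full turn; it is irrational iff a is. *)
definition rotation :: "real \<Rightarrow> complex \<Rightarrow> complex" where
  "rotation a z = cis (2 * pi * a) * z"

(* phi identifies X with the topological disjoint union of n circles; its i-th circle is
   C i = phi ` ({i} x circle). The angle a does not depend on i. *)
definition cyclic_irrational_rotations :: "'a topology \<Rightarrow> ('a \<Rightarrow> 'a) \<Rightarrow> bool" where
  "cyclic_irrational_rotations X f \<longleftrightarrow>
     (\<exists>n\<ge>1. \<exists>phi :: nat \<times> complex \<Rightarrow> 'a. \<exists>C :: nat \<Rightarrow> 'a set.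
        homeomorphic_map (sum_topology (\<lambda>i. circle) {..<n}) X phi \<and>
        (\<forall>i<n. C i = phi ` ({i} \<times> topspace circle)) \<and>
        (\<forall>i<n. f ` C i = C ((i + 1) mod n)) \<and>
        (\<exists>a. a \<notin> \<rat> \<and>
           (\<forall>i<n. topologically_conjugate (subtopology X (C i)) (f ^^ n) circle (rotation a))))"

end

theory Submission
  imports Defs "HOL-Analysis.Kronecker_Approximation_Theorem"
begin

text \<open>
  Identify a free interval with an arc \<open>e\<close> parametrized by \<open>(0,1)\<close>. There are two cases.

  If the periodic points are dense in the arc, shrink it so that it avoids some periodic orbit. No closed set with
  an interior point that is invariant under an iterate of \<open>f\<close> then fits in the arc, so the iterates of a small
  interval through a periodic point, being connected, leave the arc; after one more shrinking all closures
  \<open>cl (\<Union>k. f^(N k) U)\<close> with \<open>U\<close> in the arc contain the arc. Such a closure, for a suitable \<open>N\<close>, is one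
  piece of a regular periodic decomposition. Moreover the iterates of an interval eventually cover all
  but two of five disjoint intervals with periodic endpoints, which gives mixing, a horseshoe and non-injectivity.

  If some subarc has no periodic points, collapse its complement to a point. The lift \<open>g\<close> of
  \<open>f^m\<close> to the resulting circle satisfies \<open>x < g x < x + 1\<close> and is monotone. Iterating a segment from \<open>y\<close> to
  \<open>f^k y\<close> gives a curve \<open>\<gamma>\<close> with \<open>\<gamma> (t + 1) = f^k (\<gamma> t)\<close> and an increasing homeomorphism \<open>H\<close>
  of the line, commuting with the unit translation, with \<open>\<gamma> (H t) = \<gamma> t\<close>. Poincare's
  conjugation of \<open>H\<close> to an irrational translation turns the image of \<open>\<gamma>\<close> into a circle on which
  \<open>f^k\<close> is an irrational rotation; its finitely many images under \<open>f\<close> are pairwise disjoint or equal and cover the space.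
\<close>

section \<open>Free lifts of circle homeomorphisms\<close>

text \<open>The complement of the arc is arbitrary, so order arguments are confined to the arc. What
  links the two is one separation fact: a connected set that meets the arc but omits a point of it
  on either side is trapped between these two points. Iterates of an interval under multiples of a
  period share the periodic point, which makes their union connected.

  Five blocks are taken for counting. The union of the iterates may miss endpoints of one block, and
  a single iterate containing all other endpoints may fail to cover one further block; three remain.
  Any two of them make a horseshoe, and two families of three among five intersect, so that some
  point has preimages in two disjoint blocks.

  Without periodic points the collapsed point corresponds to the integers, and strict monotonicity
  of lifts is available only away from them; hence the circle is found as the image of a curve whose
  self-intersections are described by \<open>H\<close>.

  The two alternatives exclude each other because the second one makes \<open>f\<close> a
  homeomorphism.\<close>

lemma irrational_multiples_dense:
  fixes b :: real
  assumes "b \<notin> \<rat>" "u < v"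
  obtains n :: nat and m :: int where "n \<ge> 1" "u < n * b + m" "n * b + m < v"
proof -
  let ?c = "(u + v) / 2"
  obtain k where k: "k > 0" "\<bar>frac (real k * b) - frac ?c\<bar> < (v - u) / 2"
    using Kronecker_approx_1_explicit[of b "frac ?c" "(v - u) / 2"] assms frac_lt_1[of ?c] frac_ge_0[of ?c]
    by (auto simp: less_imp_le)
  show ?thesis
  proof (rule that[of k "\<lfloor>?c\<rfloor> - \<lfloor>real k * b\<rfloor>"])
    have "\<bar>k * b + (\<lfloor>?c\<rfloor> - \<lfloor>real k * b\<rfloor>) - ?c\<bar> < (v - u) / 2"
      using k(2) by (simp add: frac_def algebra_simps)
    then show "u < real k * b + of_int (\<lfloor>?c\<rfloor> - \<lfloor>real k * b\<rfloor>)"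
      "real k * b + of_int (\<lfloor>?c\<rfloor> - \<lfloor>real k * b\<rfloor>) < v"
      by (simp_all add: abs_less_iff field_simps)
  qed (use k in simp)
qed

text \<open>These are the lifts to the line of orientation preserving homeomorphisms of the
  circle.\<close>

locale circle_lift =
  fixes H :: "real \<Rightarrow> real"
  assumes continuous_H: "continuous_on UNIV H"
    and strict_H: "strict_mono H"
    and shift_H: "H (t + 1) = H t + 1"
begin

lemma continuous_iter: "continuous_on S (H ^^ n)"
proof (induction n)
  case (Suc n)
  have "continuous_on S (\<lambda>x. H ((H ^^ n) x))"
    using continuous_on_compose2[OF continuous_H Suc] by simp
  then show ?case
    by (simp add: comp_def)
qed simp

lemma strict_iter: "strict_mono (H ^^ n)"
  by (induction n) (use strict_H in \<open>auto simp: strict_mono_def\<close>)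

lemma H_add_nat: "H (t + real j) = H t + real j"
proof (induction j)
  case (Suc j)
  have "H (t + real (Suc j)) = H ((t + real j) + 1)"
    by (simp add: algebra_simps)
  also have "\<dots> = H t + real (Suc j)"
    unfolding shift_H using Suc by simp
  finally show ?case .
qed simp

lemma H_add_int: "H (t + of_int m) = H t + of_int m"
proof (cases "m \<ge> 0")
  case True
  then show ?thesis
    using H_add_nat[of t "nat m"] by simp
next
  case False
  then show ?thesis
    using H_add_nat[of "t + of_int m" "nat (- m)"] by simp
qed

lemma iter_add_int: "(H ^^ n) (t + of_int m) = (H ^^ n) t + of_int m"
  by (induction n) (simp_all add: H_add_int)

end

text \<open>Freeness says that the induced circle homeomorphism has no periodic point; it is what
  forces the rotation number to be irrational.\<close>

locale free_circle_lift = circle_lift +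
  assumes free_H: "n \<ge> 1 \<Longrightarrow> (H ^^ n) t \<noteq> t + of_int m"
begin

text \<open>By connectedness of the line, a change of sign of \<open>(H ^^ n) x - (x + m)\<close>
  would produce a zero, which freeness forbids. One comparison at one point therefore decides all of
  them.\<close>

lemma iter_side:
  assumes "n \<ge> 1" "(H ^^ n) s < s + of_int m"
  shows "(H ^^ n) t < t + of_int m"
proof (rule ccontr)
  assume "\<not> ?thesis"
  then have "t + of_int m \<le> (H ^^ n) t"
    by simp
  moreover have "continuous_on UNIV (\<lambda>x. (H ^^ n) x - (x + of_int m))"
    by (intro continuous_intros continuous_iter)
  then have "connected (range (\<lambda>x. (H ^^ n) x - (x + of_int m)))"
    by (intro connected_continuous_image) auto
  ultimately have "0 \<in> range (\<lambda>x. (H ^^ n) x - (x + of_int m))"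
    using assms(2) unfolding connected_iff_interval
    by (meson diff_ge_0_iff_ge diff_le_0_iff_le less_imp_le rangeI)
  then show False
    using free_H[OF assms(1)] by (metis (no_types, lifting) eq_iff_diff_eq_0 imageE)
qed

lemma iter_side':
  assumes "n \<ge> 1" "(H ^^ n) s > s + of_int m"
  shows "(H ^^ n) t > t + of_int m"
  using iter_side[OF assms(1), of t m s] free_H[OF assms(1), of t m] assms(2) by fastforce

lemma iter_mult_upper:
  assumes "\<And>t. (H ^^ n) t \<le> t + c"
  shows "(H ^^ (n * j)) t \<le> t + real j * c"
proof (induction j)
  case (Suc j)
  have "(H ^^ (n * Suc j)) t = (H ^^ n) ((H ^^ (n * j)) t)"
    by (simp add: funpow_add)
  then show ?case
    using assms[of "(H ^^ (n * j)) t"] Suc by (simp add: algebra_simps)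
qed simp

lemma iter_mult_lower:
  assumes "\<And>t. (H ^^ n) t \<ge> t + c"
  shows "(H ^^ (n * j)) t \<ge> t + real j * c"
proof (induction j)
  case (Suc j)
  have "(H ^^ (n * Suc j)) t = (H ^^ n) ((H ^^ (n * j)) t)"
    by (simp add: funpow_add)
  then show ?case
    using assms[of "(H ^^ (n * j)) t"] Suc by (simp add: algebra_simps)
qed simp

text \<open>Periodicity reduces the infimum to a minimum over the compact interval
  \<open>{0..1}\<close>. The gap is accumulated over many iterates until it exceeds a whole
  turn.\<close>

lemma uniform_gap:
  assumes g: "\<And>t. (g :: real \<Rightarrow> real) t > 0" "continuous_on UNIV g" "\<And>t. g (t + 1) = g t"
  obtains d where "d > 0" "\<And>t. g t \<ge> d"
proof -
  have "continuous_on {0..1} g"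
    using g(2) continuous_on_subset by blast
  then obtain x where x: "x \<in> {0..1}" "\<And>y. y \<in> {0..1} \<Longrightarrow> g x \<le> g y"
    using continuous_attains_inf[of "{0..1::real}" g] by auto
  have nat: "g (t + real j) = g t" for t j
  proof (induction j)
    case (Suc j)
    have "g (t + real (Suc j)) = g ((t + real j) + 1)"
      by (simp add: algebra_simps)
    also have "\<dots> = g t"
      unfolding g(3) using Suc by simp
    finally show ?case .
  qed simp
  have int: "g (t + of_int m) = g t" for t m
    using nat[of t "nat m"] nat[of "t + of_int m" "nat (- m)"] by (cases "m \<ge> 0") auto
  have "g t \<ge> g x" for t
    using int[of "t - of_int \<lfloor>t\<rfloor>" "\<lfloor>t\<rfloor>"] x(2)[of "t - of_int \<lfloor>t\<rfloor>"]
    by (simp add: less_imp_le frac_ge_0[unfolded frac_def] frac_lt_1[unfolded frac_def])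
  then show ?thesis
    using that g(1) by blast
qed

section \<open>The rotation number as a Dedekind cut\<close>

definition rot :: real where
  "rot = Inf {of_int m / real n | n m. n \<ge> 1 \<and> (H ^^ n) 0 < of_int m}"

text \<open>Both inequalities propagate to the common iterate \<open>n * n'\<close>, where they can
  be compared. This is the cut property that lets \<open>rot\<close> replace the limit of
  \<open>(H ^^ n) 0 / n\<close>.\<close>

lemma cut_less:
  assumes "n \<ge> 1" "(H ^^ n) 0 < of_int m" "n' \<ge> 1" "(H ^^ n') 0 \<ge> of_int m'"
  shows "of_int m' / real n' \<le> of_int m / real n"
proof -
  have "(H ^^ n) t \<le> t + of_int m" for t
    using iter_side[OF assms(1), of 0 m t] assms(2) by simp
  then have "(H ^^ (n * n')) 0 \<le> 0 + real n' * of_int m"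
    by (rule iter_mult_upper)
  moreover have "(H ^^ n') t \<ge> t + of_int m'" for t
    using iter_side'[OF assms(3), of 0 m' t] assms(4) free_H[OF assms(3), of 0 m'] by fastforce
  then have "(H ^^ (n' * n)) 0 \<ge> 0 + real n * of_int m'"
    by (rule iter_mult_lower)
  ultimately have "real n * of_int m' \<le> real n' * of_int m"
    by (simp add: mult.commute)
  then show ?thesis
    using assms(1,3) by (simp add: field_simps)
qed

lemma cut_nonempty: "{of_int m / real n | n m. n \<ge> 1 \<and> (H ^^ n) 0 < of_int m} \<noteq> {}"
proof -
  have "(H ^^ 1) 0 < of_int (\<lfloor>H 0\<rfloor> + 1)"
    by simp
  then show ?thesis
    by blast
qed

lemma rot_upper: "n \<ge> 1 \<Longrightarrow> (H ^^ n) 0 < of_int m \<Longrightarrow> rot \<le> of_int m / real n"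
  unfolding rot_def
proof (rule cInf_lower)
  have "(H ^^ 1) 0 \<ge> of_int \<lfloor>H 0\<rfloor>"
    by simp
  then show "bdd_below {of_int m / real n |n m. 1 \<le> n \<and> (H ^^ n) 0 < of_int m}"
    using cut_less[of _ _ 1] unfolding bdd_below_def by blast
qed blast

lemma rot_lower: "n \<ge> 1 \<Longrightarrow> (H ^^ n) 0 \<ge> of_int m \<Longrightarrow> rot \<ge> of_int m / real n"
  unfolding rot_def using cut_less cut_nonempty by (intro cInf_greatest) auto

text \<open>A uniform gap \<open>d\<close> between the iterate and the translation adds up to more
  than 1 after \<open>j\<close> repetitions. This leaves room to lower the numerator by one:
  \<open>rot\<close> is at most \<open>(j * m - 1) / (n * j)\<close>.\<close>

lemma rot_upper_strict:
  assumes n: "n \<ge> 1" and less: "(H ^^ n) 0 < of_int m"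
  shows "rot < of_int m / real n"
proof -
  have "continuous_on UNIV (\<lambda>t. t + of_int m - (H ^^ n) t)"
    by (intro continuous_intros continuous_iter)
  moreover have "(\<lambda>t. t + of_int m - (H ^^ n) t) t > 0" for t
    using iter_side[OF n, of 0 m t] less by simp
  moreover have "t + 1 + of_int m - (H ^^ n) (t + 1) = t + of_int m - (H ^^ n) t" for t
    using iter_add_int[of n t 1] by simp
  ultimately obtain d where d: "d > 0" "\<And>t. t + of_int m - (H ^^ n) t \<ge> d"
    using uniform_gap[of "\<lambda>t. t + of_int m - (H ^^ n) t"] by metis
  obtain j where j: "real j * d > 1"
    using reals_Archimedean3[OF d(1)] by blast
  have jpos: "j \<ge> 1"
    using j by (cases j) auto
  have "(H ^^ n) t \<le> t + (of_int m - d)" for t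
    using d(2)[of t] by linarith
  from iter_mult_upper[where n = n and c = "of_int m - d" and j = j and t = 0] this
  have "(H ^^ (n * j)) 0 < of_int (int j * m - 1)"
    using j by (simp add: algebra_simps)
  moreover have "n * j \<ge> 1"
    using n jpos by simp
  ultimately have "rot \<le> of_int (int j * m - 1) / real (n * j)"
    by (intro rot_upper)
  also have "\<dots> < of_int m / real n"
    using n jpos by (simp add: field_simps)
  finally show ?thesis .
qed

lemma rot_lower_strict:
  assumes n: "n \<ge> 1" and less: "(H ^^ n) 0 > of_int m"
  shows "rot > of_int m / real n"
proof -
  have "continuous_on UNIV (\<lambda>t. (H ^^ n) t - (t + of_int m))"
    by (intro continuous_intros continuous_iter)
  moreover have "(\<lambda>t. (H ^^ n) t - (t + of_int m)) t > 0" for t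
    using iter_side'[OF n, of 0 m t] less by simp
  moreover have "(H ^^ n) (t + 1) - (t + 1 + of_int m) = (H ^^ n) t - (t + of_int m)" for t
    using iter_add_int[of n t 1] by simp
  ultimately obtain d where d: "d > 0" "\<And>t. (H ^^ n) t - (t + of_int m) \<ge> d"
    using uniform_gap[of "\<lambda>t. (H ^^ n) t - (t + of_int m)"] by metis
  obtain j where j: "real j * d > 1"
    using reals_Archimedean3[OF d(1)] by blast
  have jpos: "j \<ge> 1"
    using j by (cases j) auto
  have "(H ^^ n) t \<ge> t + (of_int m + d)" for t
    using d(2)[of t] by linarith
  from iter_mult_lower[where n = n and c = "of_int m + d" and j = j and t = 0] this
  have "(H ^^ (n * j)) 0 \<ge> of_int (int j * m + 1)"
    using j by (simp add: algebra_simps)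
  moreover have "n * j \<ge> 1"
    using n jpos by simp
  ultimately have "rot \<ge> of_int (int j * m + 1) / real (n * j)"
    by (intro rot_lower)
  moreover have "of_int (int j * m + 1) / real (n * j) > of_int m / real n"
    using n jpos by (simp add: field_simps)
  ultimately show ?thesis
    by linarith
qed

lemma rot_irrational: "rot \<notin> \<rat>"
proof
  assume "rot \<in> \<rat>"
  then obtain m :: int and n :: nat where nm: "n > 0" "rot = of_int m / real n"
    by (auto elim!: Rats_cases')
      (metis Rats_cases' \<open>rot \<in> \<rat>\<close> of_int_of_nat_eq zero_less_imp_eq_int)
  then have "(H ^^ n) 0 < of_int m \<or> (H ^^ n) 0 > of_int m"
    using free_H[of n 0 m] by auto
  then show False
    using rot_upper_strict[of n m] rot_lower_strict[of n m] nm by auto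
qed

lemma iter0_less_iff:
  assumes "n \<ge> 1"
  shows "(H ^^ n) 0 < of_int m \<longleftrightarrow> real n * rot < of_int m"
proof -
  have "(H ^^ n) 0 < of_int m \<or> (H ^^ n) 0 > of_int m"
    using free_H[OF assms, of 0 m] by auto
  then show ?thesis
    using rot_upper_strict[OF assms, of m] rot_lower_strict[OF assms, of m] assms
    by (auto simp: field_simps)
qed

lemma iter0_greater_iff:
  assumes "n \<ge> 1"
  shows "of_int m < (H ^^ n) 0 \<longleftrightarrow> of_int m < real n * rot"
proof -
  have "(H ^^ n) 0 < of_int m \<or> (H ^^ n) 0 > of_int m"
    using free_H[OF assms, of 0 m] by auto
  then show ?thesis
    using rot_upper_strict[OF assms, of m] rot_lower_strict[OF assms, of m] assms
    by (auto simp: field_simps)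
qed

text \<open>The smaller number of iterates can be cancelled, since iterates are strictly increasing
  and commute with integer translations; what is left compares a single iterate of 0 with an
  integer. The equivalence is what makes a conjugacy to the translation by \<open>rot\<close>
  possible.\<close>

lemma orbit_order:
  "(H ^^ n) 0 + of_int m < (H ^^ n') 0 + of_int m' \<longleftrightarrow> real n * rot + of_int m < real n' * rot + of_int m'"
proof (cases n n' rule: linorder_cases)
  case less
  then have n': "(H ^^ n') 0 = (H ^^ n) ((H ^^ (n' - n)) 0)"
    by (metis add_diff_inverse_nat comp_apply funpow_add less_imp_not_less)
  have "(H ^^ n) 0 + of_int m < (H ^^ n') 0 + of_int m' \<longleftrightarrow>
      (H ^^ n) 0 < (H ^^ n) ((H ^^ (n' - n)) 0 + of_int (m' - m))"
    unfolding n' iter_add_int by auto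
  also have "\<dots> \<longleftrightarrow> of_int (m - m') < (H ^^ (n' - n)) 0"
    using strict_mono_less[OF strict_iter] by auto
  also have "\<dots> \<longleftrightarrow> of_int (m - m') < real (n' - n) * rot"
    using less by (intro iter0_greater_iff) simp
  also have "\<dots> \<longleftrightarrow> real n * rot + of_int m < real n' * rot + of_int m'"
    using less by (auto simp: of_nat_diff algebra_simps)
  finally show ?thesis .
next
  case greater
  then have n: "(H ^^ n) 0 = (H ^^ n') ((H ^^ (n - n')) 0)"
    by (metis add_diff_inverse_nat comp_apply funpow_add less_imp_not_less)
  have "(H ^^ n) 0 + of_int m < (H ^^ n') 0 + of_int m' \<longleftrightarrow>
      (H ^^ n') ((H ^^ (n - n')) 0 + of_int (m - m')) < (H ^^ n') 0"
    unfolding n iter_add_int by auto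
  also have "\<dots> \<longleftrightarrow> (H ^^ (n - n')) 0 < of_int (m' - m)"
    using strict_mono_less[OF strict_iter] by auto
  also have "\<dots> \<longleftrightarrow> real (n - n') * rot < of_int (m' - m)"
    using greater by (intro iter0_less_iff) simp
  also have "\<dots> \<longleftrightarrow> real n * rot + of_int m < real n' * rot + of_int m'"
    using greater by (auto simp: of_nat_diff algebra_simps)
  finally show ?thesis .
qed simp

section \<open>Poincare's semiconjugacy to a translation\<close>

definition below :: "real \<Rightarrow> real set" where
  "below t = {real n * rot + of_int m | n m. (H ^^ n) 0 + of_int m \<le> t}"

text \<open>The order preserving correspondence of \<open>(H ^^ n) 0 + m\<close> with
  \<open>n * rot + m\<close>, extended to the line by suprema. For a general free lift it is only
  monotone; on the curve considered later, transitivity makes it strict.\<close>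

definition conj :: "real \<Rightarrow> real" where
  "conj t = Sup (below t)"

lemma below_nonempty: "below t \<noteq> {}"
proof -
  have "(H ^^ 0) 0 + of_int \<lfloor>t\<rfloor> \<le> t"
    by simp
  then show ?thesis
    unfolding below_def by blast
qed

lemma below_bound:
  assumes "t < (H ^^ n) 0 + of_int m" "x \<in> below t"
  shows "x < real n * rot + of_int m"
  using assms orbit_order[of _ _ n m] unfolding below_def by fastforce

lemma bdd_below': "bdd_above (below t)"
proof -
  have "t < (H ^^ 0) 0 + of_int (\<lfloor>t\<rfloor> + 1)"
    by simp
  then show ?thesis
    using below_bound unfolding bdd_above_def by (meson less_imp_le)
qed

lemma conj_ge: "(H ^^ n) 0 + of_int m \<le> t \<Longrightarrow> real n * rot + of_int m \<le> conj t"
  unfolding conj_def by (rule cSup_upper[OF _ bdd_below']) (auto simp: below_def)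

lemma conj_le: "t < (H ^^ n) 0 + of_int m \<Longrightarrow> conj t \<le> real n * rot + of_int m"
  unfolding conj_def using below_bound by (intro cSup_least[OF below_nonempty]) (simp add: less_imp_le)

lemma conj_mono: "s \<le> t \<Longrightarrow> conj s \<le> conj t"
  unfolding conj_def by (intro cSup_subset_mono below_nonempty bdd_below') (auto simp: below_def intro: order_trans)

text \<open>The numbers \<open>n * rot + m\<close> are dense already for \<open>n \<ge> 1\<close>.
  This restriction lets \<open>conj_H\<close> strip one application of \<open>H\<close> from the
  orbit point it compares with.\<close>

lemma approx_eqI:
  fixes x y :: real
  assumes "\<And>n m. n \<ge> 1 \<Longrightarrow> real n * rot + of_int m < x \<Longrightarrow> real n * rot + of_int m \<le> y"
    and "\<And>n m. n \<ge> 1 \<Longrightarrow> real n * rot + of_int m < y \<Longrightarrow> real n * rot + of_int m \<le> x"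
  shows "x = y"
proof (rule ccontr)
  assume "x \<noteq> y"
  then consider "x < y" | "y < x"
    by linarith
  then show False
  proof cases
    case 1
    then obtain n m where "n \<ge> 1" "x < real n * rot + of_int m" "real n * rot + of_int m < y"
      using irrational_multiples_dense[OF rot_irrational] by blast
    then show False
      using assms(2)[of n m] by auto
  next
    case 2
    then obtain n m where "n \<ge> 1" "y < real n * rot + of_int m" "real n * rot + of_int m < x"
      using irrational_multiples_dense[OF rot_irrational] by blast
    then show False
      using assms(1)[of n m] by auto
  qed
qed

lemma less_conjD: "real n * rot + of_int m < conj t \<Longrightarrow> (H ^^ n) 0 + of_int m \<le> t"
  using conj_le[of t n m] by linarith

lemma conj_add_1: "conj (t + 1) = conj t + 1"
proof (rule approx_eqI)
  fix n :: nat and m :: int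
  { assume "real n * rot + of_int m < conj (t + 1)"
    from less_conjD[OF this] have "(H ^^ n) 0 + of_int (m - 1) \<le> t"
      by simp
    from conj_ge[OF this] show "real n * rot + of_int m \<le> conj t + 1"
      by simp }
  { assume "real n * rot + of_int m < conj t + 1"
    then have "real n * rot + of_int (m - 1) < conj t"
      by simp
    from less_conjD[OF this] have "(H ^^ n) 0 + of_int m \<le> t + 1"
      by simp
    from conj_ge[OF this] show "real n * rot + of_int m \<le> conj (t + 1)" . }
qed

lemma conj_H: "conj (H t) = conj t + rot"
proof (rule approx_eqI)
  fix n :: nat and m :: int assume n: "n \<ge> 1"
  then obtain l where l: "n = Suc l"
    by (cases n) auto
  have *: "(H ^^ n) 0 + of_int m \<le> H t \<longleftrightarrow> (H ^^ l) 0 + of_int m \<le> t"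
    using strict_mono_less_eq[OF strict_H, of "(H ^^ l) 0 + of_int m" t] by (simp add: l H_add_int)
  { assume "real n * rot + of_int m < conj (H t)"
    from less_conjD[OF this] * have "(H ^^ l) 0 + of_int m \<le> t"
      by simp
    from conj_ge[OF this] show "real n * rot + of_int m \<le> conj t + rot"
      by (simp add: l algebra_simps) }
  { assume "real n * rot + of_int m < conj t + rot"
    then have "real l * rot + of_int m < conj t"
      by (simp add: l algebra_simps)
    from less_conjD[OF this] * have "(H ^^ n) 0 + of_int m \<le> H t"
      by simp
    from conj_ge[OF this] show "real n * rot + of_int m \<le> conj (H t)" . }
qed

lemma continuous_conj: "continuous_on UNIV conj"
  unfolding continuous_on_iff
proof clarify
  fix t d :: real assume d: "0 < d"
  obtain n m where lo: "conj t - d < real n * rot + of_int m" "real n * rot + of_int m < conj t"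
    using irrational_multiples_dense[OF rot_irrational, of "conj t - d" "conj t"] d
    by (metis diff_less_eq less_add_same_cancel1)
  obtain n' m' where hi: "conj t < real n' * rot + of_int m'" "real n' * rot + of_int m' < conj t + d"
    using irrational_multiples_dense[OF rot_irrational, of "conj t" "conj t + d"] d
    by (metis less_add_same_cancel1)
  let ?a = "(H ^^ n) 0 + of_int m" and ?b = "(H ^^ n') 0 + of_int m'"
  \<comment> \<open>\<open>less_conjD\<close> yields only a weak inequality; a second orbit point in
    between makes \<open>?a < t\<close> strict.\<close>
  obtain n2 m2 where lo2: "real n * rot + of_int m < real n2 * rot + of_int m2" "real n2 * rot + of_int m2 < conj t"
    using irrational_multiples_dense[OF rot_irrational lo(2)] by blast
  have "?a < t"
    using less_conjD[OF lo2(2)] lo2(1) orbit_order[of n m n2 m2] by linarith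
  moreover have "t < ?b"
    using conj_ge[of n' m' t] hi(1) by linarith
  ultimately obtain s where s: "s > 0" "s \<le> t - ?a" "s \<le> ?b - t"
    by (metis diff_gt_0_iff_gt field_lbound_gt_zero less_imp_le)
  show "\<exists>s>0. \<forall>x\<in>UNIV. dist x t < s \<longrightarrow> dist (conj x) (conj t) < d"
  proof (intro exI[of _ s] conjI ballI impI)
    fix x assume "dist x t < s"
    then have "?a \<le> x" "x < ?b"
      using s by (auto simp: dist_real_def)
    then show "dist (conj x) (conj t) < d"
      using conj_ge[of n m x] conj_le[of x n' m'] lo hi by (auto simp: dist_real_def)
  qed (use s in simp)
qed

end

section \<open>Transitive maps and free arcs\<close>

locale compact_transitive =
  fixes X :: "'a topology" and f :: "'a \<Rightarrow> 'a"
  assumes compact: "compact_space X"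
    and hausdorff: "Hausdorff_space X"
    and transitive: "transitive_map X f"
begin

lemma continuous_f: "continuous_map X X f"
  using transitive by (simp add: transitive_map_def)

lemma continuous_iterate: "continuous_map X X (f ^^ n)"
proof (induction n)
  case (Suc n)
  then show ?case
    using continuous_map_compose[OF Suc continuous_f] by (simp add: o_def)
qed simp

lemma iterate_in: "x \<in> topspace X \<Longrightarrow> (f ^^ n) x \<in> topspace X"
  using continuous_iterate[of n] unfolding continuous_map_def by blast

lemma iterate_image_subset: "S \<subseteq> topspace X \<Longrightarrow> (f ^^ n) ` S \<subseteq> topspace X"
  using iterate_in by blast

lemma iterate_closed: "closedin X A \<Longrightarrow> closedin X ((f ^^ n) ` A)"
  using closedin_compact_space[OF compact] image_compactin[OF _ continuous_iterate]
    compactin_imp_closedin[OF hausdorff] by blast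

definition preim :: "nat \<Rightarrow> 'a set \<Rightarrow> 'a set" where
  "preim n V = {x \<in> topspace X. (f ^^ n) x \<in> V}"

lemma openin_preim: "openin X V \<Longrightarrow> openin X (preim n V)"
  unfolding preim_def by (rule openin_continuous_map_preimage[OF continuous_iterate])

lemma closedin_preim: "closedin X V \<Longrightarrow> closedin X (preim n V)"
  unfolding preim_def by (rule closedin_continuous_map_preimage[OF continuous_iterate])

text \<open>Aiming at the part of \<open>U\<close> that reaches \<open>V\<close> after
  \<open>n\<close> steps prolongs the hitting time by at least one step.\<close>

lemma meet_ge:
  assumes "openin X U" "U \<noteq> {}" "openin X V" "V \<noteq> {}"
  shows "\<exists>n\<ge>N. n \<ge> 1 \<and> (f ^^ n) ` U \<inter> V \<noteq> {}"
proof (induction N)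
  case 0
  then show ?case
    using transitive assms unfolding transitive_map_def by blast
next
  case (Suc N)
  then obtain n x where n: "n \<ge> N" "x \<in> U" "(f ^^ n) x \<in> V"
    by blast
  let ?W = "U \<inter> preim n V"
  have "openin X ?W"
    using assms openin_preim by blast
  moreover have "?W \<noteq> {}"
    using n openin_subset[OF assms(1)] by (auto simp: preim_def)
  ultimately obtain m where m: "m \<ge> 1" "(f ^^ m) ` U \<inter> ?W \<noteq> {}"
    using transitive assms(1,2) unfolding transitive_map_def by blast
  then obtain y where "y \<in> U" "(f ^^ m) y \<in> ?W"
    by blast
  then have "(f ^^ (n + m)) y \<in> V"
    by (simp add: preim_def funpow_add)
  then show ?case
    using n(1) m(1) \<open>y \<in> U\<close> by (intro exI[of _ "n + m"]) auto
qed

lemma meet: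
  assumes "openin X U" "U \<noteq> {}" "openin X V" "V \<noteq> {}"
  obtains n where "n \<ge> 1" "(f ^^ n) ` U \<inter> V \<noteq> {}"
  using meet_ge[OF assms, of 0] by blast

text \<open>The sets \<open>U \<supseteq> W 1 \<supseteq> W 2 \<supseteq> \<dots>\<close> shrink so that each returns into its predecessor; two of the
  accumulated return times agree modulo \<open>k\<close>.\<close>

lemma recurrent_multiple:
  assumes U: "openin X U" "U \<noteq> {}" and k: "k \<ge> 1"
  obtains j where "j \<ge> 1" "(f ^^ (k * j)) ` U \<inter> U \<noteq> {}"
proof -
  have "\<exists>g :: nat \<Rightarrow> 'a set \<times> nat. \<forall>i. (openin X (fst (g i)) \<and> fst (g i) \<noteq> {} \<and> fst (g i) \<subseteq> U) \<and>
      (snd (g i) < snd (g (Suc i)) \<and> fst (g (Suc i)) \<subseteq> fst (g i) \<and>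
       (f ^^ (snd (g (Suc i)) - snd (g i))) ` fst (g (Suc i)) \<subseteq> fst (g i))"
  proof (rule dependent_nat_choice)
    show "\<exists>x::'a set \<times> nat. openin X (fst x) \<and> fst x \<noteq> {} \<and> fst x \<subseteq> U"
      by (rule exI[of _ "(U, 0)"]) (use U in simp)
  next
    fix x :: "'a set \<times> nat" and n :: nat
    assume x: "openin X (fst x) \<and> fst x \<noteq> {} \<and> fst x \<subseteq> U"
    with meet[of "fst x" "fst x"] obtain m where m: "m \<ge> 1" "(f ^^ m) ` fst x \<inter> fst x \<noteq> {}"
      by metis
    show "\<exists>y. (openin X (fst y) \<and> fst y \<noteq> {} \<and> fst y \<subseteq> U) \<and>
        (snd x < snd y \<and> fst y \<subseteq> fst x \<and> (f ^^ (snd y - snd x)) ` fst y \<subseteq> fst x)"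
    proof (intro exI[of _ "(fst x \<inter> preim m (fst x), snd x + m)"] conjI)
      show "openin X (fst (fst x \<inter> preim m (fst x), snd x + m))"
        using x openin_preim by auto
      show "fst (fst x \<inter> preim m (fst x), snd x + m) \<noteq> {}"
        using m(2) x openin_subset[of X "fst x"] by (auto simp: preim_def)
    qed (use x m in \<open>auto simp: preim_def\<close>)
  qed
  then obtain g :: "nat \<Rightarrow> 'a set \<times> nat" where g:
      "\<And>i. openin X (fst (g i)) \<and> fst (g i) \<noteq> {} \<and> fst (g i) \<subseteq> U"
      "\<And>i. snd (g i) < snd (g (Suc i)) \<and> fst (g (Suc i)) \<subseteq> fst (g i) \<and>
         (f ^^ (snd (g (Suc i)) - snd (g i))) ` fst (g (Suc i)) \<subseteq> fst (g i)"
    by blast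
  define W s where "W = fst \<circ> g" and "s = snd \<circ> g"
  then have W: "\<And>i. openin X (W i)" "\<And>i. W i \<noteq> {}" "\<And>i. W i \<subseteq> U"
    and s: "\<And>i. s i < s (Suc i)"
    and ret: "\<And>i. (f ^^ (s (Suc i) - s i)) ` W (Suc i) \<subseteq> W i"
    using g by auto
  have smono: "strict_mono s"
    using s by (simp add: strict_mono_Suc_iff)
  have chain: "(f ^^ (s (i + n) - s i)) ` W (i + n) \<subseteq> W i" for i n
  proof (induction n)
    case (Suc n)
    have le: "s i \<le> s (i + n)" "s (i + n) \<le> s (Suc (i + n))"
      using smono by (simp_all add: strict_mono_less_eq)
    then have "s (i + Suc n) - s i = (s (i + n) - s i) + (s (Suc (i + n)) - s (i + n))"
      by simp
    then have "(f ^^ (s (i + Suc n) - s i)) ` W (i + Suc n)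
        = (f ^^ (s (i + n) - s i)) ` ((f ^^ (s (Suc (i + n)) - s (i + n))) ` W (Suc (i + n)))"
      by (simp only: funpow_add image_comp add_Suc_right)
    also have "\<dots> \<subseteq> W i"
      using Suc ret[of "i + n"] by blast
    finally show ?case .
  qed simp
  have "\<not> inj_on (\<lambda>i. s i mod k) {..k}"
  proof
    assume "inj_on (\<lambda>i. s i mod k) {..k}"
    then have "card {..k} \<le> card {..<k}"
      using k by (intro card_inj_on_le[of "\<lambda>i. s i mod k"]) auto
    then show False by simp
  qed
  then obtain a b where ab: "a < b" "s a mod k = s b mod k"
    unfolding inj_on_def by (metis linorder_neqE_nat)
  have "s a < s b"
    using smono ab(1) by (simp add: strict_mono_less)
  moreover have "k dvd s b - s a"
    using ab(2) \<open>s a < s b\<close> by (metis mod_eq_dvd_iff_nat less_imp_le)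
  ultimately obtain j where j: "s b - s a = k * j"
    by blast
  then have "j \<ge> 1"
    using \<open>s a < s b\<close> by (cases j) auto
  moreover have "(f ^^ (k * j)) ` W b \<subseteq> W a"
    using chain[of a "b - a"] ab(1) j by simp
  then have "(f ^^ (k * j)) ` U \<inter> U \<noteq> {}"
    using W(2)[of b] W(3)[of a] W(3)[of b] by blast
  ultimately show ?thesis
    using that by blast
qed

lemma closed_invariant_eq:
  assumes A: "closedin X A" "f ` A \<subseteq> A" and U: "openin X U" "U \<noteq> {}" "U \<subseteq> A"
  shows "A = topspace X"
proof (rule ccontr)
  assume "A \<noteq> topspace X"
  then have "openin X (topspace X - A)" "topspace X - A \<noteq> {}"
    using A(1) closedin_subset[OF A(1)] by auto
  from meet[OF U(1,2) this] obtain n where "(f ^^ n) ` U \<inter> (topspace X - A) \<noteq> {}" .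
  moreover have "(f ^^ n) ` A \<subseteq> A" for n
    by (induction n) (use A(2) in auto)
  ultimately show False
    using U(3) by blast
qed

lemma iterate_invariant:
  assumes "(f ^^ k) ` A \<subseteq> A"
  shows "(f ^^ (k * j)) ` A \<subseteq> A"
proof (induction j)
  case (Suc j)
  have "(f ^^ (k * Suc j)) ` A = (f ^^ k) ` ((f ^^ (k * j)) ` A)"
    by (simp add: funpow_add image_comp)
  then show ?case
    using Suc assms by (simp, blast)
qed simp

lemma image_iterate_fixed:
  assumes "(f ^^ k) ` A = A"
  shows "(f ^^ (k * j)) ` A = A"
proof (induction j)
  case (Suc j)
  have "(f ^^ (k * Suc j)) ` A = (f ^^ k) ` ((f ^^ (k * j)) ` A)"
    by (simp only: mult_Suc_right funpow_add image_comp)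
  then show ?case
    using Suc assms by simp
qed simp

text \<open>Iterating the inclusion gives \<open>(f ^^ i)\<close> A \<subseteq> (f ^^ (k * i))
  \<open>A\<close>, and invariance under \<open>f ^^ k\<close> brings the right-hand side back into
  \<open>A\<close>.\<close>

lemma expanding_image_fixed:
  assumes k: "k \<ge> 1" "(f ^^ k) ` A \<subseteq> A" and i: "A \<subseteq> (f ^^ i) ` A"
  shows "(f ^^ i) ` A = A"
proof -
  have step: "(f ^^ i) ` A \<subseteq> (f ^^ (i * Suc m)) ` A" for m
  proof (induction m)
    case (Suc m)
    have "(f ^^ i) ` A \<subseteq> (f ^^ i) ` ((f ^^ (i * Suc m)) ` A)"
      using i Suc by blast
    also have "\<dots> = (f ^^ (i * Suc (Suc m))) ` A"
      by (simp add: image_comp flip: funpow_add)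
    finally show ?case .
  qed simp
  have "(f ^^ i) ` A \<subseteq> (f ^^ (k * i)) ` A"
    using step[of "k - 1"] k(1) by (simp add: mult.commute)
  then show ?thesis
    using iterate_invariant[OF k(2), of i] i by blast
qed

text \<open>The union is closed and has interior, and it is invariant under \<open>f\<close> because
  the image after \<open>k\<close> steps folds back into \<open>A\<close>.\<close>

lemma invariant_images_cover:
  assumes k: "k \<ge> 1" and A: "closedin X A" "(f ^^ k) ` A \<subseteq> A"
    and U: "openin X U" "U \<noteq> {}" "U \<subseteq> A"
  shows "(\<Union>i<k. (f ^^ i) ` A) = topspace X"
proof (rule closed_invariant_eq[OF _ _ U(1,2)])
  show "closedin X (\<Union>i<k. (f ^^ i) ` A)"
    using A(1) by (intro closedin_Union) (auto intro: iterate_closed)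
  show "U \<subseteq> (\<Union>i<k. (f ^^ i) ` A)"
    using U(3) k by (intro subset_trans[OF U(3)] subsetI UN_I[of 0]) auto
  show "f ` (\<Union>i<k. (f ^^ i) ` A) \<subseteq> (\<Union>i<k. (f ^^ i) ` A)"
  proof clarify
    fix i x assume "i < k" "x \<in> A"
    show "f ((f ^^ i) x) \<in> (\<Union>i<k. (f ^^ i) ` A)"
    proof (cases "Suc i < k")
      case True
      then show ?thesis
        using \<open>x \<in> A\<close> by (intro UN_I[of "Suc i"]) auto
    next
      case False
      then have "Suc i = k"
        using \<open>i < k\<close> by simp
      then have "f ((f ^^ i) x) \<in> A"
        using A(2) \<open>x \<in> A\<close> by (metis comp_apply funpow.simps(2) image_subset_iff)
      then show ?thesis
        using k by (intro UN_I[of 0]) auto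
    qed
  qed
qed

section \<open>Smallest closed sets containing a given set and invariant under an iterate\<close>

definition orbit_hull :: "nat \<Rightarrow> 'a set \<Rightarrow> 'a set" where
  "orbit_hull N U = X closure_of (\<Union>k. (f ^^ (N * k)) ` U)"

lemma closedin_orbit_hull [simp]: "closedin X (orbit_hull N U)"
  by (simp add: orbit_hull_def)

lemma orbit_hull_mono: "U \<subseteq> V \<Longrightarrow> orbit_hull N U \<subseteq> orbit_hull N V"
  unfolding orbit_hull_def by (intro closure_of_mono) blast

lemma orbit_hull_dvd: "N dvd M \<Longrightarrow> orbit_hull M U \<subseteq> orbit_hull N U"
proof -
  assume "N dvd M"
  then obtain j where "M = N * j" ..
  then have "(\<Union>k. (f ^^ (M * k)) ` U) \<subseteq> (\<Union>k. (f ^^ (N * k)) ` U)"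
    by (simp only: mult.assoc) blast
  then show ?thesis
    unfolding orbit_hull_def by (rule closure_of_mono)
qed

lemma subset_orbit_hull: "U \<subseteq> topspace X \<Longrightarrow> U \<subseteq> orbit_hull N U"
proof -
  assume U: "U \<subseteq> topspace X"
  have "U = (f ^^ (N * 0)) ` U"
    by simp
  then have "U \<subseteq> (\<Union>k. (f ^^ (N * k)) ` U)"
    by blast
  moreover have "(\<Union>k. (f ^^ (N * k)) ` U) \<subseteq> topspace X"
    using iterate_image_subset[OF U] by blast
  ultimately show ?thesis
    unfolding orbit_hull_def using closure_of_subset by blast
qed

text \<open>Continuity gives one inclusion; the other holds because iterates are closed maps on a
  compact Hausdorff space.\<close>

lemma image_orbit_hull:
  assumes "U \<subseteq> topspace X"
  shows "(f ^^ i) ` orbit_hull N U = orbit_hull N ((f ^^ i) ` U)"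
proof -
  let ?W = "\<Union>k. (f ^^ (N * k)) ` U"
  have W: "?W \<subseteq> topspace X"
    using iterate_image_subset[OF assms] by blast
  have "closed_map X X (f ^^ i)"
    by (simp add: closed_map_def iterate_closed)
  then have "X closure_of ((f ^^ i) ` ?W) \<subseteq> (f ^^ i) ` (X closure_of ?W)"
    using W unfolding closed_map_closure_of_image by blast
  moreover have "(f ^^ i) ` (X closure_of ?W) \<subseteq> X closure_of ((f ^^ i) ` ?W)"
    using continuous_iterate by (rule continuous_map_image_closure_subset)
  moreover have "(f ^^ i) ` ?W = (\<Union>k. (f ^^ (N * k)) ` ((f ^^ i) ` U))"
  proof -
    have "(f ^^ i) ` ((f ^^ n) ` U) = (f ^^ n) ` ((f ^^ i) ` U)" for n
      by (simp only: image_comp flip: funpow_add) (simp only: add.commute)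
    then show ?thesis
      by (simp only: image_UN)
  qed
  ultimately show ?thesis
    unfolding orbit_hull_def by simp
qed

lemma orbit_hull_least:
  assumes "closedin X A" "(f ^^ N) ` A \<subseteq> A" "U \<subseteq> A"
  shows "orbit_hull N U \<subseteq> A"
proof -
  have "(f ^^ (N * k)) ` U \<subseteq> A" for k
    using iterate_invariant[OF assms(2), of k] assms(3) by blast
  then show ?thesis
    unfolding orbit_hull_def by (intro closure_of_minimal[OF _ assms(1)]) blast
qed

lemma orbit_hull_invariant:
  assumes "U \<subseteq> topspace X"
  shows "(f ^^ N) ` orbit_hull N U \<subseteq> orbit_hull N U"
proof -
  have "(f ^^ N) ` orbit_hull N U = X closure_of (\<Union>k. (f ^^ (N * k)) ` ((f ^^ N) ` U))"
    using image_orbit_hull[OF assms] by (simp add: orbit_hull_def)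
  moreover have "(f ^^ (N * k)) ` ((f ^^ N) ` U) = (f ^^ (N * Suc k)) ` U" for k
    by (simp only: image_comp flip: funpow_add) (simp add: add.commute)
  ultimately show ?thesis
    unfolding orbit_hull_def by (simp only:) (intro closure_of_mono, blast)
qed

end

lemma affine_between:
  fixes a b x :: real
  assumes "a < b" "0 < x" "x < 1"
  shows "a < a + (b - a) * x" "a + (b - a) * x < b"
proof -
  have "0 < (b - a) * x" "(b - a) * x < (b - a) * 1"
    using assms by (auto intro!: mult_strict_left_mono)
  then show "a < a + (b - a) * x" "a + (b - a) * x < b"
    unfolding mult_1_right by linarith+
qed

text \<open>A free interval enters through an open embedding of the unit interval, so that shrinking
  it is an affine reparametrization.\<close>

locale free_arc =
  fixes X :: "'a topology" and e :: "real \<Rightarrow> 'a"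
  assumes continuous_arc: "continuous_map (top_of_set {0<..<1}) X e"
    and inj_arc: "inj_on e {0<..<1}"
    and open_arc: "\<And>S. open S \<Longrightarrow> S \<subseteq> {0<..<1} \<Longrightarrow> openin X (e ` S)"
begin

lemma arc_in: "0 < x \<Longrightarrow> x < 1 \<Longrightarrow> e x \<in> topspace X"
  using continuous_arc by (auto simp: continuous_map_def)

lemma arc_eq_iff: "0 < x \<Longrightarrow> x < 1 \<Longrightarrow> 0 < y \<Longrightarrow> y < 1 \<Longrightarrow> e x = e y \<longleftrightarrow> x = y"
  using inj_arc by (auto simp: inj_on_def)

lemma open_arc_interval: "0 \<le> a \<Longrightarrow> b \<le> 1 \<Longrightarrow> openin X (e ` {a<..<b})"
  by (intro open_arc) auto

lemma continuous_arc_on: "S \<subseteq> {0<..<1} \<Longrightarrow> continuous_map (top_of_set S) X e"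
  using continuous_map_from_subtopology[OF continuous_arc, of S]
  by (simp add: subtopology_subtopology Int_absorb1)

lemma connected_arc: "S \<subseteq> {0<..<1} \<Longrightarrow> connected S \<Longrightarrow> connectedin X (e ` S)"
  using connectedin_continuous_map_image[OF continuous_arc_on, of S S]
  by (simp add: connectedin_absolute connectedin_subtopology)

lemma compact_arc: "S \<subseteq> {0<..<1} \<Longrightarrow> compact S \<Longrightarrow> compactin X (e ` S)"
  using image_compactin[of "top_of_set S" S X e] continuous_arc_on[of S]
  by (simp add: compactin_subtopology)

lemma open_subset_arc:
  assumes "openin X U" "e x \<in> U" "0 < x" "x < 1"
  obtains a b where "0 < a" "a < x" "x < b" "b < 1" "e ` {a<..<b} \<subseteq> U"
proof -
  have "openin (top_of_set {0<..<1}) {z \<in> {0<..<1}. e z \<in> U}"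
    using openin_continuous_map_preimage[OF continuous_arc assms(1)] by simp
  then have "open {z \<in> {0<..<1}. e z \<in> U}"
    by (simp add: openin_open_eq)
  then obtain d where d: "d > 0" "ball x d \<subseteq> {z \<in> {0<..<1}. e z \<in> U}"
    using assms unfolding open_contains_ball by force
  let ?d = "d / 2"
  have m: "x - ?d \<in> ball x d" "x + ?d \<in> ball x d"
    using d(1) by (auto simp: dist_real_def)
  show ?thesis
  proof (rule that[of "x - ?d" "x + ?d"])
    show "e ` {x - ?d<..<x + ?d} \<subseteq> U"
      using d by (force simp: dist_real_def)
    have "x - ?d \<in> {0<..<1}" "x + ?d \<in> {0<..<1}"
      using m d(2) by blast+
    then show "0 < x - ?d" "x + ?d < 1"
      by auto
  qed (use d(1) in auto)
qed

lemma open_meets_arc: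
  assumes "openin X U" "U \<inter> e ` {a<..<b} \<noteq> {}" "0 \<le> a" "b \<le> 1"
  obtains c d where "a < c" "c < d" "d < b" "e ` {c..d} \<subseteq> U"
proof -
  obtain x where x: "a < x" "x < b" "e x \<in> U"
    using assms(2) by auto
  have "openin X (U \<inter> e ` {a<..<b})"
    using assms open_arc_interval by blast
  then obtain c d where cd: "0 < c" "c < x" "x < d" "d < 1" "e ` {c<..<d} \<subseteq> U \<inter> e ` {a<..<b}"
    using open_subset_arc[of "U \<inter> e ` {a<..<b}" x] x assms by auto
  let ?c = "max ((a + x) / 2) ((c + x) / 2)" and ?d = "min ((b + x) / 2) ((d + x) / 2)"
  show ?thesis
  proof (rule that[of ?c ?d])
    have "{?c..?d} \<subseteq> {c<..<d}"
      using cd x by auto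
    then show "e ` {?c..?d} \<subseteq> U"
      using cd(5) by blast
    show "a < ?c" "?d < b" "?c < ?d"
      using cd x by (simp_all add: less_max_iff_disj min_less_iff_disj) (simp_all add: max_def)
  qed
qed

end

locale transitive_arc = compact_transitive X f + free_arc X e
  for X :: "'a topology" and f :: "'a \<Rightarrow> 'a" and e :: "real \<Rightarrow> 'a"
begin

lemma closed_arc: "S \<subseteq> {0<..<1} \<Longrightarrow> compact S \<Longrightarrow> closedin X (e ` S)"
  using compact_arc hausdorff compactin_imp_closedin by blast

text \<open>The open arc between \<open>e c\<close> and \<open>e d\<close> and the complement of the
  closed one are disjoint open sets. They cover every set that avoids both endpoints, so a connected
  one lies in a single part.\<close>

lemma connected_trapped:
  assumes C: "connectedin X C" and cd: "0 < c" "d < 1" "e c \<notin> C" "e d \<notin> C"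
    and meet: "C \<inter> e ` {c<..<d} \<noteq> {}"
  shows "C \<subseteq> e ` {c<..<d}"
proof -
  have ec: "e ` {c..d} = insert (e c) (insert (e d) (e ` {c<..<d}))" if "c \<le> d"
  proof -
    have "{c..d} = insert c (insert d {c<..<d})"
      using that by auto
    then show ?thesis
      by simp
  qed
  have "c < d"
    using meet by auto
  have "{c..d} \<subseteq> {0<..<1}"
    using cd by auto
  then have o: "openin X (e ` {c<..<d})" "openin X (topspace X - e ` {c..d})"
    using cd closed_arc[of "{c..d}"] by (simp_all add: open_arc_interval openin_diff)
  have sub: "C \<subseteq> e ` {c<..<d} \<union> (topspace X - e ` {c..d})"
    using connectedin_subset_topspace[OF C] cd(3,4) unfolding ec[OF less_imp_le[OF \<open>c < d\<close>]]
    by blast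
  have "e ` {c<..<d} \<inter> (topspace X - e ` {c..d}) \<inter> C = {}"
    unfolding ec[OF less_imp_le[OF \<open>c < d\<close>]] by blast
  then have "(topspace X - e ` {c..d}) \<inter> C = {}"
    using connectedinD[OF C o sub] meet by blast
  then show ?thesis
    using sub by blast
qed

lemma transitive_subarc:
  assumes "0 \<le> a" "a < b" "b \<le> 1"
  shows "transitive_arc X f (\<lambda>x. e (a + (b - a) * x))"
proof (unfold_locales)
  let ?l = "\<lambda>x. a + (b - a) * x"
  have l: "?l x \<in> {0<..<1}" if "x \<in> {0<..<1}" for x
    using affine_between[OF assms(2), of x] that assms(1,3) unfolding greaterThanLessThan_iff by linarith
  show "continuous_map (top_of_set {0<..<1}) X (\<lambda>x. e (?l x))"
  proof -
    have "continuous_on {0<..<1} ?l"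
      by (intro continuous_intros)
    then have "continuous_map (top_of_set {0<..<1}) (top_of_set {0<..<1}) ?l"
      using l by (simp add: image_subset_iff)
    from continuous_map_compose[OF this continuous_arc] show ?thesis
      by (simp add: o_def)
  qed
  show "inj_on (\<lambda>x. e (?l x)) {0<..<1}"
  proof (rule inj_onI)
    fix x y assume "x \<in> {0<..<1}" "y \<in> {0<..<1}" "e (?l x) = e (?l y)"
    then have "?l x = ?l y"
      using l by (meson inj_arc inj_onD)
    then show "x = y"
      using assms by simp
  qed
  show "openin X ((\<lambda>x. e (?l x)) ` S)" if "open S" "S \<subseteq> {0<..<1}" for S
  proof -
    have "open (?l ` S)"
    proof -
      have "?l ` S = (+) a ` ((*\<^sub>R) (b - a) ` S)"
        by (auto simp: image_image)
      then show ?thesis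
        using assms open_translation[OF open_scaling[OF _ that(1), of "b - a"], of a] by simp
    qed
    moreover have "?l ` S \<subseteq> {0<..<1}"
      using l that(2) by blast
    ultimately show ?thesis
      using open_arc[of "?l ` S"] by (simp add: image_image)
  qed
qed

end

section \<open>Dense periodic points in the arc\<close>

text \<open>A finite form of Baire's theorem: if the last closed set does not contain
  \<open>V\<close>, removing it leaves a nonempty open set covered by the remaining ones.\<close>

lemma closed_cover_open_subset:
  assumes "openin X V" "V \<noteq> {}" "V \<subseteq> (\<Union>i<n. C i)" "\<And>i. i < n \<Longrightarrow> closedin X (C i)"
  shows "\<exists>i<n. \<exists>W. openin X W \<and> W \<noteq> {} \<and> W \<subseteq> V \<inter> C (i::nat)"
  using assms
proof (induction n arbitrary: V)
  case (Suc n)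
  show ?case
  proof (cases "V \<subseteq> C n")
    case True
    then show ?thesis
      using Suc.prems by (intro exI[of _ n]) auto
  next
    case False
    have "openin X (V - C n)"
      using Suc.prems by (intro openin_diff) auto
    moreover have "V - C n \<subseteq> (\<Union>i<n. C i)"
      using Suc.prems(3) unfolding lessThan_Suc by blast
    ultimately obtain i W where "i < n" "openin X W" "W \<noteq> {}" "W \<subseteq> (V - C n) \<inter> C i"
      using Suc.IH[of "V - C n"] Suc.prems(4) False by auto
    then show ?thesis
      by (intro exI[of _ i]) auto
  qed
qed auto

section \<open>Hulls of intervals and full arcs\<close>

locale periodic_arc = transitive_arc +
  assumes periodic: "0 \<le> a \<Longrightarrow> a < b \<Longrightarrow> b \<le> 1 \<Longrightarrow> \<exists>x n. a < x \<and> x < b \<and> n \<ge> 1 \<and> (f ^^ n) (e x) = e x"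
begin

lemma funpow_period: "(f ^^ n) x = x \<Longrightarrow> (f ^^ (n * k)) x = x"
  by (induction k) (auto simp: funpow_add)

lemma funpow_period_dvd: "(f ^^ n) x = x \<Longrightarrow> n dvd m \<Longrightarrow> (f ^^ m) x = x"
  using funpow_period by (auto elim: dvdE)

lemma periodic_subarc:
  assumes ab: "0 \<le> a" "a < b" "b \<le> 1"
  shows "periodic_arc X f (\<lambda>x. e (a + (b - a) * x))"
proof -
  interpret sub: transitive_arc X f "\<lambda>x. e (a + (b - a) * x)"
    using transitive_subarc[OF ab] .
  show ?thesis
  proof
    fix s t :: real assume st: "0 \<le> s" "s < t" "t \<le> 1"
    have "a + (b - a) * t \<le> a + (b - a) * 1"
      using st ab by (intro add_left_mono mult_left_mono) auto
    then obtain x n where x: "a + (b - a) * s < x" "x < a + (b - a) * t" "n \<ge> 1" "(f ^^ n) (e x) = e x"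
      using periodic[of "a + (b - a) * s" "a + (b - a) * t"] st ab by auto
    have "a + (b - a) * ((x - a) / (b - a)) = x"
      using ab by simp
    moreover have "s < (x - a) / (b - a)" "(x - a) / (b - a) < t"
      using x ab by (simp_all add: field_simps)
    ultimately show "\<exists>x n. s < x \<and> x < t \<and> n \<ge> 1 \<and> (f ^^ n) (e (a + (b - a) * x)) = e (a + (b - a) * x)"
      using x by metis
  qed
qed

text \<open>A periodic orbit is finite, so the parameters at which it meets the arc stay away from
  the points slightly to the right of 0.\<close>

lemma avoid_orbit:
  obtains p a b where "p \<in> topspace X" "0 \<le> a" "a < b" "b \<le> 1" "\<And>i x. a < x \<Longrightarrow> x < b \<Longrightarrow> (f ^^ i) p \<noteq> e x"
proof -
  obtain z n where z: "0 < z" "z < 1" "n \<ge> 1" "(f ^^ n) (e z) = e z"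
    using periodic[of 0 1] by auto
  let ?S = "{x \<in> {0<..<1}. e x \<in> (\<lambda>i. (f ^^ i) (e z)) ` {..<n}}"
  have "finite ?S"
  proof (rule inj_on_finite[of e])
    show "inj_on e ?S"
      using inj_arc by (rule inj_on_subset) auto
    show "e ` ?S \<subseteq> (\<lambda>i. (f ^^ i) (e z)) ` {..<n}"
      by blast
  qed simp
  have fin: "\<exists>b>0. b \<le> 1 \<and> (\<forall>x. 0 < x \<and> x < b \<longrightarrow> x \<notin> T)" if "finite T" for T :: "real set"
    using that
  proof (induction T)
    case empty
    then show ?case
      by (intro exI[of _ 1]) auto
  next
    case (insert y T)
    then obtain b where b: "b > 0" "b \<le> 1" "\<And>x. 0 < x \<Longrightarrow> x < b \<Longrightarrow> x \<notin> T"
      by blast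
    then show ?case
      by (intro exI[of _ "if 0 < y then min b y else b"]) auto
  qed
  obtain b where b: "b > 0" "b \<le> 1" "\<And>x. 0 < x \<Longrightarrow> x < b \<Longrightarrow> x \<notin> ?S"
    using fin[OF \<open>finite ?S\<close>] by blast
  show ?thesis
  proof (rule that[of "e z" 0 b])
    fix i x assume x: "0 < x" "x < b"
    have "(f ^^ i) (e z) = (f ^^ (i mod n)) ((f ^^ (n * (i div n))) (e z))"
      by (metis comp_apply funpow_add mod_mult_div_eq)
    then have "(f ^^ i) (e z) = (f ^^ (i mod n)) (e z)"
      using funpow_period[OF z(4)] by simp
    moreover have "i mod n < n"
      using z(3) by simp
    ultimately show "(f ^^ i) (e z) \<noteq> e x"
      using b(3)[OF x] x b(2) by (metis (mono_tags, lifting) greaterThanLessThan_iff imageI lessThan_iff less_le_trans mem_Collect_eq)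
  qed (use z b arc_in in auto)
qed

end

locale escaping_arc = periodic_arc +
  assumes escape: "\<exists>p\<in>topspace X. \<forall>i x. 0 < x \<and> x < 1 \<longrightarrow> (f ^^ i) p \<noteq> e x"
begin

text \<open>If both alternatives fail, the iterates of \<open>e ` {a<..<b}\<close> through a periodic point are trapped
  in a compact subarc, so every orbit enters the arc.\<close>

lemma hull_one_side:
  assumes N: "N \<ge> 1" and ab: "0 \<le> a" "a < b" "b \<le> 1"
  shows "e ` {0<..a} \<subseteq> orbit_hull N (e ` {a<..<b}) \<or> e ` {b..<1} \<subseteq> orbit_hull N (e ` {a<..<b})"
proof (rule ccontr)
  let ?U = "e ` {a<..<b}"
  assume "\<not> ?thesis"
  then obtain c d where c: "0 < c" "c \<le> a" "e c \<notin> orbit_hull N ?U"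
    and d: "b \<le> d" "d < 1" "e d \<notin> orbit_hull N ?U"
    unfolding image_subset_iff by (metis greaterThanAtMost_iff atLeastLessThan_iff)
  obtain z p where z: "a < z" "z < b" "p \<ge> 1" "(f ^^ p) (e z) = e z"
    using periodic[OF ab] by auto
  \<comment> \<open>Multiples of \<open>p\<close> fix \<open>e z\<close>, so the iterates share a
    point; multiples of \<open>N\<close> keep them inside the given hull.\<close>
  let ?M = "N * p"
  have Usub: "?U \<subseteq> topspace X"
    using ab by (auto intro: arc_in)
  let ?W = "\<Union>k. (f ^^ (?M * k)) ` ?U"
  have W: "?W \<subseteq> orbit_hull ?M ?U"
    unfolding orbit_hull_def using iterate_image_subset[OF Usub] by (intro closure_of_subset) blast
  have MN: "orbit_hull ?M ?U \<subseteq> orbit_hull N ?U"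
    by (rule orbit_hull_dvd) simp
  have conn: "connectedin X ?W"
  proof (rule connectedin_Union)
    have "connectedin X ?U"
      using ab by (intro connected_arc) auto
    then show "\<And>S. S \<in> range (\<lambda>k. (f ^^ (?M * k)) ` ?U) \<Longrightarrow> connectedin X S"
      using connectedin_continuous_map_image[OF continuous_iterate] by blast
    have "(f ^^ (?M * k)) (e z) = e z" for k
      using funpow_period_dvd[OF z(4), of "?M * k"] by simp
    then have "e z \<in> (f ^^ (?M * k)) ` ?U" for k
      using z(1,2) by (metis greaterThanLessThan_iff imageI)
    then show "\<Inter> (range (\<lambda>k. (f ^^ (?M * k)) ` ?U)) \<noteq> {}"
      by blast
  qed
  have ez: "e z \<in> ?W"
  proof (rule UN_I)
    show "e z \<in> (f ^^ (?M * 0)) ` ?U"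
      using z by simp
  qed simp
  have "?W \<subseteq> e ` {c<..<d}"
  proof (rule connected_trapped[OF conn])
    show "e c \<notin> ?W" "e d \<notin> ?W"
      using c d W MN by blast+
    have "e z \<in> e ` {c<..<d}"
      using z c d by (intro imageI) auto
    then show "?W \<inter> e ` {c<..<d} \<noteq> {}"
      using ez by blast
  qed (use c d in auto)
  also have "\<dots> \<subseteq> e ` {c..d}"
    by (intro image_mono) auto
  finally have "orbit_hull ?M ?U \<subseteq> e ` {c..d}"
    unfolding orbit_hull_def using c d by (intro closure_of_minimal closed_arc) auto
  moreover have "(\<Union>i<?M. (f ^^ i) ` orbit_hull ?M ?U) = topspace X"
  proof (rule invariant_images_cover)
    show "openin X ?U" "?U \<noteq> {}" "?U \<subseteq> orbit_hull ?M ?U"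
      using ab open_arc_interval subset_orbit_hull[OF Usub] by auto
    show "(f ^^ ?M) ` orbit_hull ?M ?U \<subseteq> orbit_hull ?M ?U"
      using orbit_hull_invariant[OF Usub] .
  qed (use N z in auto)
  moreover obtain p0 where p0: "p0 \<in> topspace X" "\<And>i x. 0 < x \<Longrightarrow> x < 1 \<Longrightarrow> (f ^^ i) p0 \<noteq> e x"
    using escape by blast
  ultimately obtain i q where q: "i < ?M" "q \<in> orbit_hull ?M ?U" "p0 = (f ^^ i) q"
    by blast
  \<comment> \<open>Completing \<open>i\<close> to \<open>?M\<close> steps brings the orbit of
    \<open>p0\<close> back to the hull, which lies in the arc that this orbit avoids.\<close>
  have "(f ^^ (?M - i)) p0 = (f ^^ ?M) q"
    using q by (metis comp_apply funpow_add le_add_diff_inverse2 less_imp_le)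
  also have "\<dots> \<in> e ` {c..d}"
    using orbit_hull_invariant[OF Usub, of ?M] q(2) \<open>orbit_hull ?M ?U \<subseteq> e ` {c..d}\<close> by blast
  finally show False
    using p0(2) c d by force
qed

definition full :: "nat \<Rightarrow> real \<Rightarrow> real \<Rightarrow> bool" where
  "full N a b \<longleftrightarrow> (\<forall>c d. a \<le> c \<and> c < d \<and> d \<le> b \<longrightarrow> e ` {a<..<b} \<subseteq> orbit_hull N (e ` {c<..<d}))"

text \<open>Let \<open>E\<close> be the hull of an interval \<open>U\<close> that misses a point of
  the arc segment. Some image of \<open>E\<close> under \<open>f ^^ i\<close> contains an interval
  \<open>B\<close> disjoint from \<open>E\<close>. The hull of \<open>B\<close> cannot contain
  \<open>U\<close>: otherwise \<open>E\<close> would lie in its own image under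
  \<open>f ^^ i\<close>, hence equal it, and meet \<open>B\<close>. Thus neither hull covers the
  side facing the other interval, and by \<open>hull_one_side\<close> each covers the opposite
  side.\<close>

lemma not_full_separated:
  assumes N: "N \<ge> 1" and ab: "0 \<le> a" "a < b" "b \<le> 1" and nf: "\<not> full N a b"
  obtains s t u v where "a \<le> s" "s < t" "t \<le> u" "u < v" "v \<le> b"
    "e ` {0<..s} \<subseteq> orbit_hull N (e ` {s<..<t})" "e ` {v..<1} \<subseteq> orbit_hull N (e ` {u<..<v})"
    "orbit_hull N (e ` {s<..<t}) \<inter> e ` {u<..<v} = {} \<or> orbit_hull N (e ` {u<..<v}) \<inter> e ` {s<..<t} = {}"
proof -
  obtain c d x where cd: "a \<le> c" "c < d" "d \<le> b" and x: "a < x" "x < b" "e x \<notin> orbit_hull N (e ` {c<..<d})"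
    using nf unfolding full_def image_subset_iff by (metis greaterThanLessThan_iff)
  let ?U = "e ` {c<..<d}"
  let ?E = "orbit_hull N ?U"
  have Usub: "?U \<subseteq> topspace X"
    using ab cd by (auto intro: arc_in)
  have UE: "?U \<subseteq> ?E"
    using subset_orbit_hull[OF Usub] .
  let ?V = "e ` {a<..<b} - ?E"
  have "openin X ?V"
    using ab by (intro openin_diff open_arc_interval) auto
  moreover have "e x \<in> ?V"
    using x by auto
  ultimately have V: "openin X ?V" "?V \<noteq> {}"
    by blast+
  have inv: "(f ^^ N) ` ?E \<subseteq> ?E"
    using orbit_hull_invariant[OF Usub] .
  have "(\<Union>i<N. (f ^^ i) ` ?E) = topspace X"
    using N inv UE cd ab by (intro invariant_images_cover[of N ?E ?U] open_arc_interval) auto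
  then obtain i W where W: "i < N" "openin X W" "W \<noteq> {}" "W \<subseteq> ?V \<inter> (f ^^ i) ` ?E"
    using closed_cover_open_subset[OF V, where n = N and C = "\<lambda>i. (f ^^ i) ` ?E"] openin_subset[OF V(1)] iterate_closed
    by auto
  have "W \<inter> e ` {a<..<b} \<noteq> {}"
    using W by blast
  then obtain u v where uv: "a < u" "u < v" "v < b" "e ` {u..v} \<subseteq> W"
    using open_meets_arc[OF W(2)] ab by metis
  let ?B = "e ` {u<..<v}"
  have BW: "?B \<subseteq> W"
    using uv(4) by auto
  have BE: "?E \<inter> ?B = {}"
    using BW W(4) by blast
  have EB: "?E \<inter> e ` {u..v} = {}"
    using uv(4) W(4) by blast
  have mid: "e ((u + v) / 2) \<in> ?B"
    using uv by (intro imageI) auto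
  have notU: "\<not> ?U \<subseteq> orbit_hull N ?B"
  proof
    assume UB: "?U \<subseteq> orbit_hull N ?B"
    have Bsub: "?B \<subseteq> topspace X"
      using BW W(2) openin_subset by blast
    have fE: "(f ^^ i) ` ?E = orbit_hull N ((f ^^ i) ` ?U)"
      using image_orbit_hull[OF Usub] .
    have "orbit_hull N ?B \<subseteq> (f ^^ i) ` ?E"
      using BW W(4) orbit_hull_invariant[OF iterate_image_subset[OF Usub], of N i]
      unfolding fE by (intro orbit_hull_least) auto
    moreover have "?E \<subseteq> orbit_hull N ?B"
      using UB orbit_hull_invariant[OF Bsub] by (intro orbit_hull_least) auto
    ultimately have E: "?E \<subseteq> (f ^^ i) ` ?E"
      by blast
    have "(f ^^ i) ` ?E = ?E"
      using expanding_image_fixed[OF N inv E] .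
    then show False
      using W BE BW mid by blast
  qed
  have "v \<le> c \<or> d \<le> u"
  proof (rule ccontr)
    assume "\<not> ?thesis"
    then have "max c u < min d v"
      using uv cd by auto
    then obtain y where y: "max c u < y" "y < min d v"
      using dense by blast
    then have "e y \<in> ?U" "e y \<in> ?B"
      by auto
    then show False
      using UE BE by blast
  qed
  then show ?thesis
  proof
    assume vc: "v \<le> c"
    have "?U \<subseteq> e ` {v..<1}"
      using vc cd ab by (intro image_mono) auto
    then have "\<not> e ` {v..<1} \<subseteq> orbit_hull N ?B"
      using notU by blast
    then have "e ` {0<..u} \<subseteq> orbit_hull N ?B"
      using hull_one_side[OF N, of u v] uv ab by auto
    moreover have "e v \<in> e ` {0<..c}" "e v \<in> e ` {u..v}"
      using uv vc ab by auto
    then have "\<not> e ` {0<..c} \<subseteq> ?E"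
      using EB by blast
    then have "e ` {d..<1} \<subseteq> ?E"
      using hull_one_side[OF N, of c d] cd ab by auto
    ultimately show ?thesis
      using that[of u v c d] uv vc cd BE by auto
  next
    assume du: "d \<le> u"
    have "?U \<subseteq> e ` {0<..u}"
      using du cd ab by (intro image_mono) auto
    then have "\<not> e ` {0<..u} \<subseteq> orbit_hull N ?B"
      using notU by blast
    then have "e ` {v..<1} \<subseteq> orbit_hull N ?B"
      using hull_one_side[OF N, of u v] uv ab by auto
    moreover have "e u \<in> e ` {d..<1}" "e u \<in> e ` {u..v}"
      using uv du ab by auto
    then have "\<not> e ` {d..<1} \<subseteq> ?E"
      using EB by blast
    then have "e ` {0<..c} \<subseteq> ?E"
      using hull_one_side[OF N, of c d] cd ab by auto
    ultimately show ?thesis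
      using that[of c d u v] uv du cd BE by auto
  qed
qed

text \<open>Separation is applied twice. Within the interval whose hull misses the other one, a
  second separation produces a smaller interval whose hull extends over the whole far side, and so
  over the interval that was missed.\<close>

lemma ex_full: "\<exists>a b. 0 \<le> a \<and> a < b \<and> b \<le> 1 \<and> (\<forall>N\<ge>1. full N a b)"
proof (rule ccontr)
  assume "\<not> ?thesis"
  then have nf: "\<exists>N\<ge>1. \<not> full N a b" if "0 \<le> a" "a < b" "b \<le> 1" for a b
    using that by blast
  obtain N where N: "N \<ge> 1" "\<not> full N 0 1"
    using nf[of 0 1] by auto
  obtain s t u v where st: "0 \<le> s" "s < t" "t \<le> u" "u < v" "v \<le> 1"
    and alt: "orbit_hull N (e ` {s<..<t}) \<inter> e ` {u<..<v} = {} \<or> orbit_hull N (e ` {u<..<v}) \<inter> e ` {s<..<t} = {}"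
    using not_full_separated[OF N(1) order.refl zero_less_one order.refl N(2)] by metis
  \<comment> \<open>Hulls shrink when the exponent is multiplied, so a failure for \<open>M\<close>
    persists for \<open>N * M\<close>. The second separation can therefore use a multiple of
    \<open>N\<close>, and its hulls lie in those for \<open>N\<close>.\<close>
  have refine: "\<exists>N'. N dvd N' \<and> N' \<ge> 1 \<and> \<not> full N' a b" if ab: "0 \<le> a" "a < b" "b \<le> 1" for a b
  proof -
    obtain M where M: "M \<ge> 1" "\<not> full M a b"
      using nf[OF ab] by blast
    have "\<not> full (N * M) a b"
      using M(2) orbit_hull_dvd[of M "N * M"] unfolding full_def by (meson dvd_triv_right subset_trans)
    then show ?thesis
      using M N by (intro exI[of _ "N * M"]) auto
  qed
  from alt show False
  proof
    assume disj: "orbit_hull N (e ` {s<..<t}) \<inter> e ` {u<..<v} = {}"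
    obtain N' where N': "N dvd N'" "N' \<ge> 1" "\<not> full N' s t"
      using refine[of s t] st by auto
    have "t \<le> 1"
      using st by linarith
    obtain s' t' u' v' where q: "s \<le> s'" "s' < t'" "t' \<le> u'" "u' < v'" "v' \<le> t"
      "e ` {v'..<1} \<subseteq> orbit_hull N' (e ` {u'<..<v'})"
      using not_full_separated[OF N'(2) st(1,2) \<open>t \<le> 1\<close> N'(3)] by metis
    have "e ` {u<..<v} \<subseteq> e ` {v'..<1}"
      using q st by (intro image_mono) auto
    also have "\<dots> \<subseteq> orbit_hull N (e ` {u'<..<v'})"
      using q(6) orbit_hull_dvd[OF N'(1)] by blast
    also have "\<dots> \<subseteq> orbit_hull N (e ` {s<..<t})"
      using q by (intro orbit_hull_mono image_mono) auto
    finally show False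
      using disj dense[OF st(4)] by fastforce
  next
    assume disj: "orbit_hull N (e ` {u<..<v}) \<inter> e ` {s<..<t} = {}"
    obtain N' where N': "N dvd N'" "N' \<ge> 1" "\<not> full N' u v"
      using refine[of u v] st by auto
    have "0 \<le> u"
      using st by linarith
    obtain s' t' u' v' where q: "u \<le> s'" "s' < t'" "t' \<le> u'" "u' < v'" "v' \<le> v"
      "e ` {0<..s'} \<subseteq> orbit_hull N' (e ` {s'<..<t'})"
      using not_full_separated[OF N'(2) \<open>0 \<le> u\<close> st(4,5) N'(3)] by metis
    have "e ` {s<..<t} \<subseteq> e ` {0<..s'}"
      using q st by (intro image_mono) auto
    also have "\<dots> \<subseteq> orbit_hull N (e ` {s'<..<t'})"
      using q(6) orbit_hull_dvd[OF N'(1)] by blast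
    also have "\<dots> \<subseteq> orbit_hull N (e ` {u<..<v})"
      using q by (intro orbit_hull_mono image_mono) auto
    finally show False
      using disj dense[OF st(2)] by fastforce
  qed
qed

end

section \<open>The regular periodic decomposition generated by the arc\<close>

locale full_arc = periodic_arc +
  assumes full: "N \<ge> 1 \<Longrightarrow> 0 \<le> a \<Longrightarrow> a < b \<Longrightarrow> b \<le> 1 \<Longrightarrow> e ` {0<..<1} \<subseteq> orbit_hull N (e ` {a<..<b})"
begin

definition J :: "'a set" where "J = e ` {0<..<1}"

lemma open_J: "openin X J" and J_nonempty: "J \<noteq> {}" and J_sub: "J \<subseteq> topspace X"
  using open_arc_interval[of 0 1] arc_in by (auto simp: J_def)

lemma J_interval:
  assumes "openin X U" "U \<noteq> {}" "U \<subseteq> J"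
  obtains a b where "0 < a" "a < b" "b < 1" "e ` {a..b} \<subseteq> U"
  using open_meets_arc[OF assms(1), of 0 1] assms unfolding J_def by (metis Int_absorb2 order.refl)

lemma hull_J:
  assumes "N \<ge> 1" "openin X U" "U \<noteq> {}" "U \<subseteq> J"
  shows "J \<subseteq> orbit_hull N U"
proof -
  obtain a b where ab: "0 < a" "a < b" "b < 1" "e ` {a..b} \<subseteq> U"
    using J_interval[OF assms(2-4)] .
  have "e ` {a<..<b} \<subseteq> e ` {a..b}"
    by (intro image_mono) auto
  with ab(4) have "e ` {a<..<b} \<subseteq> U"
    by blast
  then show ?thesis
    using full[OF assms(1), of a b] ab orbit_hull_mono unfolding J_def by (meson less_imp_le order.trans)
qed

definition base_period :: nat where
  "base_period = (SOME n. n \<ge> 1 \<and> (\<exists>z\<in>J. (f ^^ n) z = z))"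

lemma base_period: "base_period \<ge> 1" "\<exists>z\<in>J. (f ^^ base_period) z = z"
proof -
  have ex: "\<exists>n. n \<ge> 1 \<and> (\<exists>z\<in>J. (f ^^ n) z = z)"
    using periodic[of 0 1] unfolding J_def by (metis greaterThanLessThan_iff imageI order.refl zero_less_one)
  show "base_period \<ge> 1" "\<exists>z\<in>J. (f ^^ base_period) z = z"
    using someI_ex[OF ex] unfolding base_period_def by blast+
qed

definition D :: "'a set" where "D = orbit_hull base_period J"

lemma closed_D: "closedin X D" and J_D: "J \<subseteq> D" and D_sub: "D \<subseteq> topspace X"
  and D_inv: "(f ^^ base_period) ` D \<subseteq> D"
  using subset_orbit_hull[OF J_sub] orbit_hull_invariant[OF J_sub] closedin_subset[OF closedin_orbit_hull]
  by (simp_all add: D_def)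

text \<open>By fullness all nonempty open subsets of \<open>J\<close> have the same hull at exponent
  \<open>N\<close>. Computing it from the part of \<open>J\<close> that returns to \<open>J\<close>
  after \<open>base_period\<close> steps, nonempty by the choice of this period, shows that it is
  invariant under \<open>f ^^ base_period\<close> and hence contains \<open>D\<close>.\<close>

lemma hull_eq_D:
  assumes N: "N \<ge> 1" "base_period dvd N" and U: "openin X U" "U \<noteq> {}" "U \<subseteq> J"
  shows "orbit_hull N U = D"
proof
  show "orbit_hull N U \<subseteq> D"
    unfolding D_def using orbit_hull_mono[OF U(3)] orbit_hull_dvd[OF N(2)] by blast
  have Usub: "U \<subseteq> topspace X"
    using U openin_subset by blast
  have NU: "orbit_hull N U = orbit_hull N J" if "openin X U" "U \<noteq> {}" "U \<subseteq> J" for U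
  proof
    show "orbit_hull N J \<subseteq> orbit_hull N U"
      using hull_J[OF N(1) that] openin_subset[OF that(1)]
      by (intro orbit_hull_least orbit_hull_invariant) auto
  qed (rule orbit_hull_mono[OF that(3)])
  let ?U = "J \<inter> preim base_period J"
  have "(f ^^ base_period) ` orbit_hull N J \<subseteq> orbit_hull N J"
  proof -
    have "openin X ?U" "?U \<noteq> {}"
      using base_period(2) open_J openin_preim J_sub by (auto simp: preim_def)
    then have "orbit_hull N J = orbit_hull N ?U"
      using NU by auto
    then have "(f ^^ base_period) ` orbit_hull N J = orbit_hull N ((f ^^ base_period) ` ?U)"
      using image_orbit_hull[of ?U base_period N] J_sub by (simp add: le_infI1)
    also have "\<dots> \<subseteq> orbit_hull N J"
      by (intro orbit_hull_mono) (auto simp: preim_def)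
    finally show ?thesis .
  qed
  then have "D \<subseteq> orbit_hull N J"
    unfolding D_def using subset_orbit_hull[OF J_sub] by (intro orbit_hull_least) auto
  then show "D \<subseteq> orbit_hull N U"
    using NU[OF U] by simp
qed

text \<open>If part of \<open>J\<close> were outside the image, this open part would recur at a
  positive multiple of \<open>base_period\<close>; but after such a time it has landed in the image
  of \<open>D\<close>.\<close>

lemma image_base_period: "(f ^^ base_period) ` D = D"
proof
  show "D \<subseteq> (f ^^ base_period) ` D"
    unfolding D_def[of]
  proof (rule orbit_hull_least)
    show "closedin X ((f ^^ base_period) ` orbit_hull base_period J)"
      by (intro iterate_closed) simp
    show "(f ^^ base_period) ` ((f ^^ base_period) ` orbit_hull base_period J) \<subseteq> (f ^^ base_period) ` orbit_hull base_period J"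
      using D_inv unfolding D_def by blast
    show "J \<subseteq> (f ^^ base_period) ` orbit_hull base_period J"
    proof (rule ccontr)
      assume nsub: "\<not> ?thesis"
      let ?V = "J - (f ^^ base_period) ` D"
      have "openin X ?V"
        using open_J iterate_closed closed_D by (intro openin_diff)
      moreover have "?V \<noteq> {}"
        using nsub unfolding D_def by blast
      ultimately obtain j where j: "j \<ge> 1" "(f ^^ (base_period * j)) ` ?V \<inter> ?V \<noteq> {}"
        using recurrent_multiple[OF _ _ base_period(1), of ?V] by blast
      have "base_period * j = base_period + base_period * (j - 1)"
        using j(1) by (cases j) auto
      then have "(f ^^ (base_period * j)) ` ?V = (f ^^ base_period) ` (f ^^ (base_period * (j - 1))) ` ?V"
        by (simp only: funpow_add image_comp)
      also have "(f ^^ (base_period * (j - 1))) ` ?V \<subseteq> D"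
        using iterate_invariant[OF D_inv] J_D by blast
      finally show False
        using j(2) by blast
    qed
  qed
qed (fact D_inv)

text \<open>\<open>D\<close> is its own image after \<open>base_period * i\<close> steps, and the
  last \<open>i\<close> of these steps start from a subset of \<open>D\<close>.\<close>

lemma stable_image:
  assumes "(f ^^ i) ` D \<subseteq> D"
  shows "(f ^^ i) ` D = D"
proof
  obtain m where m: "base_period = Suc m"
    using base_period(1) by (cases base_period) auto
  have "D = (f ^^ (base_period * i)) ` D"
    using image_iterate_fixed[OF image_base_period] by simp
  also have "\<dots> = (f ^^ i) ` ((f ^^ (i * m)) ` D)"
    by (simp only: m image_comp flip: funpow_add) (simp add: mult.commute)
  also have "\<dots> \<subseteq> (f ^^ i) ` D"
    using iterate_invariant[OF assms] by blast
  finally show "D \<subseteq> (f ^^ i) ` D" .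
qed fact

definition d :: nat where "d = (LEAST i. i \<ge> 1 \<and> (f ^^ i) ` D = D)"

lemma d_pos: "d \<ge> 1" and image_d: "(f ^^ d) ` D = D"
proof -
  have "base_period \<ge> 1 \<and> (f ^^ base_period) ` D = D"
    using base_period(1) image_base_period by simp
  from LeastI[of "\<lambda>i. i \<ge> 1 \<and> (f ^^ i) ` D = D", OF this] show "d \<ge> 1" "(f ^^ d) ` D = D"
    unfolding d_def by blast+
qed

lemma image_mod_d: "(f ^^ i) ` D = (f ^^ (i mod d)) ` D"
proof -
  have "(f ^^ i) ` D = (f ^^ (i mod d)) ` ((f ^^ (d * (i div d))) ` D)"
    by (simp only: image_comp mod_mult_div_eq flip: funpow_add)
  then show ?thesis
    using image_iterate_fixed[OF image_d] by simp
qed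

lemma image_fixed_iff: "(f ^^ i) ` D = D \<longleftrightarrow> d dvd i"
proof
  assume "(f ^^ i) ` D = D"
  then have "(f ^^ (i mod d)) ` D = D"
    using image_mod_d by metis
  moreover have "i mod d < d"
    using d_pos by simp
  ultimately have "\<not> i mod d \<ge> 1"
    unfolding d_def using not_less_Least by blast
  then show "d dvd i"
    by (simp add: dvd_eq_mod_eq_0)
next
  assume "d dvd i"
  then show "(f ^^ i) ` D = D"
    using image_iterate_fixed[OF image_d] by (auto elim: dvdE)
qed

lemma d_dvd_base: "d dvd base_period"
  using image_fixed_iff[of base_period] image_base_period by simp

definition piece :: "nat \<Rightarrow> 'a set" where "piece i = (f ^^ i) ` D"

lemma closed_piece: "closedin X (piece i)"
  unfolding piece_def by (intro iterate_closed closed_D)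

lemma image_piece: "(f ^^ i) ` piece j = piece (i + j)"
  by (simp add: piece_def image_comp funpow_add)

lemma piece_eq_hull: "piece i = X closure_of (\<Union>k. (f ^^ (base_period * k + i)) ` J)"
  unfolding piece_def D_def image_orbit_hull[OF J_sub] unfolding orbit_hull_def image_comp funpow_add ..

lemma piece_base: "(f ^^ base_period) ` piece i = piece i"
  using image_base_period image_piece[of base_period i] image_piece[of i base_period]
  by (simp add: piece_def add.commute)

lemma piece_cover: "(\<Union>i<d. piece i) = topspace X"
  unfolding piece_def
  using d_pos closed_D image_d open_J J_nonempty J_D by (intro invariant_images_cover) auto

text \<open>\<open>D\<close> is the hull of \<open>U\<close>, so the inclusion extends from
  \<open>U\<close> to \<open>D\<close>. Another \<open>d - i\<close> steps carry piece
  \<open>i\<close> to \<open>D\<close> and piece \<open>j\<close> to piece \<open>j - i\<close>;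
  then \<open>D\<close> is contained in its image after \<open>j - i\<close> steps, hence equal to
  it, and \<open>d\<close> divides \<open>j - i\<close>.\<close>

lemma no_overlap:
  assumes U: "openin X U" "U \<noteq> {}" "U \<subseteq> J" and ij: "i < j" "j < d"
  shows "\<not> (f ^^ a) ` U \<subseteq> piece i \<inter> piece j"
proof
  assume sub: "(f ^^ a) ` U \<subseteq> piece i \<inter> piece j"
  have "D = orbit_hull base_period U"
    using hull_eq_D[OF base_period(1) _ U] by simp
  then have "(f ^^ a) ` D = orbit_hull base_period ((f ^^ a) ` U)"
    using image_orbit_hull openin_subset[OF U(1)] by simp
  also have "\<dots> \<subseteq> piece i \<inter> piece j"
  proof (rule orbit_hull_least[OF _ _ sub])
    show "(f ^^ base_period) ` (piece i \<inter> piece j) \<subseteq> piece i \<inter> piece j"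
      using piece_base[of i] piece_base[of j] by blast
  qed (use closed_piece in blast)
  finally have "(f ^^ (d - i)) ` (f ^^ a) ` D \<subseteq> (f ^^ (d - i)) ` piece i \<inter> (f ^^ (d - i)) ` piece j"
    by blast
  moreover have "(f ^^ (d - i)) ` piece i = D"
    using ij image_d by (simp add: image_piece) (simp add: piece_def)
  moreover have "(f ^^ (d - i)) ` piece j = piece (j - i)"
  proof -
    have "(f ^^ (d - i)) ` piece j = (f ^^ (j - i)) ` piece d"
      using ij unfolding image_piece by (intro arg_cong[of _ _ piece]) simp
    then show ?thesis
      using image_d by (simp add: piece_def)
  qed
  ultimately have *: "(f ^^ (d - i + a)) ` D \<subseteq> D \<inter> piece (j - i)"
    by (simp add: funpow_add image_comp)
  then have "(f ^^ (d - i + a)) ` D = D"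
    using stable_image[of "d - i + a"] by simp
  then have "D \<subseteq> (f ^^ (j - i)) ` D"
    using * by (simp add: piece_def)
  then have "d dvd j - i"
    using expanding_image_fixed[OF base_period(1) D_inv, of "j - i"] image_fixed_iff[of "j - i"] by simp
  then show False
    using ij by (auto dest: dvd_imp_le)
qed

lemma no_overlap':
  assumes U: "openin X U" "U \<noteq> {}" "U \<subseteq> J" and ij: "i \<noteq> j" "i < d" "j < d"
  shows "\<not> (f ^^ a) ` U \<subseteq> piece i \<inter> piece j"
  using no_overlap[OF U, of i j a] no_overlap[OF U, of j i a] ij
  by (metis Int_commute linorder_neqE_nat)

text \<open>Near a point of the piece there is an iterate of an open subset of \<open>J\<close>. The
  other pieces cannot cover the neighbourhood, since one of them would then contain an iterate of a
  smaller open set, against \<open>no_overlap'\<close>. What they leave is open and belongs to this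
  piece.\<close>

lemma regular_closed_piece:
  assumes "i < d"
  shows "regular_closed X (piece i)"
proof -
  have "X closure_of (X interior_of piece i) \<subseteq> piece i"
    by (intro closure_of_minimal interior_of_subset closed_piece)
  moreover have "piece i \<subseteq> X closure_of (X interior_of piece i)"
  proof
    fix x assume x: "x \<in> piece i"
    have "\<exists>y. y \<in> X interior_of piece i \<and> y \<in> V" if V: "x \<in> V" "openin X V" for V
    proof -
      obtain k where "V \<inter> (f ^^ (base_period * k + i)) ` J \<noteq> {}"
        using x V unfolding piece_eq_hull in_closure_of by blast
      let ?t = "base_period * k + i"
      let ?U = "J \<inter> preim ?t V"
      have U: "openin X ?U" "?U \<noteq> {}"
        using \<open>V \<inter> (f ^^ ?t) ` J \<noteq> {}\<close> V open_J openin_preim J_sub unfolding preim_def by blast+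
      have sub: "(f ^^ ?t) ` J \<subseteq> piece i"
      proof -
        have "(f ^^ ?t) ` J \<subseteq> (f ^^ (i + base_period * k)) ` D"
          using J_D by (simp only: add.commute) blast
        also have "\<dots> = piece i"
          using image_iterate_fixed[OF image_base_period, of k] unfolding piece_def
          by (simp only: funpow_add flip: image_comp)
        finally show ?thesis .
      qed
      \<comment> \<open>Replacing piece \<open>i\<close> by the empty set keeps the cover indexed by
        all \<open>j < d\<close>.\<close>
      let ?C = "\<lambda>j. if j = i then {} else piece j"
      have "\<not> V \<subseteq> (\<Union>j<d. ?C j)"
      proof
        assume "V \<subseteq> (\<Union>j<d. ?C j)"
        then have "?U \<subseteq> (\<Union>j<d. preim ?t (?C j))"
          unfolding preim_def by blast
        moreover have "closedin X (preim ?t (?C j))" for j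
          by (intro closedin_preim) (simp add: closed_piece)
        ultimately obtain j W where W: "j < d" "openin X W" "W \<noteq> {}" "W \<subseteq> ?U \<inter> preim ?t (?C j)"
          using closed_cover_open_subset[OF U, where n = d and C = "\<lambda>j. preim ?t (?C j)"] by blast
        then have "j \<noteq> i"
          by (auto simp: preim_def)
        moreover have "(f ^^ ?t) ` W \<subseteq> piece i \<inter> piece j"
          using W(4) sub \<open>j \<noteq> i\<close> unfolding preim_def by auto
        ultimately show False
          using no_overlap'[OF W(2,3) _ _ assms W(1), of ?t] W(4) by auto
      qed
      moreover have "closedin X (\<Union>j<d. ?C j)"
        by (intro closedin_Union) (auto simp: closed_piece)
      then have "openin X (V - (\<Union>j<d. ?C j))"
        using V(2) by (rule openin_diff[rotated])
      moreover have "V - (\<Union>j<d. ?C j) \<subseteq> piece i"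
        using piece_cover openin_subset[OF V(2)] by (force split: if_splits)
      ultimately show ?thesis
        using interior_of_maximal by blast
    qed
    then show "x \<in> X closure_of (X interior_of piece i)"
      using x closedin_subset[OF closed_piece] unfolding in_closure_of by blast
  qed
  ultimately show ?thesis
    unfolding regular_closed_def using closedin_subset[OF closed_piece] by blast
qed

lemma nowhere_dense_pieces:
  assumes "i \<noteq> j" "i < d" "j < d"
  shows "nowhere_dense_in X (piece i \<inter> piece j)"
proof -
  have cl: "X closure_of (piece i \<inter> piece j) = piece i \<inter> piece j"
    using closed_piece by (intro closure_of_closedin) blast
  let ?V = "X interior_of (piece i \<inter> piece j)"
  have "?V = {}"
  proof (rule ccontr)
    assume "?V \<noteq> {}"
    from meet[OF open_J J_nonempty openin_interior_of this]
    obtain l where l: "(f ^^ l) ` J \<inter> ?V \<noteq> {}" .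
    let ?U = "J \<inter> preim l ?V"
    have "openin X ?U"
      by (intro openin_Int open_J openin_preim openin_interior_of)
    moreover have "?U \<noteq> {}"
      using l J_sub unfolding preim_def by blast
    moreover have "(f ^^ l) ` ?U \<subseteq> piece i \<inter> piece j"
      using interior_of_subset[of X "piece i \<inter> piece j"] unfolding preim_def by blast
    ultimately show False
      using no_overlap'[of ?U i j l] assms by auto
  qed
  then show ?thesis
    unfolding nowhere_dense_in_def cl using closedin_subset[OF closed_piece] by blast
qed

lemma rpd: "regular_periodic_decomposition X f d piece"
  unfolding regular_periodic_decomposition_def
proof (intro conjI allI impI)
  fix i assume i: "i < d"
  have "f ` piece i = piece (Suc i)"
    using image_piece[of 1 i] by simp
  also have "\<dots> = piece ((i + 1) mod d)"
    unfolding piece_def using image_mod_d by simp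
  finally show "f ` piece i \<subseteq> piece ((i + 1) mod d)"
    by simp
qed (use d_pos regular_closed_piece piece_cover nowhere_dense_pieces in auto)

section \<open>Blocks with periodic endpoints and the horseshoe\<close>

lemma periodic_choice: "\<exists>x n. \<forall>i<10. real i / 10 < x i \<and> x i < (real i + 1) / 10 \<and> n i \<ge> 1 \<and> (f ^^ (n i)) (e (x i)) = e (x i)"
proof -
  have "\<exists>y. i < 10 \<longrightarrow> real i / 10 < fst y \<and> fst y < (real i + 1) / 10 \<and> snd y \<ge> (1::nat) \<and> (f ^^ (snd y)) (e (fst y)) = e (fst y)" for i :: nat
  proof (cases "i < 10")
    case True
    then have "(real i + 1) / 10 \<le> 1"
      by simp
    then obtain x n where "real i / 10 < x" "x < (real i + 1) / 10" "n \<ge> 1" "(f ^^ n) (e x) = e x"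
      using periodic[of "real i / 10" "(real i + 1) / 10"] by (auto simp: field_simps)
    then show ?thesis
      by (intro exI[of _ "(x, n)"]) simp
  qed auto
  then obtain y where "\<And>i. i < 10 \<Longrightarrow> real i / 10 < fst (y i) \<and> fst (y i) < (real i + 1) / 10 \<and> snd (y i) \<ge> (1::nat) \<and> (f ^^ (snd (y i))) (e (fst (y i))) = e (fst (y i))"
    by metis
  then show ?thesis
    by (intro exI[of _ "\<lambda>i. fst (y i)"] exI[of _ "\<lambda>i. snd (y i)"]) blast
qed

text \<open>One periodic parameter in each tenth of the arc; consecutive pairs are the endpoints of
  the five blocks, which are thereby disjoint.\<close>

definition mark :: "nat \<Rightarrow> real" where
  "mark = (SOME x. \<exists>n. \<forall>i<10. real i / 10 < x i \<and> x i < (real i + 1) / 10 \<and> n i \<ge> (1::nat) \<and> (f ^^ (n i)) (e (x i)) = e (x i))"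

lemma mark_ex: "\<exists>n. \<forall>i<10. real i / 10 < mark i \<and> mark i < (real i + 1) / 10 \<and> n i \<ge> 1 \<and> (f ^^ (n i)) (e (mark i)) = e (mark i)"
  unfolding mark_def using someI_ex[OF periodic_choice] .

lemma mark_bounds: "i < 10 \<Longrightarrow> 0 < mark i" "i < 10 \<Longrightarrow> mark i < 1"
proof -
  assume "i < 10"
  then have "real i / 10 < mark i" "mark i < (real i + 1) / 10"
    using mark_ex by blast+
  then show "0 < mark i" "mark i < 1"
    using \<open>i < 10\<close> by (simp_all add: field_simps)
qed

lemma mark_less: "i < j \<Longrightarrow> j < 10 \<Longrightarrow> mark i < mark j"
proof -
  assume ij: "i < j" "j < 10"
  then have "mark i < (real i + 1) / 10" "real j / 10 < mark j"
    using mark_ex by (meson less_trans)+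
  moreover have "(real i + 1) / 10 \<le> real j / 10"
    using ij(1) by simp
  ultimately show ?thesis
    by linarith
qed

text \<open>Divisibility by \<open>base_period\<close> makes the hulls of open subsets of
  \<open>J\<close> at all its positive multiples equal to \<open>D\<close>.\<close>

definition common_period :: nat where
  "common_period = (SOME p. p \<ge> 1 \<and> base_period dvd p \<and> (\<forall>i<10. (f ^^ p) (e (mark i)) = e (mark i)))"

lemma common_period: "common_period \<ge> 1" "base_period dvd common_period"
  "i < 10 \<Longrightarrow> (f ^^ common_period) (e (mark i)) = e (mark i)"
proof -
  obtain n where n: "\<And>i. i < 10 \<Longrightarrow> n i \<ge> 1" "\<And>i. i < 10 \<Longrightarrow> (f ^^ (n i)) (e (mark i)) = e (mark i)"
    using mark_ex by blast
  let ?p = "base_period * (\<Prod>i<10. n i)"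
  have "(\<Prod>i<10. n i) > 0"
    using n(1) by (intro prod_pos) (auto simp: Suc_le_eq)
  then have "?p \<ge> 1"
    using base_period(1) by (metis One_nat_def Suc_leI nat_0_less_mult_iff less_le_trans zero_less_one)
  moreover have "(f ^^ ?p) (e (mark i)) = e (mark i)" if "i < 10" for i
    using that by (intro funpow_period_dvd[OF n(2)[OF that]] dvd_mult dvd_prodI) auto
  ultimately have "\<exists>p. p \<ge> 1 \<and> base_period dvd p \<and> (\<forall>i<10. (f ^^ p) (e (mark i)) = e (mark i))"
    by (intro exI[of _ ?p]) auto
  from someI_ex[OF this] show "common_period \<ge> 1" "base_period dvd common_period"
    "i < 10 \<Longrightarrow> (f ^^ common_period) (e (mark i)) = e (mark i)"
    unfolding common_period_def by blast+
qed

definition block :: "nat \<Rightarrow> 'a set" where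
  "block j = e ` {mark (2 * j)..mark (2 * j + 1)}"

abbreviation covers_blocks :: "'a set \<Rightarrow> bool" where
  "covers_blocks C \<equiv> 3 \<le> card {j. j < 5 \<and> block j \<subseteq> C}"

lemma block_interval:
  assumes "j < 5"
  shows "0 < mark (2 * j)" "mark (2 * j) < mark (2 * j + 1)" "mark (2 * j + 1) < 1"
  using assms mark_bounds[of "2 * j"] mark_bounds[of "2 * j + 1"] mark_less[of "2 * j" "2 * j + 1"] by auto

lemma block_disjoint:
  assumes "i < 5" "j < 5" "i \<noteq> j"
  shows "block i \<inter> block j = {}"
proof -
  have *: "block i \<inter> block j = {}" if "i < j" "j < 5" for i j
  proof -
    have "mark (2 * i + 1) < mark (2 * j)"
      using that by (intro mark_less) auto
    then show ?thesis
      using block_interval[of i] block_interval[of j] that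
      unfolding block_def by (force simp: arc_eq_iff)
  qed
  show ?thesis
    using *[of i j] *[of j i] assms by (metis Int_commute linorder_neqE_nat)
qed

lemma compact_block: "j < 5 \<Longrightarrow> compactin X (block j)"
  unfolding block_def using block_interval[of j] by (intro compact_arc) auto

lemma block_nonempty: "j < 5 \<Longrightarrow> block j \<noteq> {}"
  unfolding block_def using block_interval[of j] by auto

lemma block_sub: "j < 5 \<Longrightarrow> block j \<subseteq> topspace X"
  using compact_block compactin_subset_topspace by blast

text \<open>A dense connected subset of the arc misses at most one of its points, hence contains all
  endpoints of the blocks except those of one block.\<close>

lemma connected_dense_misses_one:
  assumes W: "connectedin X W" "J \<subseteq> X closure_of W" and xy: "0 < x" "x < y" "y < 1"
    and out: "e x \<notin> W" "e y \<notin> W"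
  shows False
proof -
  have "openin X (e ` {x<..<y})"
    using xy by (intro open_arc_interval) auto
  moreover have "e ((x + y) / 2) \<in> e ` {x<..<y}"
    using xy by (intro imageI) auto
  moreover have "e ((x + y) / 2) \<in> X closure_of W"
    using W(2) xy unfolding J_def by (auto intro!: subsetD[OF W(2)[unfolded J_def]])
  ultimately have "W \<inter> e ` {x<..<y} \<noteq> {}"
    unfolding in_closure_of by blast
  then have "W \<subseteq> e ` {x<..<y}"
    using connected_trapped[OF W(1) xy(1,3) out] by blast
  also have "\<dots> \<subseteq> e ` {x..y}"
    by (intro image_mono) auto
  finally have "X closure_of W \<subseteq> e ` {x..y}"
    using xy by (intro closure_of_minimal closed_arc) auto
  moreover have "e (x / 2) \<in> J"
    using xy unfolding J_def by auto
  ultimately have "e (x / 2) \<in> e ` {x..y}"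
    using W(2) by blast
  then show False
    using xy by (force simp: arc_eq_iff)
qed

text \<open>Among the blocks other than \<open>j0\<close> at most one is incomplete. Two gaps
  \<open>c\<close> and \<open>d\<close> in different blocks, with the right endpoint of the first
  block between them, would trap \<open>C\<close> between the gaps, although the left endpoint of
  the first block lies to the left of \<open>c\<close>.\<close>

lemma connected_contains_blocks:
  assumes C: "connectedin X C" and j0: "\<And>i. i < 10 \<Longrightarrow> i div 2 \<noteq> j0 \<Longrightarrow> e (mark i) \<in> C"
  shows "covers_blocks C"
proof -
  let ?G = "{j. j < 5 \<and> block j \<subseteq> C}" and ?B = "{j. j < 5 \<and> \<not> block j \<subseteq> C \<and> j \<noteq> j0}"
  have no: False if less: "j1 < j2" and B: "j1 \<in> ?B" "j2 \<in> ?B" for j1 j2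
  proof -
    have in_C: "e (mark (2 * j)) \<in> C" "e (mark (2 * j + 1)) \<in> C" if "j \<in> ?B" for j
      using that by (auto intro!: j0)
    have "\<exists>c. mark (2 * j) \<le> c \<and> c \<le> mark (2 * j + 1) \<and> e c \<notin> C" if "j \<in> ?B" for j
      using that unfolding block_def image_subset_iff by auto
    then obtain c d where c: "mark (2 * j1) \<le> c" "c \<le> mark (2 * j1 + 1)" "e c \<notin> C"
      and d: "mark (2 * j2) \<le> d" "d \<le> mark (2 * j2 + 1)" "e d \<notin> C"
      using B by blast
    have "c \<noteq> mark (2 * j1)" "c \<noteq> mark (2 * j1 + 1)" "d \<noteq> mark (2 * j2)"
      using in_C[OF B(1)] in_C[OF B(2)] c d by metis+
    then have strict: "mark (2 * j1) < c" "c < mark (2 * j1 + 1)" "mark (2 * j2) < d"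
      using c d by auto
    have j: "j1 < 5" "j2 < 5"
      using B by auto
    have "mark (2 * j1 + 1) < mark (2 * j2)"
      using less B by (intro mark_less) auto
    then have m: "mark (2 * j1 + 1) \<in> {c<..<d}"
      using strict by auto
    then have "C \<inter> e ` {c<..<d} \<noteq> {}"
      using in_C(2)[OF B(1)] by blast
    then have "C \<subseteq> e ` {c<..<d}"
      using connected_trapped[OF C, of c d] c(3) d(3) strict d(2) block_interval[OF j(1)] block_interval[OF j(2)]
      by auto
    then have "e (mark (2 * j1)) \<in> e ` {c<..<d}"
      using in_C(1)[OF B(1)] by blast
    then show False
      using strict block_interval[OF j(1)] block_interval[OF j(2)] d(2) by (force simp: arc_eq_iff)
  qed
  have "finite ?B"
    by simp
  moreover have "\<forall>j1\<in>?B. \<forall>j2\<in>?B. j1 = j2"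
    using no by (metis (no_types, lifting) linorder_neqE_nat)
  ultimately have "card ?B \<le> Suc 0"
    by (simp only: card_le_Suc0_iff_eq)
  have "{..<5} \<subseteq> ?G \<union> insert j0 ?B"
    by auto
  then have "card {..<5::nat} \<le> card (?G \<union> insert j0 ?B)"
    by (intro card_mono) auto
  also have "\<dots> \<le> card ?G + (Suc (card ?B))"
    using card_Un_le[of ?G "insert j0 ?B"] card_insert_le_m1[of "Suc (card ?B)" ?B j0] by simp
  finally show ?thesis
    using \<open>card ?B \<le> Suc 0\<close> by simp
qed

text \<open>All iterates contain \<open>e w\<close>, so their union is connected, and its closure
  contains \<open>J\<close>. Endpoints are fixed by \<open>f ^^ M\<close>: once an iterate contains
  one, so do all later iterates. A single late iterate thus contains every endpoint that the union
  contains.\<close>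

lemma eventually_covers_blocks:
  assumes st: "0 < s" "s < t" "t < 1" and w: "s \<le> w" "w \<le> t" "(f ^^ M) (e w) = e w"
    and M: "M \<ge> 1" "common_period dvd M"
  shows "\<forall>\<^sub>F k in sequentially. covers_blocks ((f ^^ (M * k)) ` e ` {s..t})"
proof -
  define C where "C k = (f ^^ (M * k)) ` e ` {s..t}" for k
  have conn: "connectedin X (C k)" for k
    unfolding C_def using st
    by (intro connectedin_continuous_map_image[OF continuous_iterate] connected_arc) auto
  have fixed: "(f ^^ (M * k)) (e w) = e w" for k
    using w(3) by (rule funpow_period)
  have ew: "e w \<in> C k" for k
  proof -
    have "(f ^^ (M * k)) (e w) \<in> C k"
      unfolding C_def using w(1,2) by (intro imageI) auto
    then show ?thesis
      using fixed by simp
  qed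
  let ?W = "\<Union>k. C k"
  have connW: "connectedin X ?W"
  proof (rule connectedin_Union)
    show "\<Inter> (range C) \<noteq> {}"
      using ew by blast
  qed (use conn in blast)
  have "base_period dvd M"
    using common_period(2) M(2) by (rule dvd_trans)
  have "e ` {s<..<t} \<subseteq> J"
    using st unfolding J_def by (intro image_mono) auto
  then have "orbit_hull M (e ` {s<..<t}) = D"
    using st M(1) \<open>base_period dvd M\<close> by (intro hull_eq_D open_arc_interval) auto
  moreover have "orbit_hull M (e ` {s<..<t}) \<subseteq> X closure_of ?W"
    unfolding orbit_hull_def C_def by (intro closure_of_mono UN_mono image_mono) auto
  ultimately have JW: "J \<subseteq> X closure_of ?W"
    using J_D by blast
  have "\<exists>j0. \<forall>i<10. i div 2 \<noteq> j0 \<longrightarrow> e (mark i) \<in> ?W"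
  proof (cases "\<exists>i<10. e (mark i) \<notin> ?W")
    case True
    then obtain i where i: "i < 10" "e (mark i) \<notin> ?W"
      by blast
    have "e (mark i') \<in> ?W" if "i' < 10" "i' div 2 \<noteq> i div 2" for i'
    proof (rule ccontr)
      assume out: "e (mark i') \<notin> ?W"
      have "i \<noteq> i'"
        using that(2) by blast
      then consider "i < i'" | "i' < i"
        by linarith
      then show False
      proof cases
        case 1
        then show False
          using connected_dense_misses_one[OF connW JW _ _ _ i(2) out] mark_less[of i i'] mark_bounds i(1) that(1)
          by blast
      next
        case 2
        then show False
          using connected_dense_misses_one[OF connW JW _ _ _ out i(2)] mark_less[of i' i] mark_bounds i(1) that(1)
          by blast
      qed
    qed
    then show ?thesis
      by blast
  qed auto
  then obtain j0 where j0: "\<And>i. i < 10 \<Longrightarrow> i div 2 \<noteq> j0 \<Longrightarrow> e (mark i) \<in> ?W"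
    by blast
  have ev: "\<forall>\<^sub>F k in sequentially. e (mark i) \<in> C k" if i: "i < 10" "i div 2 \<noteq> j0" for i
  proof -
    obtain k0 where k0: "e (mark i) \<in> C k0"
      using j0[OF i] by blast
    have "e (mark i) \<in> C (k0 + k)" for k
    proof -
      have "e (mark i) = (f ^^ (M * k)) (e (mark i))"
        using funpow_period_dvd[OF common_period(3)[OF i(1)], of "M * k"] M(2) by simp
      also have "\<dots> \<in> (f ^^ (M * k)) ` C k0"
        using k0 by blast
      also have "(f ^^ (M * k)) ` C k0 = C (k0 + k)"
        unfolding C_def add_mult_distrib2 add.commute[of "M * k0"] funpow_add by (simp only: image_comp o_assoc)
      finally show ?thesis .
    qed
    then show ?thesis
      unfolding eventually_sequentially by (metis le_add_diff_inverse)
  qed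
  have "\<forall>\<^sub>F k in sequentially. \<forall>i\<in>{i. i < 10 \<and> i div 2 \<noteq> j0}. e (mark i) \<in> C k"
    using ev by (intro eventually_ball_finite) auto
  then have "\<forall>\<^sub>F k in sequentially. covers_blocks (C k)"
  proof eventually_elim
    case (elim k)
    then show ?case
      using connected_contains_blocks[OF conn, of j0 k] by blast
  qed
  then show ?thesis
    unfolding C_def .
qed

lemma horseshoe:
  obtains K where "K \<ge> 1" "\<And>j. j < 5 \<Longrightarrow> covers_blocks ((f ^^ K) ` block j)"
proof -
  have "\<forall>\<^sub>F k in sequentially. covers_blocks ((f ^^ (common_period * k)) ` block j)" if "j < 5" for j
    unfolding block_def[of j] using block_interval[OF that] common_period that
    by (intro eventually_covers_blocks[where w = "mark (2 * j)"]) auto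
  then have "\<forall>\<^sub>F k in sequentially. \<forall>j\<in>{..<5}. covers_blocks ((f ^^ (common_period * k)) ` block j)"
    by (intro eventually_ball_finite) auto
  then have "\<forall>\<^sub>F k in sequentially. k \<ge> 1 \<and> (\<forall>j\<in>{..<5}. covers_blocks ((f ^^ (common_period * k)) ` block j))"
    using eventually_ge_at_top[of 1] by eventually_elim auto
  from eventually_happens[OF this]
  obtain k where k: "k \<ge> 1" "\<And>j. j < 5 \<Longrightarrow> covers_blocks ((f ^^ (common_period * k)) ` block j)"
    by (auto simp del: image_image)
  show ?thesis
    by (rule that[OF _ k(2)]) (use k(1) common_period(1) in simp)
qed

text \<open>Two blocks that each cover three of five blocks cover a common one, whose points then
  have two different preimages under the same iterate.\<close>

lemma not_homeomorphic: "\<not> homeomorphic_map X X f"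
proof
  assume "homeomorphic_map X X f"
  then have inj: "inj_on f (topspace X)"
    using homeomorphic_imp_injective_map by blast
  have injn: "inj_on (f ^^ n) (topspace X)" for n
  proof (induction n)
    case (Suc n)
    have "inj_on f ((f ^^ n) ` topspace X)"
      using inj by (rule inj_on_subset) (use iterate_image_subset in blast)
    from comp_inj_on[OF Suc this] show ?case
      by (simp add: comp_def)
  qed simp
  obtain K where K: "\<And>j. j < 5 \<Longrightarrow> covers_blocks ((f ^^ K) ` block j)"
    using horseshoe by metis
  let ?G = "\<lambda>j. {i. i < 5 \<and> block i \<subseteq> (f ^^ K) ` block j}"
  have "?G 0 \<inter> ?G 1 \<noteq> {}"
  proof
    assume "?G 0 \<inter> ?G 1 = {}"
    then have "card (?G 0 \<union> ?G 1) = card (?G 0) + card (?G 1)"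
      by (intro card_Un_disjoint) auto
    moreover have "card (?G 0 \<union> ?G 1) \<le> card {..<5::nat}"
      by (intro card_mono) auto
    ultimately show False
      using K[of 0] K[of 1] by simp
  qed
  then obtain i where i: "i < 5" "block i \<subseteq> (f ^^ K) ` block 0" "block i \<subseteq> (f ^^ K) ` block 1"
    by auto
  obtain x where "x \<in> block i"
    using block_nonempty[OF i(1)] by blast
  then obtain y z where "y \<in> block 0" "z \<in> block 1" "x = (f ^^ K) y" "x = (f ^^ K) z"
    using i by blast
  moreover from this have "y = z"
    using injn[of K] block_sub[of 0] block_sub[of 1] by (auto simp: inj_on_def)
  ultimately show False
    using block_disjoint[of 0 1] by auto
qed

section \<open>Positive topological entropy\<close>

lemma blocks_separated:
  assumes M: "mtopology_of M = X"
  obtains r where "r > 0" "\<And>i j x y. i < 5 \<Longrightarrow> j < 5 \<Longrightarrow> i \<noteq> j \<Longrightarrow> x \<in> block i \<Longrightarrow> y \<in> block j \<Longrightarrow> r \<le> mdist M x y"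
proof -
  have one: "\<exists>r>0. \<forall>x\<in>block i. \<forall>y\<in>block j. r \<le> mdist M x y" if ij: "i < 5" "j < 5" "i \<noteq> j" for i j
  proof -
    let ?I = "\<lambda>i. {mark (2 * i)..mark (2 * i + 1)}"
    let ?K = "?I i \<times> ?I j"
    let ?g = "\<lambda>p. mdist M (e (fst p)) (e (snd p))"
    have e: "continuous_map (top_of_set (?I k)) X e" if "k < 5" for k
      using block_interval[OF that] by (intro continuous_arc_on) auto
    have "continuous_map (top_of_set ?K) (top_of_set (?I i)) fst"
      by (auto intro!: continuous_intros)
    from continuous_map_compose[OF this e[OF ij(1)]]
    have 1: "continuous_map (top_of_set ?K) (mtopology_of M) (\<lambda>p. e (fst p))"
      by (simp add: M comp_def)
    have "continuous_map (top_of_set ?K) (top_of_set (?I j)) snd"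
      by (auto intro!: continuous_intros)
    from continuous_map_compose[OF this e[OF ij(2)]]
    have 2: "continuous_map (top_of_set ?K) (mtopology_of M) (\<lambda>p. e (snd p))"
      by (simp add: M comp_def)
    have g: "continuous_on ?K ?g"
      using continuous_map_mdist[OF 1 2] by simp
    have K: "compact ?K" "?K \<noteq> {}"
      using block_interval[OF ij(1)] block_interval[OF ij(2)] by (auto intro!: compact_Times)
    obtain p where p: "p \<in> ?K" "\<And>q. q \<in> ?K \<Longrightarrow> ?g p \<le> ?g q"
      using continuous_attains_inf[OF K g] by blast
    have in_b: "e (fst p) \<in> block i" "e (snd p) \<in> block j"
      using p(1) unfolding block_def by auto
    then have "e (fst p) \<noteq> e (snd p)"
      using block_disjoint[OF ij] by auto
    moreover have "e (fst p) \<in> mspace M" "e (snd p) \<in> mspace M"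
      using in_b block_sub[OF ij(1)] block_sub[OF ij(2)] M by auto
    ultimately have "?g p > 0"
      by (metis mdist_nonneg mdist_zero order_le_less)
    moreover have "?g p \<le> mdist M x y" if "x \<in> block i" "y \<in> block j" for x y
      using that p(2) unfolding block_def by force
    ultimately show ?thesis
      by blast
  qed
  have "\<forall>q\<in>{..<5}\<times>{..<5}. \<exists>r>0. fst q \<noteq> snd q \<longrightarrow> (\<forall>x\<in>block (fst q). \<forall>y\<in>block (snd q). r \<le> mdist M x y)"
    using one by (metis lessThan_iff mem_Sigma_iff prod.collapse zero_less_one)
  then obtain r where r: "\<And>q. q \<in> {..<5}\<times>{..<5} \<Longrightarrow> r q > 0"
    "\<And>q x y. q \<in> {..<5}\<times>{..<5} \<Longrightarrow> fst q \<noteq> snd q \<Longrightarrow> x \<in> block (fst q) \<Longrightarrow> y \<in> block (snd q) \<Longrightarrow> r q \<le> mdist M x y"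
    by metis
  let ?R = "r ` ({..<5::nat}\<times>{..<5::nat})"
  have fin: "finite ?R" "?R \<noteq> {}"
    by (simp_all add: lessThan_empty_iff)
  show ?thesis
  proof (rule that[of "Min ?R"])
    show "Min ?R > 0"
      using Min_in[OF fin] r(1) by auto
    fix i j x y assume ij: "i < (5::nat)" "j < (5::nat)" "i \<noteq> j" "x \<in> block i" "y \<in> block j"
    have "Min ?R \<le> r (i, j)"
      using ij by (intro Min_le fin) auto
    also have "\<dots> \<le> mdist M x y"
      using ij r(2)[of "(i, j)" x y] by simp
    finally show "Min ?R \<le> mdist M x y" .
  qed
qed

definition apart :: "nat \<Rightarrow> nat \<Rightarrow> 'a \<Rightarrow> 'a \<Rightarrow> bool" where
  "apart K m x y \<longleftrightarrow> (\<exists>k\<le>m. \<exists>a<5. \<exists>b<5. a \<noteq> b \<and> (f ^^ (K * k)) x \<in> block a \<and> (f ^^ (K * k)) y \<in> block b)"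

lemma apart_shift: "apart K m ((f ^^ K) x) ((f ^^ K) y) \<Longrightarrow> apart K (Suc m) x y"
proof -
  assume "apart K m ((f ^^ K) x) ((f ^^ K) y)"
  then obtain k a b where k: "k \<le> m" "a < 5" "b < 5" "a \<noteq> b"
    "(f ^^ (K * k)) ((f ^^ K) x) \<in> block a" "(f ^^ (K * k)) ((f ^^ K) y) \<in> block b"
    unfolding apart_def by blast
  have "(f ^^ (K * k)) ((f ^^ K) z) = (f ^^ (K * Suc k)) z" for z
    by (simp add: add.commute[of K] funpow_add)
  with k show ?thesis
    unfolding apart_def by (metis Suc_le_mono)
qed

text \<open>Block \<open>i\<close> covers two blocks, each carrying \<open>2 ^ m\<close> points by
  induction. Chosen preimages of all these points separate at time \<open>K\<close> if their images
  lie in different blocks, and later otherwise.\<close>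

lemma separated_itineraries:
  assumes K: "\<And>j. j < 5 \<Longrightarrow> covers_blocks ((f ^^ K) ` block j)" and i: "i < 5"
  shows "\<exists>E. E \<subseteq> block i \<and> finite E \<and> card E = 2 ^ m \<and> (\<forall>x\<in>E. \<forall>y\<in>E. x \<noteq> y \<longrightarrow> apart K m x y)"
  using i
proof (induction m arbitrary: i)
  case 0
  then obtain x where "x \<in> block i"
    using block_nonempty by blast
  then show ?case
    by (intro exI[of _ "{x}"]) auto
next
  case (Suc m)
  let ?A = "{j. j < 5 \<and> block j \<subseteq> (f ^^ K) ` block i}"
  have "\<not> card ?A \<le> Suc 0"
    using K[OF Suc.prems] by simp
  moreover have "finite ?A"
    by simp
  ultimately obtain a b where ab: "a \<in> ?A" "b \<in> ?A" "a \<noteq> b"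
    by (simp only: card_le_Suc0_iff_eq) blast
  then have ab5: "a < 5" "b < 5"
    by simp_all
  obtain Ea where Ea: "Ea \<subseteq> block a" "finite Ea" "card Ea = 2 ^ m"
    "\<forall>x\<in>Ea. \<forall>y\<in>Ea. x \<noteq> y \<longrightarrow> apart K m x y"
    using Suc.IH[OF ab5(1)] by blast
  obtain Eb where Eb: "Eb \<subseteq> block b" "finite Eb" "card Eb = 2 ^ m"
    "\<forall>x\<in>Eb. \<forall>y\<in>Eb. x \<noteq> y \<longrightarrow> apart K m x y"
    using Suc.IH[OF ab5(2)] by blast
  let ?E = "Ea \<union> Eb"
  have disj: "Ea \<inter> Eb = {}"
    using Ea(1) Eb(1) block_disjoint[OF ab5 ab(3)] by blast
  have "?E \<subseteq> (f ^^ K) ` block i"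
    using Ea(1) Eb(1) ab by blast
  then obtain F where F: "F \<subseteq> block i" "inj_on (f ^^ K) F" "?E = (f ^^ K) ` F"
    unfolding subset_image_inj by blast
  have "card F = card ?E"
    unfolding F(3) using F(2) by (simp add: card_image)
  also have "\<dots> = 2 ^ Suc m"
    using Ea(2,3) Eb(2,3) disj by (simp add: card_Un_disjoint)
  finally have cF: "card F = 2 ^ Suc m" .
  have finF: "finite F"
    using cF by (intro card_ge_0_finite) simp
  have "apart K (Suc m) x y" if xy: "x \<in> F" "y \<in> F" "x \<noteq> y" for x y
  proof -
    let ?x = "(f ^^ K) x" and ?y = "(f ^^ K) y"
    have ne: "?x \<noteq> ?y"
      using F(2) xy by (auto simp: inj_on_def)
    have E: "?x \<in> ?E" "?y \<in> ?E"
      unfolding F(3) using xy by blast+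
    have one: "apart K (Suc m) x y" if "?x \<in> block a'" "?y \<in> block b'" "a' < 5" "b' < 5" "a' \<noteq> b'" for a' b'
      using that unfolding apart_def by (intro exI[of _ 1]) auto
    consider "?x \<in> Ea" "?y \<in> Ea" | "?x \<in> Eb" "?y \<in> Eb" | "?x \<in> Ea" "?y \<in> Eb" | "?x \<in> Eb" "?y \<in> Ea"
      using E by blast
    then show ?thesis
    proof cases
      case 1
      then show ?thesis
        using Ea(4) ne by (intro apart_shift) blast
    next
      case 2
      then show ?thesis
        using Eb(4) ne by (intro apart_shift) blast
    next
      case 3
      then show ?thesis
        using one[of a b] Ea(1) Eb(1) ab5 ab(3) by blast
    next
      case 4
      then show ?thesis
        using one[of b a] Ea(1) Eb(1) ab5 ab(3) by blast
    qed
  qed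
  then show ?case
    using F(1) finF cF by blast
qed

lemma entropy_pos:
  assumes "metrizable_space X"
  shows "topological_entropy X f > 0"
proof -
  obtain M where M: "mtopology_of M = X"
    using assms Metric_space.mtopology_of unfolding metrizable_space_def by metis
  obtain r where r: "r > 0" "\<And>i j x y. i < 5 \<Longrightarrow> j < 5 \<Longrightarrow> i \<noteq> j \<Longrightarrow> x \<in> block i \<Longrightarrow> y \<in> block j \<Longrightarrow> r \<le> mdist M x y"
    using blocks_separated[OF M] by metis
  obtain K where K: "K \<ge> 1" "\<And>j. j < 5 \<Longrightarrow> covers_blocks ((f ^^ K) ` block j)"
    using horseshoe by metis
  define s where "s n = (SUP E\<in>{E. finite E \<and> bowen_separated M f n (r / 2) E}. ereal (ln (real (card E)) / real n))" for n
  \<comment> \<open>The \<open>2 ^ m\<close> points separate within \<open>K * (m + 1)\<close>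
    steps, a rate of \<open>m * ln 2 / (K * (m + 1))\<close>, which is at least this constant for
    \<open>m \<ge> 1\<close>. The bound is obtained along these times, enough for the limit
    superior.\<close>
  let ?c = "ereal (ln 2 / (2 * real K))"
  have big: "?c \<le> s (K * (m + 1))" if m: "m \<ge> 1" for m
  proof -
    obtain E where E: "E \<subseteq> block 0" "finite E" "card E = 2 ^ m"
      "\<forall>x\<in>E. \<forall>y\<in>E. x \<noteq> y \<longrightarrow> apart K m x y"
      using separated_itineraries[OF K(2), of 0 m] by auto
    have "bowen_separated M f (K * (m + 1)) (r / 2) E"
      unfolding bowen_separated_def
    proof (intro conjI ballI impI)
      show "E \<subseteq> mspace M"
        using E(1) block_sub[of 0] M by auto
      fix x y assume "x \<in> E" "y \<in> E" "x \<noteq> y"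
      then obtain k a b where k: "k \<le> m" "a < 5" "b < 5" "a \<noteq> b" "(f ^^ (K * k)) x \<in> block a" "(f ^^ (K * k)) y \<in> block b"
        using E(4) unfolding apart_def by blast
      have "K * k < K * (m + 1)"
        using k(1) K(1) by (intro mult_strict_left_mono) auto
      moreover have "r / 2 < mdist M ((f ^^ (K * k)) x) ((f ^^ (K * k)) y)"
        using r(1) r(2)[OF k(2-6)] by linarith
      ultimately show "\<exists>k<K * (m + 1). r / 2 < mdist M ((f ^^ k) x) ((f ^^ k) y)"
        by blast
    qed
    then have "ereal (ln (real (card E)) / real (K * (m + 1))) \<le> s (K * (m + 1))"
      unfolding s_def using E(2) by (intro SUP_upper) simp
    moreover have "ln 2 / (2 * real K) \<le> ln (real (card E)) / real (K * (m + 1))"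
    proof -
      have "ln (real (card E)) = real m * ln 2"
        using E(3) by (simp add: ln_realpow)
      moreover have "(1 + real m) * ln 2 \<le> (2 * real m) * ln 2"
        using m by (intro mult_right_mono) auto
      ultimately have "(1 + real m) * ln 2 / (2 * real K * (1 + real m)) \<le> (2 * ln (real (card E))) / (2 * real K * (1 + real m))"
        by (intro divide_right_mono) auto
      moreover have "(1 + real m) * ln 2 / (2 * real K * (1 + real m)) = ln 2 / (2 * real K)"
      proof -
        have "1 + real m \<noteq> 0"
          by linarith
        then show ?thesis
          by simp
      qed
      moreover have "(2 * ln (real (card E))) / (2 * real K * (1 + real m)) = ln (real (card E)) / real (K * (m + 1))"
        unfolding mult.assoc mult_divide_mult_cancel_left[OF zero_neq_numeral[symmetric]] by (simp add: distrib_left)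
      ultimately show ?thesis
        by linarith
    qed
    ultimately show ?thesis
      by (meson ereal_less_eq(3) order.trans)
  qed
  have "?c \<le> limsup s"
  proof (rule ccontr)
    assume "\<not> ?thesis"
    then have "\<forall>\<^sub>F n in sequentially. s n < ?c"
      by (intro Limsup_lessD) simp
    then obtain N where N: "\<And>n. n \<ge> N \<Longrightarrow> s n < ?c"
      unfolding eventually_sequentially by blast
    have "N \<le> K * (N + 1 + 1)"
      using K(1) by (metis le_add1 mult_le_mono nat_mult_1 order.trans add.assoc)
    then show False
      using N big[of "N + 1"] by (simp add: not_le[symmetric])
  qed
  also have "\<dots> \<le> bowen_entropy M f"
    unfolding bowen_entropy_def s_def using r(1) by (intro SUP_upper2[of "r / 2"]) auto
  also have "\<dots> = topological_entropy X f"
    using topological_entropy_eq[OF compact continuous_f M] by simp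
  finally have "?c \<le> topological_entropy X f" .
  moreover have "(0 :: ereal) < ?c"
    using K(1) by simp
  ultimately show ?thesis
    by (rule less_le_trans[rotated])
qed

text \<open>Replacing an interval by a periodic point in it makes its hitting time of \<open>V\<close> recur periodically, and
  transitivity along multiples of that period then aligns the next block.\<close>

lemma common_hitting_time:
  assumes V: "openin X V" "V \<inter> D \<noteq> {}" and r: "d dvd r" and M: "M \<ge> 1" "base_period dvd M" and s: "s \<le> 5"
  shows "\<exists>t p. p \<ge> 1 \<and> M dvd p \<and> (\<exists>q. t = r + M * q) \<and> (\<forall>j<s. \<forall>i. (f ^^ (t + p * i)) ` block j \<inter> V \<noteq> {})"
  using s
proof (induction s)
  case 0
  then show ?case
    using M by (intro exI[of _ r] exI[of _ M]) (auto intro: exI[of _ 0])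
next
  case (Suc s)
  then have "s \<le> 5"
    by simp
  from Suc.IH[OF this] obtain t p q where IH: "p \<ge> 1" "M dvd p" "t = r + M * q"
    "\<And>j i. j < s \<Longrightarrow> (f ^^ (t + p * i)) ` block j \<inter> V \<noteq> {}"
    by blast
  have s: "s < 5"
    using Suc.prems by simp
  let ?a = "mark (2 * s)" and ?b = "mark (2 * s + 1)"
  have ab: "0 < ?a" "?a < ?b" "?b < 1"
    using block_interval[OF s] .
  let ?U = "e ` {?a<..<?b}"
  have U: "openin X ?U" "?U \<noteq> {}" "?U \<subseteq> J"
    using ab open_arc_interval unfolding J_def by (auto intro!: image_mono)
  have "base_period dvd p"
    using M(2) IH(2) by (rule dvd_trans)
  have "d dvd t"
    using r d_dvd_base M(2) IH(3) by (metis dvd_add dvd_mult2 dvd_trans)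
  then have tD: "(f ^^ t) ` D = D"
    using image_fixed_iff by blast
  obtain v where v: "v \<in> V" "v \<in> D"
    using V(2) by blast
  then obtain x where x: "x \<in> D" "(f ^^ t) x \<in> V"
    using tD by (metis imageE)
  \<comment> \<open>At exponent \<open>p\<close> the hull of the new block's interior is all of
    \<open>D\<close>, so some time \<open>t + p * k\<close> succeeds; the earlier blocks tolerate
    added multiples of \<open>p\<close>.\<close>
  have "x \<in> X closure_of (\<Union>k. (f ^^ (p * k)) ` ?U)"
    using x(1) hull_eq_D[OF IH(1) \<open>base_period dvd p\<close> U] unfolding orbit_hull_def by simp
  moreover have "openin X (preim t V)" "x \<in> preim t V"
    using V(1) openin_preim x D_sub unfolding preim_def by auto
  ultimately obtain k where k: "(f ^^ (p * k)) ` ?U \<inter> preim t V \<noteq> {}"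
    unfolding in_closure_of by blast
  let ?t = "t + p * k"
  have "preim ?t V \<inter> ?U \<noteq> {}"
    using k U(1)[THEN openin_subset] unfolding preim_def by (auto simp: funpow_add)
  then obtain c c' where c: "?a < c" "c < c'" "c' < ?b" "e ` {c..c'} \<subseteq> preim ?t V"
    using open_meets_arc[OF openin_preim[OF V(1)], of ?t ?a ?b] ab by (metis less_imp_le)
  then obtain w l where w: "c < w" "w < c'" "l \<ge> 1" "(f ^^ l) (e w) = e w"
    using periodic[of c c'] ab by auto
  let ?p = "p * l"
  have new: "(f ^^ (?t + ?p * i)) ` block s \<inter> V \<noteq> {}" for i
  proof -
    have "(f ^^ (?t + ?p * i)) (e w) = (f ^^ ?t) ((f ^^ (?p * i)) (e w))"
      by (simp add: funpow_add)
    also have "(f ^^ (?p * i)) (e w) = e w"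
      using funpow_period_dvd[OF w(4), of "?p * i"] by simp
    finally have eq: "(f ^^ (?t + ?p * i)) (e w) = (f ^^ ?t) (e w)" .
    have "e w \<in> preim ?t V"
      using c(4) w by auto
    then have "(f ^^ (?t + ?p * i)) (e w) \<in> V"
      unfolding eq by (simp add: preim_def)
    moreover have "e w \<in> block s"
      unfolding block_def using c w by (intro imageI) auto
    ultimately show ?thesis
      by blast
  qed
  have old: "(f ^^ (?t + ?p * i)) ` block j \<inter> V \<noteq> {}" if "j < s" for i j
  proof -
    have "?t + ?p * i = t + p * (k + l * i)"
      by (simp add: algebra_simps)
    then show ?thesis
      using IH(4)[OF that, of "k + l * i"] by metis
  qed
  obtain u where "p = M * u"
    using IH(2) by blast
  then have "?t = r + M * (q + u * k)"
    unfolding IH(3) by (simp add: algebra_simps)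
  moreover have "?p \<ge> 1" "M dvd ?p"
    using IH(1,2) w(3) by auto
  ultimately show ?case
    using new old by (intro exI[of _ ?t] exI[of _ ?p]) (metis less_Suc_eq)
qed

text \<open>For every residue \<open>r\<close> modulo \<open>?M\<close> that is divisible by
  \<open>d\<close>, all blocks meet \<open>V\<close> at a common time \<open>h r\<close> congruent
  to \<open>r\<close>. A late \<open>x\<close> is \<open>h r\<close> plus a large multiple of
  \<open>?M\<close>, and after that multiple the interval already covers a block.\<close>

lemma mixing_core:
  assumes st: "0 < s" "s < t" "t < 1" and V: "openin X V" "V \<inter> D \<noteq> {}"
  shows "\<exists>N. \<forall>x\<ge>N. d dvd x \<longrightarrow> (f ^^ x) ` e ` {s..t} \<inter> V \<noteq> {}"
proof -
  obtain w q where w: "s < w" "w < t" "q \<ge> 1" "(f ^^ q) (e w) = e w"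
    using periodic[of s t] st by auto
  let ?M = "common_period * q"
  have M: "?M \<ge> 1" "common_period dvd ?M"
    using common_period(1) w(3) by simp_all
  have base: "base_period dvd ?M"
    using common_period(2) M(2) by (rule dvd_trans)
  have dM: "d dvd ?M"
    using d_dvd_base base by (rule dvd_trans)
  have "(f ^^ ?M) (e w) = e w"
    using funpow_period_dvd[OF w(4), of ?M] by simp
  then have "\<forall>\<^sub>F k in sequentially. covers_blocks ((f ^^ (?M * k)) ` e ` {s..t})"
    using eventually_covers_blocks[OF st _ _ _ M, of w] w by simp
  then obtain k0 where k0: "\<And>k. k \<ge> k0 \<Longrightarrow> covers_blocks ((f ^^ (?M * k)) ` e ` {s..t})"
    unfolding eventually_sequentially by blast
  have "\<exists>t'. d dvd r \<longrightarrow> (\<exists>q. t' = r + ?M * q) \<and> (\<forall>j<5. (f ^^ t') ` block j \<inter> V \<noteq> {})" for r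
  proof (cases "d dvd r")
    case True
    from common_hitting_time[OF V True M(1) base order.refl]
    obtain t' p q' where "t' = r + ?M * q'" "\<forall>j<5. \<forall>i. (f ^^ (t' + p * i)) ` block j \<inter> V \<noteq> {}"
      by blast
    moreover from this(2) have "\<forall>j<5. (f ^^ t') ` block j \<inter> V \<noteq> {}"
      by (metis add.right_neutral mult_0_right)
    ultimately show ?thesis
      by blast
  qed simp
  then obtain h where h: "\<And>r. d dvd r \<Longrightarrow> \<exists>q. h r = r + ?M * q" "\<And>r j. d dvd r \<Longrightarrow> j < 5 \<Longrightarrow> (f ^^ h r) ` block j \<inter> V \<noteq> {}"
    by metis
  let ?T = "Max (h ` {..<?M})"
  have T: "h r \<le> ?T" if "r < ?M" for r
    using that by (intro Max_ge) auto
  have "(f ^^ x) ` e ` {s..t} \<inter> V \<noteq> {}" if x: "x \<ge> ?T + ?M * k0" "d dvd x" for x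
  proof -
    let ?r = "x mod ?M"
    have r: "?r < ?M" "d dvd ?r"
      using M(1) x(2) dM by (auto simp: dvd_mod)
    obtain q' where q': "h ?r = ?r + ?M * q'"
      using h(1)[OF r(2)] by blast
    have le: "h ?r + ?M * k0 \<le> x"
      using T[OF r(1)] x(1) by linarith
    have x_eq: "x = ?r + ?M * (x div ?M)"
      by simp
    then have "?M * (q' + k0) \<le> ?M * (x div ?M)"
      using le q' unfolding add_mult_distrib2 by linarith
    then have "q' + k0 \<le> x div ?M"
      using M(1) by (simp only: mult_le_cancel1)
    then obtain k where k: "x div ?M = q' + k" "k \<ge> k0"
      by (metis add_le_imp_le_left le_Suc_ex le_add1 order.trans add.assoc le_add_same_cancel1 nat_le_iff_add)
    have "x = h ?r + ?M * k"
      using x_eq q' unfolding k(1) add_mult_distrib2 by linarith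
    then have fx: "(f ^^ x) = (f ^^ h ?r) \<circ> (f ^^ (?M * k))"
      by (metis funpow_add)
    have "{j. j < 5 \<and> block j \<subseteq> (f ^^ (?M * k)) ` e ` {s..t}} \<noteq> {}"
      using k0[OF k(2)] by (metis card.empty not_numeral_le_zero)
    then obtain j where j: "j < 5" "block j \<subseteq> (f ^^ (?M * k)) ` e ` {s..t}"
      by blast
    then have "(f ^^ h ?r) ` block j \<subseteq> (f ^^ x) ` e ` {s..t}"
      unfolding fx image_comp[symmetric] by blast
    then show ?thesis
      using h(2)[OF r(2) j(1)] by blast
  qed
  then show ?thesis
    by blast
qed

text \<open>\<open>U\<close> is pulled back to a subinterval of the arc along a multiple of
  \<open>base_period\<close>. These steps map \<open>D\<close> to itself and are divisible by
  \<open>d\<close>, so the total time remains admissible for \<open>mixing_core\<close>.\<close>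

lemma mixing_D:
  assumes U: "openin X U" "U \<inter> D \<noteq> {}" and V: "openin X V" "V \<inter> D \<noteq> {}"
  shows "\<exists>n0\<ge>1. \<forall>n\<ge>n0. (f ^^ (d * n)) ` (U \<inter> D) \<inter> (V \<inter> D) \<noteq> {}"
proof -
  obtain k where k: "(f ^^ (base_period * k)) ` J \<inter> U \<noteq> {}"
    using U unfolding D_def orbit_hull_def in_closure_of disjoint_iff by blast
  let ?b = "base_period * k"
  have "preim ?b U \<inter> e ` {0<..<1} \<noteq> {}"
    using k J_sub unfolding preim_def J_def by auto
  then obtain s t where st: "0 < s" "s < t" "t < 1" "e ` {s..t} \<subseteq> preim ?b U"
    using open_meets_arc[OF openin_preim[OF U(1)], of ?b 0 1] by (metis order.refl)
  obtain N where N: "\<And>x. x \<ge> N \<Longrightarrow> d dvd x \<Longrightarrow> (f ^^ x) ` e ` {s..t} \<inter> V \<noteq> {}"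
    using mixing_core[OF st(1-3) V] by blast
  have stJ: "e ` {s..t} \<subseteq> D"
    using st J_D unfolding J_def by (intro subset_trans[OF _ J_D[unfolded J_def]] image_mono) auto
  have "(f ^^ (d * n)) ` (U \<inter> D) \<inter> (V \<inter> D) \<noteq> {}" if n: "n \<ge> N + 1" for n
  proof -
    have "d * n \<ge> 1 * n"
      using d_pos by (rule mult_le_mono1)
    then have "d * n + ?b \<ge> N"
      using n by linarith
    moreover have "d dvd d * n + ?b"
      using d_dvd_base by simp
    ultimately obtain y where y: "y \<in> {s..t}" "(f ^^ (d * n + ?b)) (e y) \<in> V"
      using N by blast
    let ?u = "(f ^^ ?b) (e y)"
    have "?u \<in> U"
      using st(4) y(1) unfolding preim_def by blast
    moreover have "?u \<in> D"
      using stJ y(1) image_iterate_fixed[OF image_base_period, of k] by blast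
    moreover have "(f ^^ (d * n)) ?u \<in> V"
      using y(2) by (simp add: funpow_add)
    moreover have "(f ^^ (d * n)) ?u \<in> D"
      using \<open>?u \<in> D\<close> image_iterate_fixed[OF image_d, of n] by blast
    ultimately show ?thesis
      by blast
  qed
  then show ?thesis
    by (intro exI[of _ "N + 1"]) auto
qed

lemma mixing_piece:
  assumes i: "i < d"
  shows "strongly_mixing (subtopology X (piece i)) (f ^^ d)"
  unfolding strongly_mixing_def
proof (intro conjI allI impI)
  have "(f ^^ d) ` piece i = piece (i + d)"
    by (simp add: image_piece add.commute)
  also have "\<dots> = piece i"
    unfolding piece_def using image_mod_d[of "i + d"] image_mod_d[of i] by simp
  finally have fd: "(f ^^ d) ` piece i = piece i" .
  show "continuous_map (subtopology X (piece i)) (subtopology X (piece i)) (f ^^ d)"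
    using fd continuous_map_from_subtopology[OF continuous_iterate, of "piece i" d]
    unfolding continuous_map_in_subtopology by auto
  fix U V
  assume "openin (subtopology X (piece i)) U \<and> U \<noteq> {} \<and> openin (subtopology X (piece i)) V \<and> V \<noteq> {}"
  then obtain U' V' where U': "openin X U'" "U = U' \<inter> piece i" "U \<noteq> {}"
    and V': "openin X V'" "V = V' \<inter> piece i" "V \<noteq> {}"
    by (auto simp: openin_subtopology)
  have "preim i U' \<inter> D \<noteq> {}" "preim i V' \<inter> D \<noteq> {}"
    using U'(2,3) V'(2,3) D_sub unfolding piece_def preim_def by auto
  then obtain n0 where n0: "n0 \<ge> 1" "\<And>n. n \<ge> n0 \<Longrightarrow> (f ^^ (d * n)) ` (preim i U' \<inter> D) \<inter> (preim i V' \<inter> D) \<noteq> {}"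
    using mixing_D[of "preim i U'" "preim i V'"] openin_preim U'(1) V'(1) by blast
  have "((f ^^ d) ^^ n) ` U \<inter> V \<noteq> {}" if n: "n \<ge> n0" for n
  proof -
    obtain x where x: "x \<in> preim i U'" "x \<in> D" "(f ^^ (d * n)) x \<in> preim i V'" "(f ^^ (d * n)) x \<in> D"
      using n0(2)[OF n] by blast
    have "(f ^^ i) x \<in> U"
      using x(1,2) unfolding U'(2) piece_def preim_def by blast
    moreover have "(f ^^ i) ((f ^^ (d * n)) x) \<in> V"
      using x(3,4) unfolding V'(2) piece_def preim_def by blast
    moreover have "(f ^^ i) ((f ^^ (d * n)) x) = ((f ^^ d) ^^ n) ((f ^^ i) x)"
      by (metis add.commute comp_apply funpow_add funpow_mult)
    ultimately show ?thesis
      by (metis IntI empty_iff imageI)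
  qed
  then show "\<exists>n0\<ge>1. \<forall>n\<ge>n0. ((f ^^ d) ^^ n) ` U \<inter> V \<noteq> {}"
    using n0(1) by blast
qed

lemma relatively_mixing: "relatively_strongly_mixing X f"
  unfolding relatively_strongly_mixing_def using rpd mixing_piece by blast

lemma periodic_points_dense: "X closure_of (periodic_points X f) = topspace X"
proof
  show "topspace X \<subseteq> X closure_of (periodic_points X f)"
  proof
    fix x assume x: "x \<in> topspace X"
    have "\<exists>y. y \<in> periodic_points X f \<and> y \<in> V" if V: "x \<in> V" "openin X V" for V
    proof -
      have "V \<noteq> {}"
        using V(1) by blast
      from meet[OF open_J J_nonempty V(2) this] obtain n where n: "(f ^^ n) ` J \<inter> V \<noteq> {}" .
      then have "preim n V \<inter> e ` {0<..<1} \<noteq> {}"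
        using J_sub unfolding preim_def J_def by auto
      then obtain s t where st: "0 < s" "s < t" "t < 1" "e ` {s..t} \<subseteq> preim n V"
        using open_meets_arc[OF openin_preim[OF V(2)], of n 0 1] by (metis order.refl)
      then obtain w q where w: "s < w" "w < t" "q \<ge> 1" "(f ^^ q) (e w) = e w"
        using periodic[of s t] by auto
      have "(f ^^ q) ((f ^^ n) (e w)) = (f ^^ n) ((f ^^ q) (e w))"
        by (metis add.commute comp_apply funpow_add)
      then have "(f ^^ n) (e w) \<in> periodic_points X f"
        unfolding periodic_points_def using w st iterate_in[OF arc_in, of w n] by auto
      moreover have "(f ^^ n) (e w) \<in> V"
        using st(4) w unfolding preim_def image_subset_iff by auto
      ultimately show ?thesis
        by blast
    qed
    then show "x \<in> X closure_of (periodic_points X f)"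
      using x unfolding in_closure_of by blast
  qed
qed (rule closure_of_subset_topspace)

end

context periodic_arc
begin

lemma ex_full_arc: "\<exists>e'. full_arc X f e'"
proof -
  obtain p a b where p: "p \<in> topspace X" "0 \<le> a" "a < b" "b \<le> 1" "\<And>i x. a < x \<Longrightarrow> x < b \<Longrightarrow> (f ^^ i) p \<noteq> e x"
    using avoid_orbit by metis
  let ?e = "\<lambda>x. e (a + (b - a) * x)"
  interpret sub: periodic_arc X f ?e
    using periodic_subarc[OF p(2-4)] .
  have inside: "a < a + (b - a) * x \<and> a + (b - a) * x < b" if "0 < x" "x < 1" for x
    using affine_between[OF p(3) that] by blast
  interpret sub: escaping_arc X f ?e
    by unfold_locales (use p(1,5) inside in blast)
  obtain c c' where c: "0 \<le> c" "c < c'" "c' \<le> 1" "\<And>N. N \<ge> 1 \<Longrightarrow> sub.full N c c'"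
    using sub.ex_full by blast
  let ?l = "\<lambda>x. c + (c' - c) * x"
  interpret fin: periodic_arc X f "\<lambda>x. ?e (?l x)"
    using sub.periodic_subarc[OF c(1-3)] .
  have "full_arc X f (\<lambda>x. ?e (?l x))"
  proof
    fix N :: nat and s t :: real assume N: "N \<ge> 1" "0 \<le> s" "s < t" "t \<le> 1"
    have img: "?l ` {s<..<t} = {?l s<..<?l t}" for s t :: real
    proof
      show "{?l s<..<?l t} \<subseteq> ?l ` {s<..<t}"
      proof
        fix y assume y: "y \<in> {?l s<..<?l t}"
        have "s < (y - c) / (c' - c)" "(y - c) / (c' - c) < t"
          using y c(2) by (simp_all add: field_simps)
        moreover have "y = ?l ((y - c) / (c' - c))"
          using c(2) by simp
        ultimately show "y \<in> ?l ` {s<..<t}"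
          by (metis greaterThanLessThan_iff imageI)
      qed
    qed (use c(2) in auto)
    have "(c' - c) * t \<le> (c' - c) * 1"
      using N c(2) by (intro mult_left_mono) auto
    then have "c \<le> ?l s" "?l s < ?l t" "?l t \<le> c'"
      using N c(2) unfolding mult_1_right by (simp, simp, linarith)
    then have "?e ` {c<..<c'} \<subseteq> orbit_hull N (?e ` {?l s<..<?l t})"
      using c(4)[OF N(1)] unfolding sub.full_def by blast
    moreover have "(\<lambda>x. ?e (?l x)) ` {0<..<1} = ?e ` {c<..<c'}"
    proof -
      have "(\<lambda>x. ?e (?l x)) ` {0<..<1} = ?e ` (?l ` {0<..<1})"
        by (simp only: image_image)
      then show ?thesis
        unfolding img by simp
    qed
    moreover have "(\<lambda>x. ?e (?l x)) ` {s<..<t} = ?e ` {?l s<..<?l t}"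
    proof -
      have "(\<lambda>x. ?e (?l x)) ` {s<..<t} = ?e ` (?l ` {s<..<t})"
        by (simp only: image_image)
      then show ?thesis
        unfolding img .
    qed
    ultimately show "(\<lambda>x. ?e (?l x)) ` {0<..<1} \<subseteq> orbit_hull N ((\<lambda>x. ?e (?l x)) ` {s<..<t})"
      by simp
  qed
  then show ?thesis
    by blast
qed

end

section \<open>Arcs without periodic points\<close>

lemma cis_eq_iff_Ints: "cis (2 * pi * a) = cis (2 * pi * b) \<longleftrightarrow> a - b \<in> \<int>"
proof -
  have "cis (2 * pi * a) = cis (2 * pi * b) \<longleftrightarrow> cis (2 * pi * (a - b)) = 1"
    using cis_divide[of "2 * pi * a" "2 * pi * b"] by (auto simp: right_diff_distrib field_simps)
  also have "\<dots> \<longleftrightarrow> a - b \<in> \<int>"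
  proof
    assume "cis (2 * pi * (a - b)) = 1"
    then have "cos (2 * pi * (a - b)) = 1"
      by (simp add: complex_eq_iff)
    then obtain n :: int where "2 * pi * (a - b) = real_of_int n * 2 * pi"
      unfolding cos_one_2pi_int by blast
    then have "a - b = of_int n"
      by simp
    then show "a - b \<in> \<int>"
      by simp
  qed simp
  finally show ?thesis .
qed

lemma cis_eq_1_Ints: "cis (2 * pi * a) = 1 \<longleftrightarrow> a \<in> \<int>"
  using cis_eq_iff_Ints[of a 0] by simp

lemma Ints_between: "(x :: real) \<in> \<int> \<Longrightarrow> of_int n - 1 < x \<Longrightarrow> x < of_int n + 1 \<Longrightarrow> x = of_int n"
proof -
  assume x: "x \<in> \<int>" "of_int n - 1 < x" "x < of_int n + 1"
  then obtain k where "x = of_int k"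
    by (auto elim: Ints_cases)
  moreover from this x(2,3) have "k = n"
    by linarith
  ultimately show ?thesis
    by simp
qed

lemma Ints_valued_constant:
  fixes g :: "real \<Rightarrow> real"
  assumes S: "connected S" "continuous_on S g" "\<And>x. x \<in> S \<Longrightarrow> g x \<in> \<int>" and xy: "x \<in> S" "y \<in> S"
  shows "g x = g y"
proof -
  have no: False if xy: "x \<in> S" "y \<in> S" "g x < g y" for x y
  proof -
    obtain m n :: int where mn: "g x = of_int m" "g y = of_int n"
      using S(3) xy(1,2) by (metis Ints_cases)
    then have "m + 1 \<le> n"
      using xy(3) by simp
    have "connected (g ` S)"
      using S by (intro connected_continuous_image)
    moreover have "g x \<le> of_int m + 1/2" "of_int m + 1/2 \<le> g y"
      using mn \<open>m + 1 \<le> n\<close> by linarith+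
    ultimately have "of_int m + 1/2 \<in> g ` S"
      using xy(1,2) unfolding connected_iff_interval by blast
    then obtain z where "z \<in> S" "g z = of_int m + 1/2"
      by auto
    then show False
      using S(3)[of z] Ints_between[of "g z" m] by auto
  qed
  show ?thesis
    using no[OF xy] no[OF xy(2,1)] by (cases "g x" "g y" rule: linorder_cases) blast+
qed

lemma avoids_Ints:
  fixes g :: "real \<Rightarrow> real"
  assumes S: "connected S" "continuous_on S g" "\<And>x. x \<in> S \<Longrightarrow> g x \<notin> \<int>" and x: "x \<in> S" and y: "y \<in> S"
  shows "of_int \<lfloor>g x\<rfloor> < g y" and "g y < of_int \<lfloor>g x\<rfloor> + 1"
proof -
  have conn: "connected (g ` S)"
    using S by (intro connected_continuous_image)
  have gx: "of_int \<lfloor>g x\<rfloor> \<le> g x" "g x \<le> of_int \<lfloor>g x\<rfloor> + 1"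
    by linarith+
  have no: "of_int n \<notin> g ` S" for n
    using S(3) by (metis Ints_of_int imageE)
  show "of_int \<lfloor>g x\<rfloor> < g y"
  proof (rule ccontr)
    assume "\<not> ?thesis"
    then have "of_int \<lfloor>g x\<rfloor> \<in> g ` S"
      using conn gx(1) x y unfolding connected_iff_interval by (metis imageI not_le less_imp_le linorder_le_less_linear)
    then show False
      using no by blast
  qed
  show "g y < of_int \<lfloor>g x\<rfloor> + 1"
  proof (rule ccontr)
    assume "\<not> ?thesis"
    then have "of_int (\<lfloor>g x\<rfloor> + 1) \<in> g ` S"
      using conn gx(2) x y unfolding connected_iff_interval of_int_add of_int_1
      by (metis imageI linorder_le_less_linear)
    then show False
      using no by blast
  qed
qed

section \<open>The projection to the circle and its lifts\<close>

context transitive_arc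
begin

text \<open>Collapsing the complement of the arc to a point turns the quotient into a circle; \<open>wind\<close> is the
  projection.\<close>

definition wind :: "'a \<Rightarrow> complex" where
  "wind p = (if p \<in> e ` {0<..<1} then cis (2 * pi * the_inv_into {0<..<1} e p) else 1)"

lemma wind_arc: "0 < x \<Longrightarrow> x < 1 \<Longrightarrow> wind (e x) = cis (2 * pi * x)"
  unfolding wind_def using the_inv_into_f_f[OF inj_arc, of x] by auto

lemma wind_outside: "p \<notin> e ` {0<..<1} \<Longrightarrow> wind p = 1"
  by (simp add: wind_def)

lemma wind_nonzero: "wind p \<noteq> 0"
  by (simp add: wind_def)

lemma norm_wind: "norm (wind p) = 1"
  by (simp add: wind_def)

text \<open>The projection is injective away from the collapsed point, so a nonintegral lift value
  determines the point of the space.\<close>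

lemma wind_eq_arc:
  assumes "wind p = cis (2 * pi * v)" "0 < v - of_int n" "v - of_int n < 1"
  shows "p = e (v - of_int n)"
proof -
  have "v \<notin> \<int>"
    using assms(2,3) by (metis Ints_cases diff_gt_0_iff_gt less_diff_eq diff_less_eq of_int_1 of_int_add of_int_less_iff add.commute zless_add1_eq not_less_iff_gr_or_eq)
  then have "wind p \<noteq> 1"
    using assms(1) cis_eq_1_Ints by simp
  then have "p \<in> e ` {0<..<1}"
    using wind_outside[of p] by blast
  then obtain x where x: "0 < x" "x < 1" "p = e x"
    by auto
  then have "v - x \<in> \<int>"
    using wind_arc[of x] assms(1) cis_eq_iff_Ints by metis
  then have "v - x = of_int n"
    using x assms by (intro Ints_between) auto
  then have "v - of_int n = x"
    by linarith
  then show ?thesis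
    using x by simp
qed

lemma wind_arc_Ints: "0 < x \<Longrightarrow> x < 1 \<Longrightarrow> wind (e x) = cis (2 * pi * v) \<Longrightarrow> v - x \<in> \<int>"
  using wind_arc[of x] cis_eq_iff_Ints by metis

text \<open>If \<open>W\<close> omits 1, its preimage is the image of an open parameter set. If
  \<open>W\<close> contains 1, the parameters sent outside \<open>W\<close> form a compact subset of
  the open interval, and its image is closed.\<close>

lemma continuous_wind: "continuous_map X euclidean wind"
  unfolding continuous_map_def
proof (intro conjI allI impI)
  fix W :: "complex set" assume "openin euclidean W"
  then have W: "open W"
    by simp
  let ?A = "\<lambda>W. {x \<in> {0<..<1}. cis (2 * pi * x) \<in> W}"
  have cont: "continuous_on S (\<lambda>x. cis (2 * pi * x))" for S
    by (intro continuous_intros)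
  show "openin X {x \<in> topspace X. wind x \<in> W}"
  proof (cases "1 \<in> W")
    case False
    have "{x \<in> topspace X. wind x \<in> W} = e ` ?A W"
    proof
      show "{x \<in> topspace X. wind x \<in> W} \<subseteq> e ` ?A W"
      proof
        fix p assume p: "p \<in> {x \<in> topspace X. wind x \<in> W}"
        then have "p \<in> e ` {0<..<1}"
          using False wind_outside[of p] by (cases "p \<in> e ` {0<..<1}") (simp_all del: image_iff)
        then show "p \<in> e ` ?A W"
          using p wind_arc by auto
      qed
    qed (use wind_arc arc_in in auto)
    moreover have "open (?A W)"
      using continuous_open_preimage[OF cont open_greaterThanLessThan W] by (simp add: vimage_def Int_def)
    then have "openin X (e ` ?A W)"
      by (rule open_arc) auto
    ultimately show ?thesis
      by simp
  next
    case True
    have eq: "?A (- W) = {x \<in> {0..1}. cis (2 * pi * x) \<in> - W}"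
      using True by (auto simp: less_le)
    have "closed {x \<in> {0..1}. cis (2 * pi * x) \<in> - W}"
      using continuous_closed_preimage[OF cont closed_atLeastAtMost, of "- W"] W
      by (simp add: vimage_def Int_def closed_def)
    then have "compact ({0..1} \<inter> {x \<in> {0..1}. cis (2 * pi * x) \<in> - W})"
      by (intro compact_Int_closed) auto
    moreover have "{0..1} \<inter> {x \<in> {0..1}. cis (2 * pi * x) \<in> - W} = ?A (- W)"
      unfolding eq by auto
    ultimately have "compact (?A (- W))"
      by simp
    then have "closedin X (e ` ?A (- W))"
      by (intro closed_arc) auto
    moreover have "wind p \<in> W \<longleftrightarrow> p \<notin> e ` ?A (- W)" for p
    proof (cases "p \<in> e ` {0<..<1}")
      case True
      then obtain x where x: "0 < x" "x < 1" "p = e x"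
        by auto
      then have "p \<in> e ` ?A (- W) \<longleftrightarrow> x \<in> ?A (- W)"
        by (auto simp: arc_eq_iff)
      then show ?thesis
        using x wind_arc[of x] by simp
    next
      case False
      then show ?thesis
        using \<open>1 \<in> W\<close> wind_outside[of p] by auto
    qed
    then have "{x \<in> topspace X. wind x \<in> W} = topspace X - e ` ?A (- W)"
      by blast
    ultimately show ?thesis
      by (simp add: openin_diff)
  qed
qed simp

lemma ex_wind_lift:
  assumes p: "continuous_map (top_of_set S) X p" and S: "convex (S :: real set)"
  obtains g where "continuous_on S g" "\<And>x. x \<in> S \<Longrightarrow> wind (p x) = cis (2 * pi * g x)"
proof -
  have "continuous_on S (\<lambda>x. wind (p x))"
    using continuous_map_compose[OF p continuous_wind] by (simp add: comp_def)
  then obtain l where l: "continuous_on S l" "\<And>x. x \<in> S \<Longrightarrow> wind (p x) = exp (l x)"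
    using continuous_logarithm_on_contractible[of S "\<lambda>x. wind (p x)"] wind_nonzero S
      convex_imp_contractible by metis
  show ?thesis
  proof (rule that[of "\<lambda>x. Im (l x) / (2 * pi)"])
    show "continuous_on S (\<lambda>x. Im (l x) / (2 * pi))"
      by (intro continuous_intros l(1)) auto
    fix x assume x: "x \<in> S"
    have "norm (exp (l x)) = 1"
      using norm_wind[of "p x"] l(2)[OF x] by simp
    then have "Re (l x) = 0"
      by simp
    then show "wind (p x) = cis (2 * pi * (Im (l x) / (2 * pi)))"
      using l(2)[OF x] by (simp add: exp_eq_polar)
  qed
qed

lemma lifts_differ_by_constant:
  fixes S :: "real set" and g h :: "real \<Rightarrow> real"
  assumes S: "connected S" "continuous_on S g" "continuous_on S h"
    and eq: "\<And>x. x \<in> S \<Longrightarrow> cis (2 * pi * g x) = cis (2 * pi * h x)" and xy: "x \<in> S" "y \<in> S"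
  shows "g x - h x = g y - h y"
  using Ints_valued_constant[OF S(1) _ _ xy, of "\<lambda>x. g x - h x"] S(2,3) eq
  by (auto simp: cis_eq_iff_Ints intro!: continuous_intros)

end

section \<open>Monotone lifts of iterates over an aperiodic arc\<close>

locale aperiodic_arc = transitive_arc +
  assumes aperiodic: "0 < x \<Longrightarrow> x < 1 \<Longrightarrow> n \<ge> 1 \<Longrightarrow> (f ^^ n) (e x) \<noteq> e x"
begin

text \<open>Among lifts that differ by integers the bounds select one. Its values lie between 0 and
  2, so that \<open>g x = 1\<close> exactly when \<open>(f ^^ m) (e x)\<close> is outside the arc;
  this explains the special level 1 below.\<close>

definition arc_lift :: "nat \<Rightarrow> (real \<Rightarrow> real) \<Rightarrow> bool" where
  "arc_lift m g \<longleftrightarrow> continuous_on {0<..<1} g \<and>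
     (\<forall>x. 0 < x \<and> x < 1 \<longrightarrow> wind ((f ^^ m) (e x)) = cis (2 * pi * g x) \<and> x < g x \<and> g x < x + 1)"

text \<open>A lift of \<open>f ^^ m\<close> cannot differ from the identity by an integer at any point of the arc, since
  this point would be periodic.\<close>

lemma ex_arc_lift:
  assumes m: "m \<ge> 1"
  obtains g where "arc_lift m g"
proof -
  have "continuous_map (top_of_set {0<..<1}) X (\<lambda>x. (f ^^ m) (e x))"
    using continuous_map_compose[OF continuous_arc continuous_iterate] by (simp add: comp_def)
  then obtain g where g: "continuous_on {0<..<1} g"
    "\<And>x. x \<in> {0<..<1} \<Longrightarrow> wind ((f ^^ m) (e x)) = cis (2 * pi * g x)"
    using ex_wind_lift by (metis convex_real_interval(8))
  let ?d = "\<lambda>x. g x - x"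
  have d: "continuous_on {0<..<1} ?d"
    by (intro continuous_intros g)
  have nint: "?d x \<notin> \<int>" if x: "x \<in> {0<..<1}" for x
  proof
    assume "?d x \<in> \<int>"
    then obtain n where n: "g x - x = of_int n"
      by (auto elim: Ints_cases)
    then have "x = g x - of_int n"
      by linarith
    then have "(f ^^ m) (e x) = e x"
      using wind_eq_arc[OF g(2)[OF x], of n] x by simp
    then show False
      using aperiodic x m by auto
  qed
  define c where "c = \<lfloor>?d (1/2)\<rfloor>"
  have half: "(1/2 :: real) \<in> {0<..<1}"
    by simp
  have b: "of_int c < ?d x" "?d x < of_int c + 1" if "x \<in> {0<..<1}" for x
    unfolding c_def
    using avoids_Ints[where S = "{0<..<1}" and g = ?d and x = "1/2" and y = x, OF _ d nint half] that
    by auto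
  show ?thesis
  proof (rule that[of "\<lambda>x. g x - of_int c"])
    have "cis (2 * pi * (g x - of_int c)) = cis (2 * pi * g x)" for x
      by (simp add: cis_eq_iff_Ints)
    then show "arc_lift m (\<lambda>x. g x - of_int c)"
      unfolding arc_lift_def using g b by (auto intro!: continuous_intros simp: algebra_simps)
  qed
qed

text \<open>Reversing the arc turns valleys of lifts into peaks and motion to the left into motion
  to the right.\<close>

lemma mirror_arc: "aperiodic_arc X f (\<lambda>x. e (1 - x))"
proof
  have "continuous_on {0<..<1} (\<lambda>x::real. 1 - x)"
    by (intro continuous_intros)
  then have "continuous_map (top_of_set {0<..<1}) (top_of_set {0<..<1}) (\<lambda>x::real. 1 - x)"
    by (auto simp: image_subset_iff)
  from continuous_map_compose[OF this continuous_arc]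
  show "continuous_map (top_of_set {0<..<1}) X (\<lambda>x. e (1 - x))"
    by (simp add: comp_def)
  show "inj_on (\<lambda>x. e (1 - x)) {0<..<1}"
    by (intro inj_onI) (auto simp: arc_eq_iff)
  show "openin X ((\<lambda>x. e (1 - x)) ` S)" if "open S" "S \<subseteq> {0<..<1}" for S
  proof -
    have "(\<lambda>x. 1 - x) ` S = (\<lambda>x. 1 - x) -` S"
      by force
    then have "open ((\<lambda>x. 1 - x) ` S)"
      using open_vimage[OF that(1), of "\<lambda>x. 1 - x"] by (simp add: continuous_intros)
    moreover have "(\<lambda>x. 1 - x) ` S \<subseteq> {0<..<1}"
      using that(2) by auto
    ultimately show ?thesis
      using open_arc[of "(\<lambda>x. 1 - x) ` S"] by (simp add: image_image)
  qed
  show "(f ^^ n) (e (1 - x)) \<noteq> e (1 - x)" if "0 < x" "x < 1" "n \<ge> 1" for x n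
    using aperiodic[of "1 - x" n] that by simp
qed

lemma arc_lift_unique_diff:
  assumes "arc_lift m g" "0 < x" "x < 1" "(f ^^ m) (e x) = e z" "x < z" "z < 1"
  shows "g x = z"
proof -
  have g: "wind (e z) = cis (2 * pi * g x)" "x < g x" "g x < x + 1"
    using assms(1-3) assms(4)[symmetric] unfolding arc_lift_def by auto
  then have "g x - z \<in> \<int>"
    using assms wind_arc_Ints[of z "g x"] by auto
  then have "g x - z = of_int 0"
    by (rule Ints_between) (use g assms in auto)
  then show ?thesis
    by simp
qed

lemma arc_lift_unique_diff':
  assumes "arc_lift m g" "0 < x" "x < 1" "(f ^^ m) (e x) = e z" "0 < z" "z < x"
  shows "g x = z + 1"
proof -
  have g: "wind (e z) = cis (2 * pi * g x)" "x < g x" "g x < x + 1"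
    using assms(1-3) assms(4)[symmetric] unfolding arc_lift_def by auto
  then have "g x - z \<in> \<int>"
    using assms wind_arc_Ints[of z "g x"] by auto
  then have "g x - z = of_int 1"
    by (rule Ints_between) (use g assms in auto)
  then show ?thesis
    by simp
qed

lemma last_level:
  fixes g :: "real \<Rightarrow> real"
  assumes "continuous_on {a..b} g" "a \<le> b" "g b < w" "w \<le> g a"
  obtains x where "a \<le> x" "x < b" "g x = w" "\<And>s. x < s \<Longrightarrow> s \<le> b \<Longrightarrow> g s < w"
proof -
  let ?S = "{x \<in> {a..b}. g x = w}"
  have "closed ?S"
    using continuous_closed_preimage_constant[OF assms(1), of w] by simp
  then have "compact ({a..b} \<inter> ?S)"
    by (intro compact_Int_closed) auto
  moreover have "{a..b} \<inter> ?S = ?S"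
    by auto
  ultimately have "compact ?S"
    by simp
  moreover have "?S \<noteq> {}"
    using IVT2'[of g b w a] assms by force
  ultimately obtain x where x: "x \<in> ?S" "\<And>y. y \<in> ?S \<Longrightarrow> y \<le> x"
    using compact_attains_sup[of ?S] by blast
  show ?thesis
  proof (rule that[of x])
    show "x < b"
      using x(1) assms(3) by (cases "x = b") auto
    fix s assume s: "x < s" "s \<le> b"
    show "g s < w"
    proof (rule ccontr)
      assume "\<not> ?thesis"
      then obtain y where "s \<le> y" "y \<le> b" "g y = w"
        using IVT2'[of g b w s] s x(1) assms continuous_on_subset[OF assms(1), of "{s..b}"] by auto
      then show False
        using x(1) x(2)[of y] s by auto
    qed
  qed (use x(1) in auto)
qed

text \<open>A valley of the lift below level 1: just above its bottom \<open>b\<close>, each level \<open>w\<close> is attained at some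
  \<open>x < b < x'\<close> with lower values in between. If \<open>f ^^ l\<close> maps \<open>e w\<close> back between \<open>x\<close> and \<open>x'\<close>, then the lift of
  \<open>f ^^ (m + l)\<close> gains one turn between \<open>x\<close> and \<open>x'\<close>, although it factors through a loop inside the arc.\<close>

lemma no_low_valley:
  assumes g: "arc_lift m g" and ab: "0 < a" "a < b" "b < 1" "g a > g b" and low: "g b < 1"
  shows False
proof -
  have gcont: "continuous_on {0<..<1} g"
    and gval: "\<And>x. 0 < x \<Longrightarrow> x < 1 \<Longrightarrow> wind ((f ^^ m) (e x)) = cis (2 * pi * g x)"
    and gbound: "\<And>x. 0 < x \<Longrightarrow> x < 1 \<Longrightarrow> x < g x \<and> g x < x + 1"
    using g unfolding arc_lift_def by auto
  \<comment> \<open>Levels below 1 keep the image of the valley inside the arc, where the lift of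
    \<open>f ^^ l\<close> applies.\<close>
  define w2 where "w2 = (if g a < 1 then g a else (1 + g b) / 2)"
  have w2: "g b < w2" "w2 \<le> g a" "w2 < 1"
    unfolding w2_def using ab low by auto
  define w1 where "w1 = (g b + w2) / 2"
  have w1: "g b < w1" "w1 < w2" "0 < w1"
    unfolding w1_def using w2 gbound[of b] ab by auto
  \<comment> \<open>To the right of \<open>b\<close> the lift climbs back by itself, since
    \<open>g c > c \<ge> w2\<close>.\<close>
  define c where "c = max ((b + 1) / 2) w2"
  have c: "b < c" "c < 1" "w2 < g c"
    using gbound[of c] ab w2 unfolding c_def by (auto simp: max_def field_simps split: if_splits)
  have "openin (top_of_set {0<..<1}) {x \<in> {0<..<1}. g x \<in> {..<w1}}"
    using continuous_openin_preimage_gen[OF gcont, of "{..<w1}"] by (simp add: vimage_def Int_def)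
  then have "open {x \<in> {0<..<1}. g x < w1}"
    by (simp add: openin_open_eq)
  moreover have "b \<in> {x \<in> {0<..<1}. g x < w1}"
    using ab w1 by auto
  ultimately obtain r where r: "r > 0" "ball b r \<subseteq> {x \<in> {0<..<1}. g x < w1}"
    unfolding open_contains_ball by blast
  have low_near: "0 < x \<and> x < 1 \<and> g x < w1" if "b - r < x" "x < b + r" for x
  proof -
    have "x \<in> ball b r"
      using that by (auto simp: dist_real_def abs_less_iff)
    then show ?thesis
      using r(2) by auto
  qed
  \<comment> \<open>Between \<open>s\<close> and \<open>t\<close> the lift is below
    \<open>w1\<close>, hence below the chosen level \<open>w\<close>. This forces
    \<open>x \<le> s\<close> and \<open>t \<le> x'\<close>, so the return point \<open>z\<close>
    falls between \<open>x\<close> and \<open>x'\<close>.\<close>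
  define s t where "s = b - r / 2" and "t = b + r / 2"
  have st: "s < b" "b < t" "0 < s" "t < 1"
    using r(1) low_near[of "b - r / 2"] low_near[of "b + r / 2"] unfolding s_def t_def by auto
  have "openin X (e ` {w1<..<w2})" "e ` {w1<..<w2} \<noteq> {}" "openin X (e ` {s<..<t})" "e ` {s<..<t} \<noteq> {}"
    using w1 w2 st by (auto intro!: open_arc_interval)
  then obtain l where l: "l \<ge> 1" "(f ^^ l) ` e ` {w1<..<w2} \<inter> e ` {s<..<t} \<noteq> {}"
    using meet by metis
  then obtain w z where w: "w1 < w" "w < w2" and z: "s < z" "z < t" and wz: "(f ^^ l) (e w) = e z"
    by auto
  have "continuous_on {a..b} g" "continuous_on {b..c} g"
    using ab c by (auto intro!: continuous_on_subset[OF gcont])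
  obtain x where x: "a \<le> x" "x < b" "g x = w" "\<And>u. x < u \<Longrightarrow> u \<le> b \<Longrightarrow> g u < w"
    using last_level[OF \<open>continuous_on {a..b} g\<close>, of w] ab w w1 w2 by auto
  have "continuous_on {- c..- b} (\<lambda>u. g (- u))"
    using continuous_on_compose[of "{- c..- b}" uminus g] \<open>continuous_on {b..c} g\<close>
    by (simp add: comp_def continuous_on_minus)
  then obtain y where y: "- c \<le> y" "y < - b" "g (- y) = w" "\<And>u. y < u \<Longrightarrow> u \<le> - b \<Longrightarrow> g (- u) < w"
    using last_level[where a = "- c" and b = "- b" and g = "\<lambda>u. g (- u)" and w = w] c w w1 w2 by auto
  define x' where "x' = - y"
  have x': "x' \<le> c" "b < x'" "g x' = w"
    using y(1-3) unfolding x'_def by auto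
  have x'4: "g u < w" if "b \<le> u" "u < x'" for u
    using y(4)[of "- u"] that unfolding x'_def by auto
  have x01: "0 < x" "x < 1" "0 < x'" "x' < 1"
    using x x' ab c by auto
  have "x < z" "z < x'"
  proof -
    have "x \<le> s"
      using low_near[of x] x(2,3) w(1) st(1) r(1) unfolding s_def by (cases "b - r < x") auto
    then show "x < z"
      using z by simp
    have "t \<le> x'"
      using low_near[of x'] x'(2,3) w(1) st(1) r(1) unfolding t_def by (cases "x' < b + r") auto
    then show "z < x'"
      using z by simp
  qed
  have range: "0 < g u \<and> g u < 1" if "u \<in> {x..x'}" for u
  proof -
    have "g u \<le> w"
      using x(3) x(4)[of u] x'(3) x'4[of u] that by (cases "u = x"; cases "u = x'"; cases "u \<le> b") auto
    moreover have "0 < u" "u < 1"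
      using that x01 by auto
    ultimately show ?thesis
      using gbound[of u] w w2 by auto
  qed
  have fm: "(f ^^ m) (e u) = e (g u)" if "u \<in> {x..x'}" for u
    using wind_eq_arc[OF gval, of u 0] range[OF that] that x01 by auto
  obtain gl where gl: "arc_lift l gl"
    using ex_arc_lift[OF l(1)] .
  have "m + l \<ge> 1"
    using l(1) by simp
  then obtain h where h: "arc_lift (m + l) h"
    using ex_arc_lift by blast
  have comp: "(f ^^ (m + l)) (e u) = (f ^^ l) (e (g u))" if "u \<in> {x..x'}" for u
    using fm[OF that] by (metis add.commute comp_apply funpow_add)
  have "h x = z"
    using arc_lift_unique_diff[OF h x01(1,2), of z] comp[of x] x(3) wz \<open>x < z\<close> \<open>z < x'\<close> x01 by auto
  moreover have "h x' = z + 1"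
    using arc_lift_unique_diff'[OF h x01(3,4), of z] comp[of x'] x'(3) wz \<open>x < z\<close> \<open>z < x'\<close> x01 by auto
  moreover have "h x - gl (g x) = h x' - gl (g x')"
  proof (rule lifts_differ_by_constant[where S = "{x..x'}"])
    show "continuous_on {x..x'} h"
      using h x01 unfolding arc_lift_def by (auto intro: continuous_on_subset)
    show "continuous_on {x..x'} (\<lambda>u. gl (g u))"
    proof (rule continuous_on_compose2[of "{0<..<1}" gl])
      show "continuous_on {x..x'} g"
        using x01 by (auto intro: continuous_on_subset[OF gcont])
    qed (use gl range in \<open>auto simp: arc_lift_def\<close>)
    show "cis (2 * pi * h u) = cis (2 * pi * gl (g u))" if u: "u \<in> {x..x'}" for u
    proof -
      have "wind ((f ^^ (m + l)) (e u)) = cis (2 * pi * h u)"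
        using h u x01 unfolding arc_lift_def by auto
      moreover have "wind ((f ^^ l) (e (g u))) = cis (2 * pi * gl (g u))"
        using gl range[OF u] unfolding arc_lift_def by auto
      ultimately show ?thesis
        using comp[OF u] by simp
    qed
  qed (use \<open>x < z\<close> \<open>z < x'\<close> in auto)
  ultimately show False
    using x(3) x'(3) by simp
qed

text \<open>Reversal conjugates \<open>wind\<close>, which negates lifts; adding 2 restores a
  displacement between 0 and 1.\<close>

lemma arc_lift_mirror:
  assumes g: "arc_lift m g"
  shows "aperiodic_arc.arc_lift f (\<lambda>x. e (1 - x)) m (\<lambda>x. 2 - g (1 - x))"
proof -
  interpret mir: aperiodic_arc X f "\<lambda>x. e (1 - x)"
    by (rule mirror_arc)
  have img: "(\<lambda>x. e (1 - x)) ` {0<..<1} = e ` {0<..<1}"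
  proof -
    have "(\<lambda>x. e (1 - x)) ` {0<..<1} = e ` ((\<lambda>x. 1 - x) ` {0<..<1})"
      by (simp only: image_image)
    also have "(\<lambda>x. 1 - x) ` {0<..<1::real} = {0<..<1}"
    proof (intro set_eqI iffI)
      fix x :: real assume "x \<in> {0<..<1}"
      then show "x \<in> (\<lambda>x. 1 - x) ` {0<..<1}"
        by (intro image_eqI[of x _ "1 - x"]) auto
    qed auto
    finally show ?thesis .
  qed
  have mwind: "mir.wind p = cnj (wind p)" for p
  proof (cases "p \<in> e ` {0<..<1}")
    case True
    then obtain x where x: "0 < x" "x < 1" "p = e x"
      by auto
    have "mir.wind (e (1 - (1 - x))) = cis (2 * pi * (1 - x))"
      using x by (intro mir.wind_arc) auto
    also have "\<dots> = cis (2 * pi * (- x))"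
      unfolding cis_eq_iff_Ints by simp
    finally show ?thesis
      using x wind_arc[of x] by (simp add: cis_cnj)
  next
    case False
    then show ?thesis
      using mir.wind_outside[of p] wind_outside[of p] img by simp
  qed
  have gc: "continuous_on {0<..<1} g"
    using g by (simp add: arc_lift_def)
  have "continuous_on {0<..<1} (\<lambda>x::real. 1 - x)"
    by (intro continuous_intros)
  then have "continuous_on {0<..<1} (\<lambda>x. g (1 - x))"
    by (rule continuous_on_compose2[OF gc]) auto
  then have c: "continuous_on {0<..<1} (\<lambda>x. 2 - g (1 - x))"
    by (intro continuous_intros)
  have "mir.wind ((f ^^ m) (e (1 - x))) = cis (2 * pi * (2 - g (1 - x)))"
    and "x < 2 - g (1 - x)" "2 - g (1 - x) < x + 1" if x: "0 < x" "x < 1" for x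
  proof -
    have "wind ((f ^^ m) (e (1 - x))) = cis (2 * pi * g (1 - x))" "1 - x < g (1 - x)" "g (1 - x) < 1 - x + 1"
      using g[unfolded arc_lift_def, THEN conjunct2, rule_format, of "1 - x"] x by simp_all
    moreover have "cis (2 * pi * (2 - g (1 - x))) = cis (2 * pi * (- g (1 - x)))"
      unfolding cis_eq_iff_Ints by simp
    ultimately show "mir.wind ((f ^^ m) (e (1 - x))) = cis (2 * pi * (2 - g (1 - x)))"
      "x < 2 - g (1 - x)" "2 - g (1 - x) < x + 1"
      using mwind by (auto simp: cis_cnj)
  qed
  then show ?thesis
    unfolding mir.arc_lift_def using c by auto
qed

text \<open>A descent from \<open>g a\<close> to \<open>g b\<close> must end at 1 or above by
  \<open>no_low_valley\<close>, and must start at 1 or below by the same lemma for the reversed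
  arc.\<close>

lemma arc_lift_mono:
  assumes g: "arc_lift m g" and ab: "0 < a" "a < b" "b < 1"
  shows "g a \<le> g b"
proof (rule ccontr)
  assume "\<not> ?thesis"
  then have less: "g b < g a"
    by simp
  interpret mir: aperiodic_arc X f "\<lambda>x. e (1 - x)"
    by (rule mirror_arc)
  have "g b \<ge> 1"
    using no_low_valley[OF g ab less] by (meson not_le)
  moreover have "2 - g a \<ge> 1"
    using mir.no_low_valley[OF arc_lift_mirror[OF g], of "1 - b" "1 - a"] ab less by fastforce
  ultimately show False
    using less by linarith
qed

text \<open>If \<open>f ^^ m\<close> collapsed an interval to a point of the arc, this point would return to the interval.\<close>

lemma arc_lift_strict:
  assumes g: "arc_lift m g" and ab: "0 < a" "a < b" "b < 1" and eq: "g a = g b"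
  shows "g a = 1"
proof (rule ccontr)
  assume ne: "g a \<noteq> 1"
  have val: "wind ((f ^^ m) (e x)) = cis (2 * pi * g a)" if "a \<le> x" "x \<le> b" for x
  proof -
    have "g x = g a"
      using arc_lift_mono[OF g, of a x] arc_lift_mono[OF g, of x b] that ab eq
      by (cases "x = a"; cases "x = b") auto
    then show ?thesis
      using g that ab unfolding arc_lift_def by auto
  qed
  have ga: "0 < g a" "g a < 2"
    using g ab unfolding arc_lift_def by (auto dest!: spec[of _ a])
  \<comment> \<open>Since \<open>g a\<close> lies between 0 and 2 and differs from 1, subtracting
    \<open>n\<close> leaves a parameter of the arc.\<close>
  define n :: int where "n = (if g a < 1 then 0 else 1)"
  have n: "0 < g a - of_int n" "g a - of_int n < 1"
    unfolding n_def using ga ne by auto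
  let ?p = "e (g a - of_int n)"
  have fm: "(f ^^ m) (e x) = ?p" if "a \<le> x" "x \<le> b" for x
    using wind_eq_arc[OF val[OF that] n] .
  have "openin X (e ` {a<..<b})" "e ` {a<..<b} \<noteq> {}"
    using ab by (auto intro!: open_arc_interval)
  from meet_ge[OF this this, of m] obtain i x where i: "i \<ge> m" "x \<in> {a<..<b}" "(f ^^ i) (e x) \<in> e ` {a<..<b}"
    by blast
  then obtain y where y: "y \<in> {a<..<b}" "(f ^^ i) (e x) = e y"
    by blast
  have "(f ^^ i) (e x) = (f ^^ (i - m)) ?p"
    using fm[of x] i(1,2) by (metis comp_apply funpow_add greaterThanLessThan_iff le_add_diff_inverse2 less_imp_le)
  then have "(f ^^ m) ((f ^^ (i - m)) ?p) = ?p"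
    using y fm[of y] by simp
  then have per: "(f ^^ i) ?p = ?p"
    using i(1) by (metis comp_apply funpow_add le_add_diff_inverse)
  show False
  proof (cases "i \<ge> 1")
    case True
    then show ?thesis
      using aperiodic[OF n True] per by simp
  next
    case False
    then have "m = 0"
      using i(1) by simp
    then have "e a = e b"
      using fm[of a] fm[of b] ab by simp
    then show ?thesis
      using ab arc_eq_iff[of a b] by simp
  qed
qed

end

lemma continuous_map_pieces:
  assumes "\<And>j::int. continuous_map (top_of_set {of_int j..of_int j + 1}) Y g"
  shows "continuous_map (euclidean :: real topology) Y g"
proof (rule pasting_lemma_locally_finite[where I = UNIV and T = "\<lambda>j::int. {of_int j..of_int j + 1}" and f = "\<lambda>_. g"])
  fix x :: real
  have "finite {i \<in> UNIV. {real_of_int i..real_of_int i + 1} \<inter> ball x 1 \<noteq> {}}"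
  proof (rule finite_subset)
    show "{i \<in> UNIV. {real_of_int i..real_of_int i + 1} \<inter> ball x 1 \<noteq> {}} \<subseteq> {\<lfloor>x\<rfloor> - 3..\<lfloor>x\<rfloor> + 3}"
    proof
      fix i :: int
      assume "i \<in> {i \<in> UNIV. {real_of_int i..real_of_int i + 1} \<inter> ball x 1 \<noteq> {}}"
      then obtain z where z: "z \<in> {real_of_int i..real_of_int i + 1}" "z \<in> ball x 1"
        by blast
      then have "\<bar>x - z\<bar> < 1"
        by (simp add: dist_real_def)
      then have "real_of_int i < x + 1" "x - 2 < real_of_int i"
        using z(1) by auto
      then have "\<lfloor>x\<rfloor> - 3 \<le> i" "i \<le> \<lfloor>x\<rfloor> + 3"
        by linarith+
      then show "i \<in> {\<lfloor>x\<rfloor> - 3..\<lfloor>x\<rfloor> + 3}"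
        by simp
    qed
  qed simp
  then show "\<exists>V. openin euclidean V \<and> x \<in> V \<and> finite {i \<in> UNIV. {real_of_int i..real_of_int i + 1} \<inter> V \<noteq> {}}"
    by (intro exI[of _ "ball x 1"]) simp
next
  fix x :: real
  show "\<exists>j. j \<in> UNIV \<and> x \<in> {real_of_int j..real_of_int j + 1} \<and> g x = g x"
    by (intro exI[of _ "\<lfloor>x\<rfloor>"]) (auto intro: less_imp_le)
qed (use assms in auto)

section \<open>The curve traced by iterating a fundamental segment\<close>

locale turning_arc = aperiodic_arc +
  fixes k :: nat and y y1 :: real
  assumes k: "k \<ge> 1" and y: "0 < y" "y < y1" "y1 < 1" and turn: "(f ^^ k) (e y) = e y1"
begin

definition seg :: "real \<Rightarrow> real" where "seg s = y + s * (y1 - y)"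

lemma seg_bounds: "0 \<le> s \<Longrightarrow> s \<le> 1 \<Longrightarrow> y \<le> seg s" "0 \<le> s \<Longrightarrow> s \<le> 1 \<Longrightarrow> seg s \<le> y1"
proof -
  assume s: "0 \<le> s" "s \<le> 1"
  have "0 \<le> s * (y1 - y)" "s * (y1 - y) \<le> 1 * (y1 - y)"
    using s y by (auto intro!: mult_right_mono)
  then show "y \<le> seg s" "seg s \<le> y1"
    unfolding seg_def mult_1_left by linarith+
qed

lemma seg_01: "seg 0 = y" "seg 1 = y1"
  by (simp_all add: seg_def)

lemma seg_less: "s < t \<Longrightarrow> seg s < seg t"
  using y by (simp add: seg_def)

lemma seg_in_arc: "0 \<le> s \<Longrightarrow> s \<le> 1 \<Longrightarrow> 0 < seg s \<and> seg s < 1"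
  using seg_bounds[of s] y by linarith

lemma continuous_seg: "continuous_on S seg"
  unfolding seg_def by (intro continuous_intros)

text \<open>The curve obtained by iterating \<open>f ^^ k\<close> on the fundamental segment from \<open>e y\<close> to \<open>e y1\<close>; it is
  constant for negative times.\<close>

definition gam :: "real \<Rightarrow> 'a" where
  "gam t = (if t < 0 then e y else (f ^^ (k * nat \<lfloor>t\<rfloor>)) (e (seg (frac t))))"

lemma gam_piece:
  assumes "0 \<le> s" "s \<le> 1"
  shows "gam (real j + s) = (f ^^ (k * j)) (e (seg s))"
proof (cases "s < 1")
  case True
  then have "\<lfloor>real j + s\<rfloor> = int j"
    using assms by linarith
  then show ?thesis
    using assms by (simp add: gam_def frac_def)
next
  case False
  then have s: "s = 1"
    using assms by simp
  have "\<lfloor>real j + 1\<rfloor> = int (Suc j)"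
    by linarith
  then have "gam (real j + 1) = (f ^^ (k * Suc j)) (e y)"
    by (simp add: gam_def frac_def seg_def nat_add_distrib)
  also have "k * Suc j = k * j + k"
    by simp
  also have "(f ^^ (k * j + k)) (e y) = (f ^^ (k * j)) (e y1)"
    using turn by (simp add: funpow_add)
  finally show ?thesis
    by (simp add: s seg_01)
qed

lemma gam_seg: "0 \<le> s \<Longrightarrow> s \<le> 1 \<Longrightarrow> gam s = e (seg s)"
  using gam_piece[of s 0] by simp

lemma split_time:
  assumes "0 \<le> t"
  obtains j s where "t = real j + s" "0 \<le> s" "s < 1" "j = nat \<lfloor>t\<rfloor>"
  using assms that[of "nat \<lfloor>t\<rfloor>" "frac t"] frac_ge_0[of t] frac_lt_1[of t] by (simp add: frac_def)

lemma gam_shift: "0 \<le> t \<Longrightarrow> gam (t + real n) = (f ^^ (k * n)) (gam t)"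
proof -
  assume "0 \<le> t"
  then obtain j s where s: "t = real j + s" "0 \<le> s" "s < 1"
    by (rule split_time)
  have "gam (real (j + n) + s) = (f ^^ (k * (j + n))) (e (seg s))"
    using gam_piece[of s "j + n"] s by simp
  also have "k * (j + n) = k * n + k * j"
    by (simp add: algebra_simps)
  also have "(f ^^ (k * n + k * j)) (e (seg s)) = (f ^^ (k * n)) (gam t)"
    using gam_piece[of s j] s by (simp add: funpow_add)
  finally show ?thesis
    using s by (simp add: algebra_simps)
qed

lemma continuous_gam: "continuous_map euclidean X gam"
proof (rule continuous_map_pieces)
  fix j :: int
  let ?I = "{real_of_int j..real_of_int j + 1}"
  show "continuous_map (top_of_set ?I) X gam"
  proof (cases "j \<ge> 0")
    case True
    have "continuous_on ?I (\<lambda>t. seg (t - real_of_int j))"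
      by (intro continuous_on_compose2[OF continuous_seg[of UNIV]] continuous_intros) auto
    then have 1: "continuous_map (top_of_set ?I) (top_of_set {0<..<1}) (\<lambda>t. seg (t - real_of_int j))"
      using seg_in_arc by auto
    have "continuous_map (top_of_set ?I) X (\<lambda>t. (f ^^ (k * nat j)) (e (seg (t - real_of_int j))))"
      using continuous_map_compose[OF continuous_map_compose[OF 1 continuous_arc] continuous_iterate]
      by (simp add: comp_def)
    then show ?thesis
    proof (rule continuous_map_eq)
      fix t assume "t \<in> topspace (top_of_set ?I)"
      then show "(f ^^ (k * nat j)) (e (seg (t - real_of_int j))) = gam t"
        using gam_piece[of "t - real_of_int j" "nat j"] True by simp
    qed
  next
    case False
    have "e y \<in> topspace X"
      using y arc_in by simp
    then have "continuous_map (top_of_set ?I) X (\<lambda>t. e y)"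
      by simp
    then show ?thesis
    proof (rule continuous_map_eq)
      fix t assume "t \<in> topspace (top_of_set ?I)"
      moreover have "real_of_int j + 1 \<le> 0"
        using False by linarith
      ultimately have "t \<le> 0"
        by auto
      then show "e y = gam t"
        using gam_seg[of 0] seg_01 by (cases "t = 0") (auto simp: gam_def)
    qed
  qed
qed

definition G :: "real \<Rightarrow> real" where
  "G = (SOME g. continuous_on UNIV g \<and> (\<forall>t. wind (gam t) = cis (2 * pi * g t)) \<and> g 0 = y)"

lemma continuous_G: "continuous_on S G" and wind_gam: "wind (gam t) = cis (2 * pi * G t)" and G_0: "G 0 = y"
proof -
  obtain g where g: "continuous_on UNIV g" "\<And>t. wind (gam t) = cis (2 * pi * g t)"
    using ex_wind_lift[of UNIV gam] continuous_gam by auto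
  have "wind (e y) = cis (2 * pi * g 0)"
    using g(2)[of 0] gam_seg[of 0] seg_01 by simp
  then have "g 0 - y \<in> \<int>"
    using wind_arc_Ints[of y "g 0"] y by simp
  have "cis (2 * pi * (g t - (g 0 - y))) = cis (2 * pi * g t)" for t
    unfolding cis_eq_iff_Ints using \<open>g 0 - y \<in> \<int>\<close> by (metis Ints_minus diff_diff_eq2 diff_self add_diff_cancel_left' minus_diff_eq diff_add_cancel)
  then have "\<exists>g. continuous_on UNIV g \<and> (\<forall>t. wind (gam t) = cis (2 * pi * g t)) \<and> g 0 = y"
    using g by (intro exI[of _ "\<lambda>t. g t - (g 0 - y)"]) (auto intro!: continuous_intros)
  from someI_ex[OF this] show "continuous_on S G" "wind (gam t) = cis (2 * pi * G t)" "G 0 = y"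
    unfolding G_def[symmetric] by (auto intro: continuous_on_subset)
qed

lemma continuous_G_shift: "continuous_on S (\<lambda>s. G (a + s))"
  by (rule continuous_on_compose2[OF continuous_G[of UNIV]]) (auto intro!: continuous_intros)

lemma G_seg: "0 \<le> s \<Longrightarrow> s \<le> 1 \<Longrightarrow> G s = seg s"
proof -
  assume s: "0 \<le> s" "s \<le> 1"
  have "G s - seg s = G 0 - seg 0"
  proof (rule lifts_differ_by_constant[where S = "{0..1}"])
    show "cis (2 * pi * G x) = cis (2 * pi * seg x)" if "x \<in> {0..1}" for x
      using wind_gam[of x] gam_seg[of x] wind_arc[of "seg x"] seg_in_arc[of x] that by simp
  qed (use s continuous_G continuous_seg in auto)
  then show ?thesis
    using G_0 seg_01 by simp
qed

text \<open>Between the times \<open>j\<close> and \<open>j + 1\<close> the curve is the image of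
  the fundamental segment under \<open>f ^^ (k * j)\<close>; its lift is therefore an arc lift up to
  an integer. This transfers monotonicity from arc lifts to \<open>G\<close>.\<close>

lemma G_piece:
  assumes "j \<ge> 1"
  obtains g and c :: int where "arc_lift (k * j) g" "\<And>s. 0 \<le> s \<Longrightarrow> s \<le> 1 \<Longrightarrow> G (real j + s) = g (seg s) + of_int c"
proof -
  have "k * j \<ge> 1"
    using assms k by simp
  then obtain g where g: "arc_lift (k * j) g"
    using ex_arc_lift by blast
  have eq: "cis (2 * pi * G (real j + s)) = cis (2 * pi * g (seg s))" if s: "s \<in> {0..1}" for s
  proof -
    have "wind ((f ^^ (k * j)) (e (seg s))) = cis (2 * pi * g (seg s))"
      using g seg_in_arc[of s] s unfolding arc_lift_def by simp
    then show ?thesis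
      using wind_gam[of "real j + s"] gam_piece[of s j] s by simp
  qed
  have "continuous_on {0<..<1} g"
    using g by (simp add: arc_lift_def)
  then have "continuous_on {0..1} (\<lambda>s. g (seg s))"
    using seg_in_arc by (intro continuous_on_compose2[of "{0<..<1}" g "{0..1}" seg] continuous_seg) auto
  then have diff: "G (real j + s) - g (seg s) = G (real j + 0) - g (seg 0)" if "s \<in> {0..1}" for s
    using that eq continuous_G_shift by (intro lifts_differ_by_constant[where S = "{0..1}"]) auto
  have "G (real j + 0) - g (seg 0) \<in> \<int>"
    using eq[of 0] by (simp add: cis_eq_iff_Ints)
  then obtain c where c: "G (real j + 0) - g (seg 0) = of_int c"
    by (auto elim: Ints_cases)
  show ?thesis
  proof (rule that[OF g])
    fix s :: real assume "0 \<le> s" "s \<le> 1"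
    then show "G (real j + s) = g (seg s) + of_int c"
      using diff[of s] c by simp
  qed
qed

lemma G_mono_piece:
  assumes "0 \<le> s" "s \<le> t" "t \<le> 1"
  shows "G (real j + s) \<le> G (real j + t)"
proof (cases "s = t")
  case False
  then have less: "seg s < seg t"
    using assms seg_less by simp
  show ?thesis
  proof (cases "j \<ge> 1")
    case True
    obtain g and c :: int where g: "arc_lift (k * j) g" "\<And>s. 0 \<le> s \<Longrightarrow> s \<le> 1 \<Longrightarrow> G (real j + s) = g (seg s) + of_int c"
      using G_piece[OF True] by blast
    have "g (seg s) \<le> g (seg t)"
      using arc_lift_mono[OF g(1) _ less] seg_in_arc assms by auto
    then show ?thesis
      using g(2) assms by simp
  next
    case False
    then have "j = 0"
      by simp
    then show ?thesis
      using G_seg[of s] G_seg[of t] less assms by simp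
  qed
qed simp

lemma G_mono:
  assumes "0 \<le> s" "s \<le> t"
  shows "G s \<le> G t"
proof -
  have nat: "G (real i) \<le> G (real j)" if "i \<le> j" for i j
  proof (rule lift_Suc_mono_le[of "\<lambda>j. G (real j)", OF _ that])
    show "G (real n) \<le> G (real (Suc n))" for n
      using G_mono_piece[of 0 1 n] by (simp add: add.commute)
  qed
  obtain i a where a: "s = real i + a" "0 \<le> a" "a < 1" and i: "i = nat \<lfloor>s\<rfloor>"
    using split_time[OF assms(1)] .
  have "0 \<le> t"
    using assms by simp
  then obtain j b where b: "t = real j + b" "0 \<le> b" "b < 1" and j: "j = nat \<lfloor>t\<rfloor>"
    by (rule split_time)
  have "i \<le> j"
    unfolding i j using assms by (simp add: floor_mono nat_mono)
  show ?thesis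
  proof (cases "i = j")
    case True
    then show ?thesis
      using a b assms G_mono_piece[of a b i] by simp
  next
    case False
    then have "Suc i \<le> j"
      using \<open>i \<le> j\<close> by simp
    have "G s \<le> G (real (Suc i))"
      using G_mono_piece[of a 1 i] a by (simp add: add.commute)
    also have "\<dots> \<le> G (real j)"
      using nat[OF \<open>Suc i \<le> j\<close>] .
    also have "\<dots> \<le> G t"
      using G_mono_piece[of 0 b j] b by simp
    finally show ?thesis .
  qed
qed

text \<open>A plateau of \<open>G\<close> contains a nondegenerate plateau within one piece. In the
  initial piece this contradicts strictness of \<open>seg\<close>; in later ones
  \<open>arc_lift_strict\<close> forces the level 1 of the arc lift, an integer level of
  \<open>G\<close>.\<close>

lemma G_strict:
  assumes "0 \<le> s" "s < t" "G s \<notin> \<int> \<or> G t \<notin> \<int>"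
  shows "G s < G t"
proof (rule ccontr)
  assume "\<not> ?thesis"
  then have eq: "G s = G t"
    using G_mono[of s t] assms by simp
  then have nint: "G s \<notin> \<int>"
    using assms(3) by simp
  obtain j a where a: "s = real j + a" "0 \<le> a" "a < 1"
    using split_time[OF assms(1)] .
  define b where "b = min (t - real j) 1"
  have b: "a < b" "b \<le> 1" "real j + b \<le> t"
    unfolding b_def using a assms(2) by auto
  have eq': "G (real j + a) = G (real j + b)"
    using G_mono[of "real j + a" "real j + b"] G_mono[of "real j + b" t] a b eq by simp
  show False
  proof (cases "j \<ge> 1")
    case True
    obtain g and c :: int where g: "arc_lift (k * j) g" "\<And>s. 0 \<le> s \<Longrightarrow> s \<le> 1 \<Longrightarrow> G (real j + s) = g (seg s) + of_int c"
      using G_piece[OF True] by blast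
    have "g (seg a) = g (seg b)"
      using eq' g(2)[of a] g(2)[of b] a b by simp
    then have "g (seg a) = 1"
      using arc_lift_strict[OF g(1), of "seg a" "seg b"] seg_in_arc[of a] seg_in_arc[of b] seg_less[OF b(1)] a b by auto
    then show False
      using nint g(2)[of a] a by simp
  next
    case False
    then have "j = 0"
      by simp
    then show ?thesis
      using eq' G_seg[of a] G_seg[of b] seg_less[OF b(1)] a b by simp
  qed
qed

lemma gam_arc: "of_int n < G t \<Longrightarrow> G t < of_int n + 1 \<Longrightarrow> gam t = e (G t - of_int n)"
  using wind_eq_arc[OF wind_gam, of t n] by simp

lemma G_eq_mod: "gam s = gam t \<Longrightarrow> G s - G t \<in> \<int>"
  using wind_gam[of s] wind_gam[of t] cis_eq_iff_Ints[of "G s" "G t"] by simp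

lemma G_0_le: "0 \<le> t \<Longrightarrow> y \<le> G t" and G_1_le: "1 \<le> t \<Longrightarrow> y1 \<le> G t"
  using G_mono[of 0 t] G_mono[of 1 t] G_0 G_seg[of 1] seg_01 by auto

text \<open>Some iterate of the segment meets the segment again. There \<open>G\<close> is at least
  \<open>y1\<close> and congruent modulo integers to some \<open>x' < y1\<close>, so it has gained a
  full turn and passed the level \<open>y + 1\<close>.\<close>

lemma ex_T: "\<exists>T. 1 < T \<and> G T = y + 1"
proof -
  let ?V = "e ` {y<..<y1}"
  have "openin X ?V" "?V \<noteq> {}"
    using y by (auto intro!: open_arc_interval)
  from recurrent_multiple[OF this k] obtain j where j: "j \<ge> 1" "(f ^^ (k * j)) ` ?V \<inter> ?V \<noteq> {}" .
  then obtain x x' where x: "y < x" "x < y1" "y < x'" "x' < y1" "(f ^^ (k * j)) (e x) = e x'"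
    by auto
  define s where "s = (x - y) / (y1 - y)"
  have s: "0 < s" "s < 1" "seg s = x"
    using x y by (auto simp: s_def seg_def field_simps)
  have "gam (real j + s) = e x'"
    using gam_piece[of s j] s x(5) by simp
  then have "G (real j + s) - x' \<in> \<int>"
    using wind_gam[of "real j + s"] wind_arc_Ints[of x' "G (real j + s)"] x y by simp
  moreover have "y1 \<le> G (real j + s)"
    using G_1_le[of "real j + s"] j s by simp
  ultimately obtain c :: int where c: "G (real j + s) - x' = of_int c" "real_of_int c > 0"
    using x by (auto elim!: Ints_cases)
  then have "c \<ge> 1"
    by simp
  then have "G (real j + s) \<ge> y + 1"
    using c x by (smt (verit) of_int_1_le_iff)
  moreover have "G 1 \<le> y + 1"
    using G_seg[of 1] seg_01 y by simp
  ultimately obtain T where T: "1 \<le> T" "T \<le> real j + s" "G T = y + 1"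
    using IVT'[of G 1 "y + 1" "real j + s"] continuous_G j s by auto
  have "T \<noteq> 1"
    using T(3) G_seg[of 1] seg_01 y by auto
  then show ?thesis
    using T by (intro exI[of _ T]) auto
qed

definition T :: real where "T = (SOME T. 1 < T \<and> G T = y + 1)"

lemma T_gt: "1 < T" and G_T: "G T = y + 1"
  using someI_ex[OF ex_T] unfolding T_def by blast+

lemma gam_T: "gam T = e y"
  using gam_arc[of 1 T] G_T y by simp

text \<open>The bounds \<open>x < g x < x + 1\<close> on the lifts force the loop traced during the first turn to wind
  exactly once after applying \<open>f ^^ k\<close>.\<close>

lemma G_T_1: "G (T + 1) = y1 + 1"
proof -
  have "0 \<le> T"
    using T_gt by simp
  then obtain j s where s: "T = real j + s" "0 \<le> s" "s < 1"
    by (rule split_time)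
  have j: "j \<ge> 1"
    using s(1,3) T_gt by (cases j) auto
  obtain g and c :: int where g: "arc_lift (k * j) g" "\<And>s. 0 \<le> s \<Longrightarrow> s \<le> 1 \<Longrightarrow> G (real j + s) = g (seg s) + of_int c"
    using G_piece[OF j] by blast
  have "Suc j \<ge> 1"
    by simp
  from G_piece[OF this] obtain h and d :: int where h: "arc_lift (k * Suc j) h"
    "\<And>s. 0 \<le> s \<Longrightarrow> s \<le> 1 \<Longrightarrow> G (real (Suc j) + s) = h (seg s) + of_int d"
    by blast
  have gb: "x < g x" "g x < x + 1" and hb: "x < h x" "h x < x + 1" if "0 < x" "x < 1" for x
    using g(1) h(1) that unfolding arc_lift_def by auto
  have ss: "y \<le> seg s" "seg s < y1" "0 < seg s" "seg s < 1"
    using seg_bounds[of s] seg_less[of s 1] seg_01 s y by auto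
  have "y + 1 = g (seg s) + of_int c"
    using g(2)[of s] s G_T by simp
  \<comment> \<open>The displacement bounds fix the integer \<open>c\<close> of the piece containing
    \<open>T\<close>, and then \<open>d\<close> of the next piece, since at the joint
    \<open>G\<close> lies between \<open>y + 1\<close> and \<open>y1 + 1\<close>.\<close>
  then have "real_of_int c > -1" "real_of_int c < 1"
    using gb[OF ss(3,4)] ss y by linarith+
  then have "c = 0"
    by linarith
  then have Gj1: "G (real j + 1) < y1 + 1"
    using g(2)[of 1] seg_01 gb[of y1] y by simp
  have "G (real j + 1) \<ge> y + 1"
    using G_mono[of T "real j + 1"] T_gt s G_T by simp
  moreover have "G (real j + 1) = h y + of_int d"
    using h(2)[of 0] seg_01 by (simp add: add.commute)
  ultimately have "real_of_int d > 0" "real_of_int d < 2"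
    using Gj1 hb[of y] y by linarith+
  then have "d = 1"
    by linarith
  have "T + 1 = real (Suc j) + s"
    using s(1) by simp
  then have GT: "G (T + 1) = h (seg s) + 1"
    using h(2)[OF s(2) less_imp_le[OF s(3)]] \<open>d = 1\<close> by (simp only: of_int_1)
  have "gam (T + 1) = e y1"
    using gam_shift[of T 1] T_gt gam_T turn by simp
  then have "G (T + 1) - y1 \<in> \<int>"
    using wind_gam[of "T + 1"] wind_arc_Ints[of y1 "G (T + 1)"] y by simp
  then have "G (T + 1) - y1 = of_int 1"
    by (rule Ints_between) (use GT hb[OF ss(3,4)] ss y in auto)
  then show ?thesis
    by simp
qed

text \<open>During this unit of time \<open>G\<close> stays strictly between 1 and 2, so integers do
  not interfere.\<close>

lemma G_strict_turn:
  assumes "T \<le> r" "r < r'" "r' \<le> T + 1"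
  shows "G r < G r'"
proof (rule G_strict)
  have "y + 1 \<le> G r"
    using G_mono[of T r] G_T T_gt assms by simp
  moreover have "G r \<le> y1 + 1"
    using G_mono[of r "T + 1"] G_T_1 T_gt assms by simp
  ultimately have "1 < G r" "G r < 2"
    using y by auto
  then show "G r \<notin> \<int> \<or> G r' \<notin> \<int>"
    using Ints_between[of "G r" 1] by auto
qed (use assms T_gt in auto)

lemma inj_G_turn: "inj_on G {T..T + 1}"
  using G_strict_turn by (intro linorder_inj_onI) force+

lemma image_G_turn: "G ` {T..T + 1} = {y + 1..y1 + 1}"
proof
  show "G ` {T..T + 1} \<subseteq> {y + 1..y1 + 1}"
    using G_mono[of T] G_mono[of _ "T + 1"] G_T G_T_1 T_gt by auto
  show "{y + 1..y1 + 1} \<subseteq> G ` {T..T + 1}"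
  proof
    fix v assume "v \<in> {y + 1..y1 + 1}"
    then obtain r where "T \<le> r" "r \<le> T + 1" "G r = v"
      using IVT'[of G T v "T + 1"] G_T G_T_1 continuous_G by auto
    then show "v \<in> G ` {T..T + 1}"
      by auto
  qed
qed

section \<open>The return map on times\<close>

definition first_return :: "real \<Rightarrow> real" where
  "first_return s = inv_into {T..T + 1} G (seg s + 1)"

lemma first_return:
  assumes "0 \<le> s" "s \<le> 1"
  shows "T \<le> first_return s" "first_return s \<le> T + 1" "G (first_return s) = seg s + 1"
proof -
  have "seg s + 1 \<in> G ` {T..T + 1}"
    unfolding image_G_turn using seg_bounds[OF assms] by simp
  then show "T \<le> first_return s" "first_return s \<le> T + 1" "G (first_return s) = seg s + 1"
    unfolding first_return_def using inv_into_into[of "seg s + 1" G "{T..T + 1}"] f_inv_into_f[of "seg s + 1" G "{T..T + 1}"]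
    by simp_all
qed

lemma first_return_unique: "T \<le> r \<Longrightarrow> r \<le> T + 1 \<Longrightarrow> G r = seg s + 1 \<Longrightarrow> first_return s = r"
  unfolding first_return_def using inv_into_f_f[OF inj_G_turn, of r] by simp

lemma first_return_01: "first_return 0 = T" "first_return 1 = T + 1"
  using first_return_unique[of T 0] first_return_unique[of "T + 1" 1] G_T G_T_1 T_gt by (simp_all add: seg_01)

lemma continuous_first_return: "continuous_on {0..1} first_return"
proof -
  have "continuous_on (G ` {T..T + 1}) (inv_into {T..T + 1} G)"
    by (intro continuous_on_inv) (auto intro: continuous_G inv_into_f_f[OF inj_G_turn])
  then have c: "continuous_on {y + 1..y1 + 1} (inv_into {T..T + 1} G)"
    by (simp add: image_G_turn)
  have "continuous_on {0..1} (\<lambda>s. seg s + 1)"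
    by (intro continuous_intros continuous_seg)
  then show ?thesis
    unfolding first_return_def by (rule continuous_on_compose2[OF c]) (use seg_bounds in auto)
qed

lemma first_return_less:
  assumes "0 \<le> s" "s < t" "t \<le> 1"
  shows "first_return s < first_return t"
proof (rule ccontr)
  assume "\<not> ?thesis"
  then have "G (first_return t) \<le> G (first_return s)"
    using first_return[of t] T_gt assms by (intro G_mono) auto
  then show False
    using first_return(3)[of s] first_return(3)[of t] seg_less[OF assms(2)] assms by auto
qed

text \<open>At time \<open>first_return s\<close> the curve passes again through the point of time
  \<open>s\<close>, one turn later. Commutation with the unit translation, which acts as
  \<open>f ^^ k\<close> along the curve, extends this to all times.\<close>

definition H :: "real \<Rightarrow> real" where
  "H t = first_return (frac t) + of_int \<lfloor>t\<rfloor>"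

lemma H_piece:
  assumes "0 \<le> s" "s \<le> 1"
  shows "H (of_int j + s) = first_return s + of_int j"
proof (cases "s < 1")
  case True
  then have "\<lfloor>of_int j + s\<rfloor> = j"
    using assms by linarith
  then show ?thesis
    by (simp add: H_def frac_def)
next
  case False
  then have "s = 1"
    using assms by simp
  then show ?thesis
    using first_return_01 by (simp add: H_def)
qed

lemma continuous_H': "continuous_on S H"
proof -
  have "continuous_map euclidean euclidean H"
  proof (rule continuous_map_pieces)
    fix j :: int
    have "continuous_on {real_of_int j..real_of_int j + 1} (\<lambda>t. first_return (t - of_int j))"
      by (rule continuous_on_compose2[OF continuous_first_return]) (auto intro!: continuous_intros)
    then have "continuous_on {real_of_int j..real_of_int j + 1} (\<lambda>t. first_return (t - of_int j) + of_int j)"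
      by (intro continuous_intros)
    moreover have "H t = first_return (t - of_int j) + of_int j" if "t \<in> {real_of_int j..real_of_int j + 1}" for t
      using H_piece[of "t - of_int j" j] that by simp
    ultimately have "continuous_on {real_of_int j..real_of_int j + 1} H"
      using continuous_on_cong[OF refl] by (metis (no_types, lifting))
    then show "continuous_map (top_of_set {real_of_int j..real_of_int j + 1}) euclidean H"
      by simp
  qed
  then show ?thesis
    by (auto intro: continuous_on_subset)
qed

lemma H_shift: "H (t + 1) = H t + 1"
  by (simp add: H_def frac_def)

lemma H_less:
  assumes "s < t"
  shows "H s < H t"
proof -
  define a b where "a = s - of_int \<lfloor>s\<rfloor>" and "b = t - of_int \<lfloor>t\<rfloor>"
  have a: "0 \<le> a" "a < 1" "s = of_int \<lfloor>s\<rfloor> + a" and b: "0 \<le> b" "b < 1" "t = of_int \<lfloor>t\<rfloor> + b"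
    unfolding a_def b_def by linarith+
  have Hs: "H s = first_return a + of_int \<lfloor>s\<rfloor>" and Ht: "H t = first_return b + of_int \<lfloor>t\<rfloor>"
    using H_piece[of a "\<lfloor>s\<rfloor>"] H_piece[of b "\<lfloor>t\<rfloor>"] a b by simp_all
  show ?thesis
  proof (cases "\<lfloor>s\<rfloor> = \<lfloor>t\<rfloor>")
    case True
    then have "a < b"
      using assms a(3) b(3) by linarith
    then show ?thesis
      using Hs Ht True first_return_less[of a b] a b by simp
  next
    case False
    then have "\<lfloor>s\<rfloor> + 1 \<le> \<lfloor>t\<rfloor>"
      using assms by (metis floor_mono less_imp_le order_less_le zless_imp_add1_zle)
    moreover have "first_return a < T + 1"
      using first_return_less[of a 1] first_return_01 a by simp
    moreover have "T \<le> first_return b"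
      using first_return[of b] b by simp
    ultimately show ?thesis
      using Hs Ht by linarith
  qed
qed

sublocale circle_lift H
  using continuous_H' H_shift H_less by unfold_locales (auto simp: strict_mono_def)

lemma H_floor: "H t \<ge> of_int \<lfloor>t\<rfloor> + T"
  using first_return[of "frac t"] frac_ge_0[of t] frac_lt_1[of t] by (simp add: H_def)

lemma floor_H: "\<lfloor>H t\<rfloor> \<ge> \<lfloor>t\<rfloor> + 1"
  using H_floor[of t] T_gt by (simp add: le_floor_iff)

lemma floor_iter: "\<lfloor>(H ^^ n) t\<rfloor> \<ge> \<lfloor>t\<rfloor> + int n"
proof (induction n)
  case (Suc n)
  then show ?case
    using floor_H[of "(H ^^ n) t"] by simp
qed simp

lemma iter_nonneg: "0 \<le> t \<Longrightarrow> 0 \<le> (H ^^ n) t"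
  using floor_iter[of t n] by (meson add_nonneg_nonneg of_nat_0_le_iff order.trans zero_le_floor)

lemma gam_H: "0 \<le> t \<Longrightarrow> gam (H t) = gam t"
proof -
  assume "0 \<le> t"
  then obtain j s where s: "t = real j + s" "0 \<le> s" "s < 1"
    by (rule split_time)
  have r: "T \<le> first_return s" "G (first_return s) = seg s + 1"
    using first_return[of s] s by auto
  have "gam (first_return s) = e (seg s)"
    using gam_arc[of 1 "first_return s"] r seg_in_arc[of s] s by simp
  moreover have "H t = first_return s + real j"
    using H_piece[of s "int j"] s by simp
  ultimately show ?thesis
    using gam_shift[of "first_return s" j] r T_gt gam_piece[of s j] s by simp
qed

lemma gam_iter: "0 \<le> t \<Longrightarrow> gam ((H ^^ n) t) = gam t"
  by (induction n) (simp_all add: gam_H iter_nonneg)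

lemma G_H: "0 \<le> t \<Longrightarrow> G (H t) = G t + 1"
proof -
  assume t: "0 \<le> t"
  have "G (H t) - G t = G (H 0) - G 0"
  proof (rule Ints_valued_constant[where S = "{0..}" and g = "\<lambda>t. G (H t) - G t"])
    show "continuous_on {0..} (\<lambda>t. G (H t) - G t)"
      by (intro continuous_intros continuous_G continuous_on_compose2[OF continuous_G[of UNIV] continuous_H']) auto
    show "G (H t) - G t \<in> \<int>" if "t \<in> {0..}" for t
      using G_eq_mod[OF gam_H] that by simp
  qed (use t in auto)
  moreover have "H 0 = T"
    by (simp add: H_def first_return_01)
  ultimately show ?thesis
    using G_T G_0 by simp
qed

lemma G_iter: "0 \<le> t \<Longrightarrow> G ((H ^^ n) t) = G t + real n"
  by (induction n) (simp_all add: G_H iter_nonneg)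

text \<open>If \<open>n\<close> applications of \<open>H\<close> moved \<open>t\<close> by an
  integer \<open>m\<close>, then \<open>m \<ge> 1\<close> by the growth of the floor. As
  \<open>gam\<close> is invariant under \<open>H\<close>, the point of the segment at time
  \<open>frac t\<close> would be fixed by \<open>f ^^ (k * m)\<close>.\<close>

sublocale free_circle_lift H
proof
  fix n t m assume n: "(n::nat) \<ge> 1"
  show "(H ^^ n) t \<noteq> t + of_int m"
  proof
    assume "(H ^^ n) t = t + of_int m"
    then have eq: "(H ^^ n) (frac t) = frac t + of_int m"
      using iter_add_int[of n "frac t" "\<lfloor>t\<rfloor>"] by (simp add: frac_def)
    have s: "0 \<le> frac t" "frac t < 1"
      by (simp_all add: frac_lt_1)
    have "\<lfloor>frac t\<rfloor> = 0"
      using s by (simp add: floor_eq_iff)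
    then have "\<lfloor>frac t\<rfloor> + m \<ge> 1"
      using floor_iter[of "frac t" n] n unfolding eq by simp
    then have m: "m \<ge> 1"
      using \<open>\<lfloor>frac t\<rfloor> = 0\<close> by simp
    have "gam (frac t) = gam (frac t + real (nat m))"
      using gam_iter[OF s(1), of n] eq m by simp
    also have "\<dots> = (f ^^ (k * nat m)) (gam (frac t))"
      using gam_shift[OF s(1)] .
    finally have "(f ^^ (k * nat m)) (e (seg (frac t))) = e (seg (frac t))"
      using gam_seg[of "frac t"] s by simp
    moreover have "k * nat m \<ge> 1"
      using k m by simp
    ultimately show False
      using aperiodic[of "seg (frac t)" "k * nat m"] seg_in_arc[of "frac t"] s by simp
  qed
qed

text \<open>Equal points have \<open>G\<close>-values that differ by an integer, nonnegative because
  \<open>b\<close> lies in the first segment. That many applications of \<open>H\<close> equalize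
  the values, and a nonintegral value of \<open>G\<close> is attained only once.\<close>

lemma gam_eq_base:
  assumes "0 \<le> a" "0 \<le> b" "b < 1" "gam a = gam b"
  obtains n where "a = (H ^^ n) b"
proof -
  have Gb: "y \<le> G b" "G b < y1" "G b < 1" "0 < G b"
    using G_seg[of b] seg_bounds[of b] seg_less[of b 1] seg_01 assms y by auto
  obtain c :: int where c: "G a - G b = of_int c"
    using G_eq_mod[OF assms(4)] by (auto elim: Ints_cases)
  have "real_of_int c > -1"
    using c G_0_le[OF assms(1)] Gb y by linarith
  then have "c \<ge> 0"
    by linarith
  then have eq: "G ((H ^^ nat c) b) = G a"
    using G_iter[OF assms(2), of "nat c"] c by simp
  have "G a \<notin> \<int>"
  proof
    assume "G a \<in> \<int>"
    then have "G b \<in> \<int>"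
      using c by (metis Ints_diff Ints_of_int diff_diff_eq2 add_diff_cancel_left')
    then show False
      using Ints_between[of "G b" 0] Gb by auto
  qed
  then have "a = (H ^^ nat c) b"
    using eq G_strict[of a "(H ^^ nat c) b"] G_strict[of "(H ^^ nat c) b" a] assms(1) iter_nonneg[OF assms(2), of "nat c"]
    by (metis less_irrefl linorder_neqE_linordered_idom)
  then show ?thesis
    using that by blast
qed

lemma rot_pos: "rot > 0"
proof -
  have "(H ^^ 1) 0 > of_int 1"
    using H_floor[of 0] T_gt by simp
  from rot_lower_strict[OF order.refl this] show ?thesis
    by simp
qed

lemma conj_add_nat: "conj (t + real n) = conj t + real n"
proof (induction n)
  case (Suc n)
  have "conj (t + real (Suc n)) = conj ((t + real n) + 1)"
    by (simp add: algebra_simps)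
  also have "\<dots> = conj t + real (Suc n)"
    unfolding conj_add_1 using Suc by simp
  finally show ?case .
qed simp

lemma conj_add_int: "conj (t + of_int m) = conj t + of_int m"
  using conj_add_nat[of t "nat m"] conj_add_nat[of "t + of_int m" "nat (- m)"] by (cases "m \<ge> 0") auto

lemma conj_iter: "conj ((H ^^ n) t) = conj t + real n * rot"
  by (induction n) (simp_all add: conj_H algebra_simps)

text \<open>An interval on which \<open>conj\<close> is constant would be wandering, but transitivity makes it recur.\<close>

lemma conj_less:
  assumes "s < t"
  shows "conj s < conj t"
proof (rule ccontr)
  assume "\<not> ?thesis"
  then have eq: "conj s = conj t"
    using conj_mono[of s t] assms by simp
  define a b where "a = frac s" and "b = min (t - of_int \<lfloor>s\<rfloor>) 1"
  have ab: "0 \<le> a" "a < b" "b \<le> 1"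
    unfolding a_def b_def using assms frac_lt_1[of s] by (auto simp: frac_def)
  have "conj (a + of_int \<lfloor>s\<rfloor>) = conj s" "conj (b + of_int \<lfloor>s\<rfloor>) \<le> conj t"
    unfolding a_def b_def by (auto simp: frac_def intro: conj_mono)
  then have "conj b \<le> conj a"
    using eq unfolding conj_add_int by simp
  then have const: "conj r = conj a" if "a \<le> r" "r \<le> b" for r
    using conj_mono[OF that(1)] conj_mono[OF that(2)] by simp
  let ?V = "e ` {seg a<..<seg b}"
  have sab: "0 < seg a" "seg a < seg b" "seg b < 1"
    using seg_in_arc[of a] seg_in_arc[of b] seg_less[OF ab(2)] ab by auto
  then have V: "openin X ?V" "?V \<noteq> {}"
    by (auto intro!: open_arc_interval)
  from recurrent_multiple[OF V k] obtain j where j: "j \<ge> 1" "(f ^^ (k * j)) ` ?V \<inter> ?V \<noteq> {}" .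
  then obtain x x' where x: "seg a < x" "x < seg b" "seg a < x'" "x' < seg b" "(f ^^ (k * j)) (e x) = e x'"
    by auto
  have param: "\<exists>r. a < r \<and> r < b \<and> seg r = x" if "seg a < x" "x < seg b" for x
  proof (intro exI[of _ "(x - y) / (y1 - y)"] conjI)
    show "a < (x - y) / (y1 - y)" "(x - y) / (y1 - y) < b" "seg ((x - y) / (y1 - y)) = x"
      using that y unfolding seg_def by (simp_all add: field_simps)
  qed
  obtain r where r: "a < r" "r < b" "seg r = x"
    using param x by blast
  obtain r' where r': "a < r'" "r' < b" "seg r' = x'"
    using param x by blast
  have "gam (r + real j) = gam r'"
    using gam_shift[of r j] gam_seg[of r] gam_seg[of r'] r r' ab x(5) by simp
  then obtain n where n: "r + real j = (H ^^ n) r'"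
    using gam_eq_base[of "r + real j" r'] r r' ab by auto
  \<comment> \<open>Both \<open>r\<close> and \<open>r'\<close> lie on the plateau, so applying
    \<open>conj\<close> leaves an equation that makes \<open>rot\<close> rational.\<close>
  have nj: "real j = real n * rot"
    using arg_cong[OF n, of conj] const[of r] const[of r'] r r' by (simp add: conj_add_nat conj_iter)
  then have "n \<noteq> 0"
    using j(1) by (intro notI) simp
  then have "rot = real j / real n"
    using nj by (simp add: field_simps)
  then show False
    using rot_irrational by simp
qed

lemma conj_inj: "conj s = conj t \<Longrightarrow> s = t"
  using conj_less[of s t] conj_less[of t s] by (cases s t rule: linorder_cases) auto

section \<open>The circle as a quotient of the curve\<close>

definition turn_map :: "real \<Rightarrow> complex" where
  "turn_map t = cis (2 * pi * (conj t / rot))"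

lemma turn_map_eq_iff: "turn_map a = turn_map b \<longleftrightarrow> conj a / rot - conj b / rot \<in> \<int>"
  unfolding turn_map_def by (rule cis_eq_iff_Ints)

text \<open>Division by \<open>rot\<close> turns \<open>H\<close> into the unit translation, so
  \<open>cis\<close> identifies each \<open>H\<close>-orbit to a point; the unit translation of
  time, which is \<open>f ^^ k\<close> on the curve, becomes this rotation.\<close>

lemma turn_map_shift: "turn_map (t + 1) = rotation (1 / rot) (turn_map t)"
  unfolding turn_map_def rotation_def conj_add_1 cis_mult by (simp add: add_divide_distrib algebra_simps)

text \<open>The image of \<open>{0..<1}\<close> under \<open>H ^^ n\<close> is a half-open interval
  of length one, so an integer translate of \<open>a\<close> falls into it.\<close>

lemma eventually_base:
  obtains l n b where "a + real l = (H ^^ n) b" "0 \<le> b" "b < 1"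
proof -
  define n where "n = nat \<lceil>a\<rceil>"
  have "(H ^^ n) 0 \<ge> real n"
    using floor_iter[of 0 n] by (simp add: le_floor_iff)
  then have na: "a \<le> (H ^^ n) 0"
    unfolding n_def by linarith
  define l where "l = nat \<lceil>(H ^^ n) 0 - a\<rceil>"
  have l: "(H ^^ n) 0 \<le> a + real l" "a + real l < (H ^^ n) 0 + 1"
    using na unfolding l_def by linarith+
  have one: "(H ^^ n) 1 = (H ^^ n) 0 + 1"
    using iter_add_int[of n 0 1] by simp
  obtain b where b: "0 \<le> b" "b \<le> 1" "(H ^^ n) b = a + real l"
    using IVT'[of "H ^^ n" 0 "a + real l" 1] continuous_iter l one by auto
  then have "b \<noteq> 1"
    using l one by auto
  then show ?thesis
    using that[of l n b] b by simp
qed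

text \<open>Equality of points survives a shift by \<open>l\<close>, which carries \<open>a\<close>
  into the \<open>H\<close>-orbit of a base time, where \<open>gam_eq_base\<close> applies; the
  values of \<open>conj\<close> then differ by a multiple of \<open>rot\<close>. The converse uses
  injectivity of \<open>conj\<close>.\<close>

lemma gam_eq_iff:
  assumes ab: "0 \<le> a" "0 \<le> b"
  shows "gam a = gam b \<longleftrightarrow> turn_map a = turn_map b"
proof
  assume eq: "gam a = gam b"
  obtain l n c where c: "a + real l = (H ^^ n) c" "0 \<le> c" "c < 1"
    using eventually_base by blast
  have "gam (b + real l) = gam (a + real l)"
    using eq gam_shift ab by simp
  also have "\<dots> = gam c"
    unfolding c(1) using gam_iter c by simp
  finally obtain n' where n': "b + real l = (H ^^ n') c"
    using gam_eq_base[of "b + real l" c] ab c by auto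
  have "conj a - conj b = (real n - real n') * rot"
    using arg_cong[OF c(1), of conj] arg_cong[OF n', of conj] by (simp add: conj_add_nat conj_iter algebra_simps)
  then have "conj a / rot - conj b / rot = real_of_int (int n - int n')"
    using rot_pos by (simp add: field_simps)
  then show "turn_map a = turn_map b"
    unfolding turn_map_eq_iff by (metis Ints_of_int)
next
  have *: "gam a = gam b" if ab: "0 \<le> a" "0 \<le> b" and n: "conj a / rot - conj b / rot = real n" for a b n
  proof -
    have "conj a = conj ((H ^^ n) b)"
      using n rot_pos unfolding conj_iter by (simp add: field_simps)
    then have "a = (H ^^ n) b"
      by (rule conj_inj)
    then show ?thesis
      using gam_iter[OF ab(2)] by simp
  qed
  assume "turn_map a = turn_map b"
  then obtain m :: int where m: "conj a / rot - conj b / rot = of_int m"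
    unfolding turn_map_eq_iff by (auto elim: Ints_cases)
  show "gam a = gam b"
  proof (cases "m \<ge> 0")
    case True
    then show ?thesis
      using *[OF ab, of "nat m"] m by simp
  next
    case False
    then have "conj b / rot - conj a / rot = real (nat (- m))"
      using m by simp
    then show ?thesis
      using *[OF ab(2,1)] by simp
  qed
qed

lemma continuous_turn_map: "continuous_on S turn_map"
  unfolding turn_map_def using rot_pos
  by (intro continuous_intros continuous_on_subset[OF continuous_conj]) auto

text \<open>From 0 to \<open>H 0\<close> the quotient \<open>conj t / rot\<close> grows by exactly
  one.\<close>

lemma turn_map_onto: "turn_map ` {0..H 0} = sphere 0 1"
proof
  show "turn_map ` {0..H 0} \<subseteq> sphere 0 1"
    by (auto simp: turn_map_def)
  show "sphere 0 1 \<subseteq> turn_map ` {0..H 0}"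
  proof
    fix z :: complex assume "z \<in> sphere 0 1"
    then have "z = cis (Arg z)"
      using rcis_cmod_Arg[of z] by (simp add: rcis_def)
    also have "Arg z = 2 * pi * (Arg z / (2 * pi))"
      by simp
    finally have z: "z = cis (2 * pi * (Arg z / (2 * pi)))" .
    define w where "w = Arg z / (2 * pi)"
    define v where "v = conj 0 / rot + frac (w - conj 0 / rot)"
    have "w - v = of_int \<lfloor>w - conj 0 / rot\<rfloor>"
      unfolding v_def frac_def by simp
    then have "v - w = of_int (- \<lfloor>w - conj 0 / rot\<rfloor>)"
      by simp
    then have "cis (2 * pi * v) = cis (2 * pi * w)"
      unfolding cis_eq_iff_Ints by (metis Ints_of_int)
    then have "cis (2 * pi * v) = z"
      using z unfolding w_def by simp
    moreover have "conj 0 \<le> v * rot" "v * rot \<le> conj (H 0)"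
    proof -
      have "v * rot = conj 0 + frac (w - conj 0 / rot) * rot"
        unfolding v_def using rot_pos by (simp add: field_simps)
      moreover have "0 \<le> frac (w - conj 0 / rot) * rot"
        using rot_pos by (intro mult_nonneg_nonneg) auto
      moreover have "frac (w - conj 0 / rot) * rot \<le> 1 * rot"
        using rot_pos by (intro mult_right_mono) (auto intro: less_imp_le frac_lt_1)
      ultimately show "conj 0 \<le> v * rot" "v * rot \<le> conj (H 0)"
        unfolding conj_H by linarith+
    qed
    moreover have "0 \<le> H 0"
      using H_floor[of 0] T_gt by simp
    ultimately obtain t where "0 \<le> t" "t \<le> H 0" "conj t = v * rot"
      using IVT'[of conj 0 "v * rot" "H 0"] continuous_on_subset[OF continuous_conj] by blast
    then have "turn_map t = z" "t \<in> {0..H 0}"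
      using \<open>cis (2 * pi * v) = z\<close> rot_pos unfolding turn_map_def by auto
    then show "z \<in> turn_map ` {0..H 0}"
      by blast
  qed
qed

definition coord :: "complex \<Rightarrow> 'a" where
  "coord z = gam (SOME t. 0 \<le> t \<and> turn_map t = z)"

lemma coord_turn_map: "0 \<le> t \<Longrightarrow> coord (turn_map t) = gam t"
proof -
  assume t: "0 \<le> t"
  let ?t = "SOME s. 0 \<le> s \<and> turn_map s = turn_map t"
  have "0 \<le> ?t \<and> turn_map ?t = turn_map t"
    by (rule someI[of _ t]) (use t in simp)
  then show ?thesis
    unfolding coord_def using gam_eq_iff[of ?t t] t by simp
qed

lemma sphere_turn_map:
  assumes "z \<in> sphere 0 1"
  obtains t where "0 \<le> t" "z = turn_map t"
  using assms turn_map_onto by (metis atLeastAtMost_iff imageE)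

text \<open>On the compact interval \<open>{0..H 0}\<close> the map \<open>turn_map\<close> is a
  quotient map onto the circle, so continuity descends from \<open>gam\<close>.\<close>

lemma continuous_coord: "continuous_map circle X coord"
proof -
  let ?I = "top_of_set {0..H 0}"
  have "quotient_map ?I circle turn_map"
  proof (rule continuous_imp_quotient_map)
    show "continuous_map ?I circle turn_map"
      using continuous_turn_map turn_map_onto by auto
    show "turn_map ` topspace ?I = topspace circle"
      using turn_map_onto by simp
  qed (auto simp: compact_space_subtopology Hausdorff_space_subtopology)
  moreover have "continuous_map ?I X (coord \<circ> turn_map)"
  proof (rule continuous_map_eq)
    show "continuous_map ?I X gam"
      using continuous_map_from_subtopology[OF continuous_gam] by simp
    show "gam t = (coord \<circ> turn_map) t" if "t \<in> topspace ?I" for t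
      using coord_turn_map that by simp
  qed
  ultimately show ?thesis
    using continuous_compose_quotient_map by blast
qed

lemma inj_coord: "inj_on coord (sphere 0 1)"
proof (rule inj_onI)
  fix z w assume "z \<in> sphere 0 1" "w \<in> sphere 0 1" and eq: "coord z = coord w"
  then obtain s t where "0 \<le> s" "z = turn_map s" "0 \<le> t" "w = turn_map t"
    by (metis sphere_turn_map)
  then show "z = w"
    using eq coord_turn_map gam_eq_iff by simp
qed

lemma coord_conjugates:
  assumes "z \<in> sphere 0 1"
  shows "(f ^^ k) (coord z) = coord (rotation (1 / rot) z)"
proof -
  obtain t where t: "0 \<le> t" "z = turn_map t"
    using sphere_turn_map[OF assms] .
  have "(f ^^ k) (coord z) = gam (t + 1)"
    using gam_shift[OF t(1), of 1] coord_turn_map t by simp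
  also have "\<dots> = coord (turn_map (t + 1))"
    using coord_turn_map[of "t + 1"] t by simp
  finally show ?thesis
    using turn_map_shift t by simp
qed

lemma open_in_image: "e ` {y<..<y1} \<subseteq> coord ` sphere 0 1"
proof
  fix p assume "p \<in> e ` {y<..<y1}"
  then obtain x where x: "y < x" "x < y1" "p = e x"
    by auto
  let ?s = "(x - y) / (y1 - y)"
  have s: "0 \<le> ?s" "?s \<le> 1" "seg ?s = x"
    using x y unfolding seg_def by (simp_all add: field_simps)
  then have "p = coord (turn_map ?s)"
    using coord_turn_map gam_seg x by simp
  then show "p \<in> coord ` sphere 0 1"
    by (auto simp: turn_map_def)
qed

lemma ex_rotation_circle:
  "\<exists>k\<ge>1. \<exists>a. a \<notin> \<rat> \<and> (\<exists>h. continuous_map circle X h \<and> inj_on h (sphere 0 1) \<and>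
     (\<forall>z\<in>sphere 0 1. (f ^^ k) (h z) = h (rotation a z)) \<and>
     (\<exists>U. openin X U \<and> U \<noteq> {} \<and> U \<subseteq> h ` sphere 0 1))"
proof -
  have "1 / rot \<notin> \<rat>"
  proof
    assume "1 / rot \<in> \<rat>"
    then have "inverse (1 / rot) \<in> \<rat>"
      by (rule Rats_inverse)
    then show False
      using rot_irrational by simp
  qed
  moreover have "openin X (e ` {y<..<y1})" "e ` {y<..<y1} \<noteq> {}"
    using y by (auto intro!: open_arc_interval)
  ultimately show ?thesis
    using k continuous_coord inj_coord coord_conjugates open_in_image by blast
qed

end

context aperiodic_arc
begin

lemma ex_rotation_circle:
  "\<exists>k\<ge>1. \<exists>a. a \<notin> \<rat> \<and> (\<exists>h. continuous_map circle X h \<and> inj_on h (sphere 0 1) \<and>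
     (\<forall>z\<in>sphere 0 1. (f ^^ k) (h z) = h (rotation a z)) \<and>
     (\<exists>U. openin X U \<and> U \<noteq> {} \<and> U \<subseteq> h ` sphere 0 1))"
proof -
  have "openin X (e ` {0<..<1})" "e ` {0<..<1} \<noteq> {}"
    by (auto intro!: open_arc_interval)
  from meet[OF this this] obtain k where k: "k \<ge> 1" "(f ^^ k) ` e ` {0<..<1} \<inter> e ` {0<..<1} \<noteq> {}" .
  then obtain y y1 where y: "0 < y" "y < 1" "0 < y1" "y1 < 1" "(f ^^ k) (e y) = e y1"
    by auto
  have "y \<noteq> y1"
    using aperiodic[OF y(1,2) k(1)] y(5) by auto
  then consider "y < y1" | "y1 < y"
    by linarith
  then show ?thesis
  proof cases
    case 1
    interpret turning_arc X f e k y y1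
      by unfold_locales (use k y 1 in auto)
    show ?thesis
      by (rule ex_rotation_circle)
  next
    case 2
    interpret mir: aperiodic_arc X f "\<lambda>x. e (1 - x)"
      by (rule mirror_arc)
    interpret mir: turning_arc X f "\<lambda>x. e (1 - x)" k "1 - y" "1 - y1"
      by unfold_locales (use k y 2 in auto)
    show ?thesis
      by (rule mir.ex_rotation_circle)
  qed
qed

end

section \<open>Cycles of circles\<close>

lemma norm_rotation [simp]: "norm (rotation a z) = norm z"
  by (simp add: rotation_def norm_mult)

lemma rotation_eq_iff: "rotation a z = rotation a w \<longleftrightarrow> z = w"
  by (simp add: rotation_def)

lemma rotation_sphere: "rotation a ` sphere 0 1 = sphere 0 1"
proof
  show "sphere 0 1 \<subseteq> rotation a ` sphere 0 1"
  proof
    fix z :: complex assume z: "z \<in> sphere 0 1"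
    have "z = rotation a (rotation (- a) z)"
      by (simp add: rotation_def cis_mult flip: mult.assoc)
    then show "z \<in> rotation a ` sphere 0 1"
      using z by (metis image_eqI norm_rotation dist_0_norm mem_sphere)
  qed
qed auto

text \<open>The forward orbit of any point of \<open>B\<close> stays in \<open>B\<close> and is
  dense in the circle by Kronecker's theorem.\<close>

lemma irrational_rotation_minimal:
  assumes a: "a \<notin> \<rat>" and B: "closed B" "B \<noteq> {}" "B \<subseteq> sphere 0 1" "rotation a ` B \<subseteq> B"
  shows "B = sphere 0 1"
proof
  show "sphere 0 1 \<subseteq> B"
  proof
    fix z :: complex assume z: "z \<in> sphere 0 1"
    obtain b where b: "b \<in> B"
      using B(2) by blast
    then have nb: "norm b = 1" "b \<noteq> 0"
      using B(3) by auto
    define w where "w = Arg (z / b) / (2 * pi)"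
    have "norm (z / b) = 1"
      using z nb by (simp add: norm_divide)
    then have "z / b = cis (2 * pi * w)"
      using rcis_cmod_Arg[of "z / b"] unfolding w_def by (simp add: rcis_def)
    then have zb: "z = cis (2 * pi * w) * b"
      using nb by (simp add: field_simps)
    have orbit: "cis (2 * pi * (real n * a)) * b \<in> B" for n
    proof (induction n)
      case (Suc n)
      have "cis (2 * pi * (real (Suc n) * a)) * b = rotation a (cis (2 * pi * (real n * a)) * b)"
        unfolding rotation_def mult.assoc[symmetric] cis_mult by (simp add: algebra_simps)
      then show ?case
        using Suc B(4) by auto
    qed (use b in simp)
    have "z \<in> closure B"
      unfolding closure_approachable
    proof (intro allI impI)
      fix r :: real assume r: "r > 0"
      have "continuous_on UNIV (\<lambda>t. cis (2 * pi * t) * b)"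
        by (intro continuous_intros)
      then obtain d where d: "d > 0" "\<And>t. dist t w < d \<Longrightarrow> dist (cis (2 * pi * t) * b) (cis (2 * pi * w) * b) < r"
        using r unfolding continuous_on_iff by blast
      have "w - d < w + d"
        using d(1) by simp
      from irrational_multiples_dense[OF a this]
      obtain n m where nm: "w - d < real n * a + of_int m" "real n * a + of_int m < w + d" .
      then have "dist (real n * a + of_int m) w < d"
        by (auto simp: dist_real_def)
      from d(2)[OF this] have "dist (cis (2 * pi * (real n * a + of_int m)) * b) z < r"
        using zb by simp
      moreover have "cis (2 * pi * (real n * a + of_int m)) = cis (2 * pi * (real n * a))"
        unfolding cis_eq_iff_Ints by simp
      ultimately show "\<exists>y\<in>B. dist y z < r"
        using orbit[of n] by auto
    qed
    then show "z \<in> B"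
      using B(1) by simp
  qed
qed fact

text \<open>The quotient \<open>F z / z\<close> is invariant under the rotation by \<open>a\<close>;
  its level set through 1 is closed and invariant, hence the whole circle.\<close>

lemma commuting_with_irrational_rotation:
  assumes a: "a \<notin> \<rat>" and F: "continuous_on (sphere 0 1) F" "F ` sphere 0 1 \<subseteq> sphere 0 1"
    and comm: "\<And>z. z \<in> sphere 0 1 \<Longrightarrow> F (rotation a z) = rotation a (F z)"
  shows "\<exists>b. \<forall>z\<in>sphere 0 1. F z = rotation b z"
proof -
  define g where "g z = F z / z" for z
  have "continuous_on (sphere 0 1) g"
    unfolding g_def by (intro continuous_intros F(1)) auto
  then have closed: "closed {z \<in> sphere 0 1. g z = g 1}"
    by (rule continuous_closed_preimage_constant) simp
  have inv: "g (rotation a z) = g z" if "z \<in> sphere 0 1" for z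
    unfolding g_def comm[OF that] by (simp add: rotation_def)
  have "{z \<in> sphere 0 1. g z = g 1} = sphere 0 1"
  proof (rule irrational_rotation_minimal[OF a closed])
    have "1 \<in> {z \<in> sphere 0 1. g z = g 1}"
      by simp
    then show "{z \<in> sphere 0 1. g z = g 1} \<noteq> {}"
      by blast
    show "rotation a ` {z \<in> sphere 0 1. g z = g 1} \<subseteq> {z \<in> sphere 0 1. g z = g 1}"
      using inv by auto
  qed auto
  then have const: "g z = g 1" if "z \<in> sphere 0 1" for z
    using that by blast
  have "norm (F 1) = 1"
    using F(2) by force
  define b where "b = Arg (F 1) / (2 * pi)"
  have F1: "F 1 = cis (2 * pi * b)"
    using rcis_cmod_Arg[of "F 1"] \<open>norm (F 1) = 1\<close> by (simp add: rcis_def b_def)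
  have lin: "F z = F 1 * z" if "z \<in> sphere 0 1" for z
  proof -
    have "z \<noteq> 0"
      using that by auto
    then show ?thesis
      using const[OF that] unfolding g_def by (simp add: divide_eq_eq)
  qed
  have "F z = rotation b z" if "z \<in> sphere 0 1" for z
    unfolding rotation_def lin[OF that] F1 ..
  then show ?thesis
    by blast
qed

lemma rotation_rotation: "rotation a (rotation b z) = rotation (a + b) z"
  unfolding rotation_def mult.assoc[symmetric] cis_mult by (simp add: distrib_left)

lemma rotation_funpow: "(rotation a ^^ n) z = rotation (real n * a) z"
  by (induction n) (simp_all add: rotation_rotation distrib_right, simp add: rotation_def)

context compact_transitive
begin

text \<open>The first return time \<open>n\<close> of the circle may be a proper divisor of
  \<open>k\<close>, so \<open>f ^^ n\<close> has to be recognized as a rotation. On the circle it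
  commutes with the irrational rotation given by \<open>f ^^ k\<close>, which suffices. The other
  circles inherit the same angle through \<open>f ^^ i\<close>.\<close>

lemma rotation_circle_imp_cyclic:
  assumes k: "k \<ge> 1" and a: "a \<notin> \<rat>"
    and h: "continuous_map circle X h" "inj_on h (sphere 0 1)"
    and conj: "\<And>z. z \<in> sphere 0 1 \<Longrightarrow> (f ^^ k) (h z) = h (rotation a z)"
    and U: "openin X U" "U \<noteq> {}" "U \<subseteq> h ` sphere 0 1"
  shows "cyclic_irrational_rotations X f"
proof -
  define Q where "Q = h ` sphere 0 1"
  have compact_circle: "compact_space circle"
    by (simp add: compact_space_subtopology)
  have "compactin X Q"
    unfolding Q_def using image_compactin[OF _ h(1), of "sphere 0 1"] by (simp add: compactin_subtopology)
  then have closed_Q: "closedin X Q" and Q_sub: "Q \<subseteq> topspace X"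
    using hausdorff compactin_imp_closedin compactin_subset_topspace by blast+
  have fkQ: "(f ^^ k) ` Q = Q"
  proof -
    have "(f ^^ k) ` Q = h ` (rotation a ` sphere 0 1)"
      unfolding Q_def image_image using conj by (intro image_cong) auto
    then show ?thesis
      by (simp add: rotation_sphere Q_def)
  qed
  have minimal: "A = Q" if A: "closedin X A" "A \<noteq> {}" "A \<subseteq> Q" "(f ^^ k) ` A \<subseteq> A" for A
  proof -
    let ?B = "{z \<in> sphere 0 1. h z \<in> A}"
    have "closedin circle ?B"
      using closedin_continuous_map_preimage[OF h(1) A(1)] by simp
    then have "closed ?B"
      by (rule closedin_closed_trans) simp
    moreover have "?B \<noteq> {}"
      using A(2,3) unfolding Q_def by blast
    moreover have "rotation a ` ?B \<subseteq> ?B"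
    proof
      fix w assume "w \<in> rotation a ` ?B"
      then obtain z where z: "z \<in> sphere 0 1" "h z \<in> A" "w = rotation a z"
        by blast
      then have "h w \<in> A"
        using A(4) conj[OF z(1)] by (metis image_subset_iff)
      then show "w \<in> ?B"
        using z by simp
    qed
    ultimately have "?B = sphere 0 1"
      by (intro irrational_rotation_minimal[OF a]) auto
    then show ?thesis
      using A(3) unfolding Q_def by blast
  qed
  \<comment> \<open>The intersection is closed and invariant under \<open>f ^^ k\<close>; by
    minimality it is all of \<open>Q\<close>, so \<open>Q\<close> lies in its image and equals
    it.\<close>
  have meets_eq: "(f ^^ i) ` Q = Q" if ne: "(f ^^ i) ` Q \<inter> Q \<noteq> {}" for i
  proof -
    have comm: "(f ^^ k) ` ((f ^^ i) ` Q) = (f ^^ i) ` Q"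
    proof -
      have "(f ^^ k) ` ((f ^^ i) ` Q) = (f ^^ i) ` ((f ^^ k) ` Q)"
        by (simp only: image_comp flip: funpow_add) (simp only: add.commute)
      then show ?thesis
        by (simp only: fkQ)
    qed
    have "(f ^^ i) ` Q \<inter> Q = Q"
    proof (rule minimal)
      show "closedin X ((f ^^ i) ` Q \<inter> Q)"
        using closed_Q iterate_closed by blast
      show "(f ^^ k) ` ((f ^^ i) ` Q \<inter> Q) \<subseteq> (f ^^ i) ` Q \<inter> Q"
        using comm fkQ by blast
    qed (use ne in auto)
    then have "Q \<subseteq> (f ^^ i) ` Q"
      by blast
    then show ?thesis
      using expanding_image_fixed[OF k] fkQ by simp
  qed
  define n where "n = (LEAST i. i \<ge> 1 \<and> (f ^^ i) ` Q = Q)"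
  have "k \<ge> 1 \<and> (f ^^ k) ` Q = Q"
    using k fkQ by simp
  from LeastI[of "\<lambda>i. i \<ge> 1 \<and> (f ^^ i) ` Q = Q", OF this]
  have n: "n \<ge> 1" "(f ^^ n) ` Q = Q"
    unfolding n_def by blast+
  have n_least: "i \<ge> n" if "i \<ge> 1" "(f ^^ i) ` Q = Q" for i
    unfolding n_def using that by (intro Least_le) simp
  have fnmQ: "(f ^^ (n * m)) ` Q = Q" for m
    using image_iterate_fixed[OF n(2)] .
  have "n dvd k"
  proof -
    have "(f ^^ k) ` Q = (f ^^ (k mod n)) ` ((f ^^ (n * (k div n))) ` Q)"
      by (simp only: image_comp mod_mult_div_eq flip: funpow_add)
    then have "(f ^^ (k mod n)) ` Q = Q"
      using fkQ fnmQ by simp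
    then have "\<not> k mod n \<ge> 1"
      using n_least[of "k mod n"] n(1) by (meson mod_less_divisor not_le zero_less_one less_le_trans)
    then show ?thesis
      by (simp add: dvd_eq_mod_eq_0)
  qed
  then obtain u where u: "k = n * u"
    by blast
  have disj: "(f ^^ i) ` Q \<inter> (f ^^ j) ` Q = {}" if ij: "i < j" "j < n" for i j
  proof (rule ccontr)
    assume "\<not> ?thesis"
    then have "(f ^^ (n - j)) ` ((f ^^ i) ` Q) \<inter> (f ^^ (n - j)) ` ((f ^^ j) ` Q) \<noteq> {}"
      by blast
    moreover have "(f ^^ (n - j)) ` ((f ^^ j) ` Q) = Q"
      using n(2) ij by (simp only: image_comp flip: funpow_add) simp
    moreover have "(f ^^ (n - j)) ` ((f ^^ i) ` Q) = (f ^^ (n - j + i)) ` Q"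
      by (simp only: image_comp flip: funpow_add)
    ultimately have "(f ^^ (n - j + i)) ` Q = Q"
      by (intro meets_eq) simp
    moreover have "1 \<le> n - j + i" "n - j + i < n"
      using ij by linarith+
    ultimately show False
      using n_least[of "n - j + i"] by simp
  qed
  \<comment> \<open>\<open>f ^^ k\<close> is a rotation on \<open>Q\<close> and hence injective
    there, and so is \<open>f ^^ i\<close> for \<open>i \<le> k\<close>. This makes the other images
    of \<open>Q\<close> circles as well.\<close>
  have inj_fk: "inj_on (f ^^ k) Q"
  proof (rule inj_onI)
    fix p q assume "p \<in> Q" "q \<in> Q" and eq: "(f ^^ k) p = (f ^^ k) q"
    then obtain z w where z: "z \<in> sphere 0 1" "p = h z" and w: "w \<in> sphere 0 1" "q = h w"
      unfolding Q_def by blast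
    then have "h (rotation a z) = h (rotation a w)"
      using eq conj by simp
    then have "rotation a z = rotation a w"
      using h(2) z w by (auto simp: inj_on_def)
    then show "p = q"
      using z w rotation_eq_iff by simp
  qed
  have inj_fi: "inj_on (f ^^ i) Q" if "i \<le> k" for i
  proof -
    have "f ^^ k = (f ^^ (k - i)) \<circ> (f ^^ i)"
      using that by (simp flip: funpow_add)
    then show ?thesis
      using inj_fk inj_on_imageI2 by metis
  qed
  have "n \<le> k"
    using n_least k fkQ by simp
  define phi where "phi = (\<lambda>(i, z). (f ^^ i) (h z))"
  have psi_cont: "continuous_map circle X (\<lambda>z. (f ^^ i) (h z))" for i
    using continuous_map_compose[OF h(1) continuous_iterate] by (simp add: comp_def)
  have psi_img: "(\<lambda>z. (f ^^ i) (h z)) ` sphere 0 1 = (f ^^ i) ` Q" for i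
    unfolding Q_def by (simp add: image_image)
  have psi_inj: "inj_on (\<lambda>z. (f ^^ i) (h z)) (sphere 0 1)" if "i < n" for i
    using comp_inj_on[OF h(2), of "f ^^ i"] inj_fi[of i] that \<open>n \<le> k\<close> unfolding Q_def by (simp add: comp_def)
  let ?S = "sum_topology (\<lambda>i. circle) {..<n}"
  have "compactin ?S (topspace ?S)"
  proof -
    have "topspace ?S = (\<Union>i<n. Pair i ` sphere 0 1)"
      by auto
    moreover have "compactin ?S (Pair i ` sphere 0 1)" if "i < n" for i
      using that by (intro image_compactin[of circle] continuous_map_component_injection) (auto simp: compactin_subtopology)
    ultimately show ?thesis
      by (simp only:) (intro compactin_Union, auto)
  qed
  then have "compact_space ?S"
    by (simp add: compact_space_def)
  have phi_homeo: "homeomorphic_map ?S X phi"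
  proof (rule continuous_imp_homeomorphic_map[OF _ \<open>compact_space ?S\<close> hausdorff])
    show "continuous_map ?S X phi"
      unfolding continuous_map_def
    proof (intro conjI allI impI)
      show "phi \<in> topspace ?S \<rightarrow> topspace X"
        using psi_cont by (auto simp: phi_def continuous_map_def Pi_iff)
      fix V assume V: "openin X V"
      have "openin circle {z. (i, z) \<in> {p \<in> topspace ?S. phi p \<in> V}}" if "i < n" for i
        using openin_continuous_map_preimage[OF psi_cont V, of i] that by (simp add: phi_def)
      then show "openin ?S {p \<in> topspace ?S. phi p \<in> V}"
        unfolding openin_sum_topology by auto
    qed
    have "phi ` topspace ?S = (\<Union>i<n. (\<lambda>z. (f ^^ i) (h z)) ` sphere 0 1)"
      by (force simp: phi_def)
    also have "\<dots> = topspace X"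
      unfolding psi_img using n closed_Q U unfolding Q_def[symmetric] by (intro invariant_images_cover) auto
    finally show "phi ` topspace ?S = topspace X" .
    show "inj_on phi (topspace ?S)"
    proof (rule inj_onI)
      fix p q assume pq: "p \<in> topspace ?S" "q \<in> topspace ?S" "phi p = phi q"
      then obtain i z j w where p: "p = (i, z)" "i < n" "z \<in> sphere 0 1" and q: "q = (j, w)" "j < n" "w \<in> sphere 0 1"
        by auto
      have "phi p \<in> (f ^^ i) ` Q" "phi q \<in> (f ^^ j) ` Q"
        using p q unfolding Q_def by (simp_all add: phi_def)
      then have "(f ^^ i) ` Q \<inter> (f ^^ j) ` Q \<noteq> {}" "(f ^^ j) ` Q \<inter> (f ^^ i) ` Q \<noteq> {}"
        unfolding pq(3) by blast+
      then have "i = j"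
        using disj[of i j] disj[of j i] p(2) q(2) by (cases i j rule: linorder_cases) simp_all
      then show "p = q"
        using psi_inj[OF p(2)] p q pq(3) by (auto simp: phi_def inj_on_def)
    qed
  qed
  define C where "C i = (f ^^ i) ` Q" for i
  have fC: "f ` C i = C ((i + 1) mod n)" if "i < n" for i
  proof (cases "i + 1 < n")
    case True
    then show ?thesis
      by (simp add: C_def image_comp)
  next
    case False
    then have "i + 1 = n"
      using that by simp
    moreover have "f ` C i = (f ^^ (i + 1)) ` Q"
      by (simp add: C_def image_comp)
    ultimately show ?thesis
      using n(2) by (simp add: C_def)
  qed
  have homeo: "homeomorphic_map circle (subtopology X (C i)) (\<lambda>z. (f ^^ i) (h z))" if "i < n" for i
  proof (rule continuous_imp_homeomorphic_map[OF _ compact_circle])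
    show "continuous_map circle (subtopology X (C i)) (\<lambda>z. (f ^^ i) (h z))"
      using psi_cont[of i] by (auto simp: continuous_map_in_subtopology C_def Q_def)
    show "Hausdorff_space (subtopology X (C i))"
      using hausdorff by (rule Hausdorff_space_subtopology)
    show "(\<lambda>z. (f ^^ i) (h z)) ` topspace circle = topspace (subtopology X (C i))"
      using psi_img[of i] iterate_image_subset[OF Q_sub, of i] by (auto simp: C_def)
    show "inj_on (\<lambda>z. (f ^^ i) (h z)) (topspace circle)"
      using psi_inj[OF that] by simp
  qed
  obtain b where b: "b \<notin> \<rat>" "\<And>z. z \<in> sphere 0 1 \<Longrightarrow> (f ^^ n) (h z) = h (rotation b z)"
  proof -
    have "homeomorphic_map circle (subtopology X Q) h"
      using homeo[of 0] n(1) by (simp add: C_def)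
    then obtain g where g: "homeomorphic_maps circle (subtopology X Q) h g"
      unfolding homeomorphic_map_maps by blast
    then have g_cont: "continuous_map (subtopology X Q) circle g"
      and hg: "\<And>p. p \<in> Q \<Longrightarrow> h (g p) = p"
      using Q_sub unfolding homeomorphic_maps_def by auto
    have fnh: "(f ^^ n) (h z) \<in> Q" if "z \<in> sphere 0 1" for z
      using n(2) that unfolding Q_def by blast
    define F where "F z = g ((f ^^ n) (h z))" for z
    have "continuous_map circle (subtopology X Q) (\<lambda>z. (f ^^ n) (h z))"
      using psi_cont[of n] fnh by (auto simp: continuous_map_in_subtopology)
    from continuous_map_compose[OF this g_cont] have F_cont: "continuous_map circle circle F"
      by (simp add: comp_def F_def[abs_def])
    have hF: "h (F z) = (f ^^ n) (h z)" if "z \<in> sphere 0 1" for z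
      unfolding F_def using hg fnh that by simp
    have F_sphere: "F z \<in> sphere 0 1" if "z \<in> sphere 0 1" for z
      using F_cont that by (auto simp: continuous_map_def)
    have comm: "F (rotation a z) = rotation a (F z)" if z: "z \<in> sphere 0 1" for z
    proof -
      have rz: "rotation a z \<in> sphere 0 1" "rotation a (F z) \<in> sphere 0 1"
        using z F_sphere[OF z] by simp_all
      have "h (F (rotation a z)) = (f ^^ n) ((f ^^ k) (h z))"
        using hF[OF rz(1)] conj[OF z] by simp
      also have "\<dots> = (f ^^ k) ((f ^^ n) (h z))"
        by (metis add.commute comp_apply funpow_add)
      also have "\<dots> = h (rotation a (F z))"
        using hF[OF z] conj[OF F_sphere[OF z]] by simp
      finally show ?thesis
        using h(2) F_sphere[OF rz(1)] rz(2) by (meson inj_onD)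
    qed
    have "continuous_on (sphere 0 1) F" "F ` sphere 0 1 \<subseteq> sphere 0 1"
      using F_cont F_sphere by auto
    from commuting_with_irrational_rotation[where F = F, OF a this comm]
    obtain b where b: "\<And>z. z \<in> sphere 0 1 \<Longrightarrow> F z = rotation b z"
      by blast
    have fb: "(f ^^ n) (h z) = h (rotation b z)" if "z \<in> sphere 0 1" for z
      using hF[OF that] b[OF that] by simp
    have "b \<notin> \<rat>"
    proof
      assume rat: "b \<in> \<rat>"
      have iter: "(f ^^ (n * m)) (h z) = h ((rotation b ^^ m) z)" if "z \<in> sphere 0 1" for m z
      proof (induction m)
        case (Suc m)
        have "(f ^^ (n * Suc m)) (h z) = (f ^^ n) ((f ^^ (n * m)) (h z))"
          by (simp add: funpow_add)
        also have "\<dots> = h (rotation b ((rotation b ^^ m) z))"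
          unfolding Suc using that by (intro fb) (simp add: rotation_funpow)
        finally show ?case
          by simp
      qed simp
      \<comment> \<open>Since \<open>k = n * u\<close>, the angle \<open>a\<close> agrees with
        \<open>u * b\<close> modulo integers, so a rational \<open>b\<close> would make
        \<open>a\<close> rational.\<close>
      have "h (rotation a 1) = h ((rotation b ^^ u) 1)"
        using iter[of 1 u] conj[of 1] u by simp
      then have "rotation a 1 = rotation (real u * b) 1"
        using h(2) unfolding rotation_funpow by (auto simp: inj_on_def)
      then have "a - real u * b \<in> \<int>"
        by (simp add: rotation_def cis_eq_iff_Ints)
      then have "a - real u * b \<in> \<rat>"
        using Ints_subset_Rats by blast
      then have "(a - real u * b) + real u * b \<in> \<rat>"
        using rat by (intro Rats_add Rats_mult Rats_of_nat)
      then show False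
        using a by simp
    qed
    then show ?thesis
      using that fb by blast
  qed
  have conjugate: "topologically_conjugate (subtopology X (C i)) (f ^^ n) circle (rotation b)" if i: "i < n" for i
  proof -
    let ?psi = "\<lambda>z. (f ^^ i) (h z)"
    obtain g where g: "homeomorphic_maps circle (subtopology X (C i)) ?psi g"
      using homeo[OF i] unfolding homeomorphic_map_maps by blast
    then have "homeomorphic_map (subtopology X (C i)) circle g"
      using homeomorphic_maps_sym homeomorphic_maps_map by blast
    moreover have "g ((f ^^ n) x) = rotation b (g x)" if x: "x \<in> topspace (subtopology X (C i))" for x
    proof -
      have gpsi: "\<And>z. z \<in> sphere 0 1 \<Longrightarrow> g (?psi z) = z"
        using g unfolding homeomorphic_maps_def by auto
      obtain z where z: "z \<in> sphere 0 1" "x = ?psi z"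
        using x unfolding C_def Q_def by auto
      have "(f ^^ n) x = (f ^^ i) ((f ^^ n) (h z))"
        unfolding z(2) by (metis add.commute comp_apply funpow_add)
      also have "\<dots> = ?psi (rotation b z)"
        using b(2)[OF z(1)] by simp
      finally show ?thesis
        using gpsi z by simp
    qed
    ultimately show ?thesis
      unfolding topologically_conjugate_def by blast
  qed
  have C_phi: "C i = phi ` ({i} \<times> topspace circle)" for i
    unfolding C_def Q_def by (force simp: phi_def)
  show ?thesis
    unfolding cyclic_irrational_rotations_def
    by (rule exI[of _ n], intro conjI n(1), rule exI[of _ phi], rule exI[of _ C], intro conjI exI[of _ b])
      (use phi_homeo C_phi fC b(1) conjugate in auto)
qed

text \<open>Disjointness of the circles puts points with equal images on the same circle. There
  \<open>f ^^ n\<close> is conjugate to a rotation, hence injective, and it factors through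
  \<open>f\<close> because \<open>n \<ge> 1\<close>.\<close>

lemma cyclic_imp_homeomorphic:
  assumes "cyclic_irrational_rotations X f"
  shows "homeomorphic_map X X f"
proof -
  obtain n phi C a where n: "n \<ge> 1" and phi: "homeomorphic_map (sum_topology (\<lambda>i. circle) {..<n}) X phi"
    and C: "\<And>i. i < n \<Longrightarrow> C i = phi ` ({i} \<times> topspace circle)"
    and fC: "\<And>i. i < n \<Longrightarrow> f ` C i = C ((i + 1) mod n)"
    and conj: "\<And>i. i < n \<Longrightarrow> topologically_conjugate (subtopology X (C i)) (f ^^ n) circle (rotation a)"
    using assms unfolding cyclic_irrational_rotations_def by blast
  have phi_inj: "inj_on phi ({..<n} \<times> sphere 0 1)" and phi_img: "phi ` ({..<n} \<times> sphere 0 1) = topspace X"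
    using homeomorphic_imp_injective_map[OF phi] homeomorphic_imp_surjective_map[OF phi] by (simp_all add: comp_def)
  have cover: "topspace X = (\<Union>i<n. C i)"
    unfolding phi_img[symmetric] using C by fastforce
  have disj: "i = j" if x: "x \<in> C i" "x \<in> C j" and ij: "i < n" "j < n" for i j x
  proof -
    obtain z where z: "x = phi (i, z)" "z \<in> sphere 0 1"
      using x(1) unfolding C[OF ij(1)] by auto
    obtain w where w: "x = phi (j, w)" "w \<in> sphere 0 1"
      using x(2) unfolding C[OF ij(2)] by auto
    have "phi (i, z) = phi (j, w)"
      using z(1) w(1) by simp
    from inj_onD[OF phi_inj this] have "(i, z) = (j, w)"
      using z(2) w(2) ij by simp
    then show ?thesis
      by simp
  qed
  have "inj_on f (topspace X)"
  proof (rule inj_onI)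
    fix x x' assume x: "x \<in> topspace X" "x' \<in> topspace X" "f x = f x'"
    then obtain i j where i: "i < n" "x \<in> C i" and j: "j < n" "x' \<in> C j"
      unfolding cover by blast
    have "f x \<in> C ((i + 1) mod n)" "f x \<in> C ((j + 1) mod n)"
      using fC[OF i(1)] fC[OF j(1)] i j x(3) by (blast, metis imageI)
    then have "(i + 1) mod n = (j + 1) mod n"
      using disj n by (metis mod_less_divisor less_le_trans zero_less_one)
    then have "i = j"
      using i(1) j(1) by (cases "i + 1 = n"; cases "j + 1 = n") auto
    obtain g where g: "homeomorphic_map (subtopology X (C i)) circle g"
      "\<And>x. x \<in> topspace (subtopology X (C i)) \<Longrightarrow> g ((f ^^ n) x) = rotation a (g x)"
      using conj[OF i(1)] unfolding topologically_conjugate_def by blast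
    have xi: "x \<in> topspace (subtopology X (C i))" "x' \<in> topspace (subtopology X (C i))"
      using x i j \<open>i = j\<close> by auto
    obtain m where "n = Suc m"
      using n by (cases n) auto
    then have "(f ^^ n) x = (f ^^ n) x'"
      using x(3) by (simp add: funpow_Suc_right del: funpow.simps)
    then have "g x = g x'"
      using g(2)[OF xi(1)] g(2)[OF xi(2)] rotation_eq_iff by metis
    then show "x = x'"
      using homeomorphic_imp_injective_map[OF g(1)] xi by (meson inj_onD)
  qed
  moreover have "f ` topspace X = topspace X"
  proof
    show "f ` topspace X \<subseteq> topspace X"
      using iterate_image_subset[of "topspace X" 1] by simp
    show "topspace X \<subseteq> f ` topspace X"
    proof
      fix x assume "x \<in> topspace X"
      then obtain j where j: "j < n" "x \<in> C j"
        unfolding cover by blast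
      define i where "i = (if j = 0 then n - 1 else j - 1)"
      have "i < n" "(i + 1) mod n = j"
        using j(1) unfolding i_def by auto
      then have "x \<in> f ` C i"
        using fC j(2) by simp
      then show "x \<in> f ` topspace X"
        using \<open>i < n\<close> unfolding cover by blast
    qed
  qed
  ultimately show ?thesis
    using continuous_imp_homeomorphic_map[OF continuous_f compact hausdorff] by blast
qed

end

section \<open>From free intervals to the dichotomy\<close>

lemma free_interval_imp_free_arc:
  assumes "free_interval X U"
  shows "\<exists>e. free_arc X e"
proof -
  obtain I :: "real set" where U: "openin X U" and I: "open I" "is_interval I" "I \<noteq> {}"
    and "subtopology X U homeomorphic_space top_of_set I"
    using assms unfolding free_interval_def by blast
  then obtain g where g: "homeomorphic_map (top_of_set I) (subtopology X U) g"
    using homeomorphic_space homeomorphic_space_sym by blast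
  obtain x where "x \<in> I"
    using I(3) by blast
  then obtain r where r: "r > 0" "ball x r \<subseteq> I"
    using I(1) open_contains_ball by blast
  \<comment> \<open>The unit interval is carried onto the ball of radius \<open>r / 2\<close> around
    \<open>x\<close>, so bounded and unbounded \<open>I\<close> are treated alike.\<close>
  define l where "l t = x + r * (t - 1 / 2)" for t
  have l: "l t \<in> I" if "t \<in> {0<..<1}" for t
  proof -
    have "\<bar>t - 1 / 2\<bar> < 1"
      using that by (auto simp: abs_if)
    then have "r * \<bar>t - 1 / 2\<bar> < r * 1"
      using r(1) by (intro mult_strict_left_mono)
    then have "\<bar>r * (t - 1 / 2)\<bar> < r"
      using r(1) by (simp add: abs_mult)
    then have "l t \<in> ball x r"
      by (simp add: l_def dist_real_def)
    then show ?thesis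
      using r(2) by blast
  qed
  have "free_arc X (\<lambda>t. g (l t))"
  proof
    have "continuous_on {0<..<1} l"
      unfolding l_def by (intro continuous_intros)
    then have l_cont: "continuous_map (top_of_set {0<..<1}) (top_of_set I) l"
      using l by auto
    have "continuous_map (top_of_set I) X g"
      using homeomorphic_imp_continuous_map[OF g] continuous_map_in_subtopology by blast
    from continuous_map_compose[OF l_cont this]
    show "continuous_map (top_of_set {0<..<1}) X (\<lambda>t. g (l t))"
      by (simp add: comp_def)
    have inj: "inj_on g I"
      using homeomorphic_imp_injective_map[OF g] by simp
    show "inj_on (\<lambda>t. g (l t)) {0<..<1}"
    proof (rule inj_onI)
      fix s t assume "s \<in> {0<..<1}" "t \<in> {0<..<1}" "g (l s) = g (l t)"
      then have "l s = l t"
        using inj l by (meson inj_onD)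
      then show "s = t"
        using r(1) by (simp add: l_def)
    qed
    fix S :: "real set" assume S: "open S" "S \<subseteq> {0<..<1}"
    have "l ` S = (\<lambda>y. 1 / 2 + (y - x) / r) -` S"
      using r(1) by (force simp: l_def image_iff field_simps)
    moreover have "open ((\<lambda>y. 1 / 2 + (y - x) / r) -` S)"
      using r(1) by (intro open_vimage S(1) continuous_intros) auto
    ultimately have "open (l ` S)"
      by (simp only:)
    moreover have "l ` S \<subseteq> I"
      using l S(2) by blast
    ultimately have "openin (top_of_set I) (l ` S)"
      using openin_open_eq[OF I(1)] by blast
    then have "openin (subtopology X U) (g ` l ` S)"
      using homeomorphic_imp_open_map[OF g] by (simp add: open_map_def)
    then have "openin X (g ` l ` S)"
      using U openin_trans_full by blast
    then show "openin X ((\<lambda>t. g (l t)) ` S)"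
      by (simp add: image_image)
  qed
  then show ?thesis
    by blast
qed

theorem theoremC:
  fixes X :: "'a topology" and f :: "'a \<Rightarrow> 'a"
  assumes "compact_space X"
    and "metrizable_space X"
    and "\<exists>U. free_interval X U"
    and "transitive_map X f"
  shows "(relatively_strongly_mixing X f \<and>
          \<not> homeomorphic_map X X f \<and>
          topological_entropy X f > 0 \<and>
          X closure_of (periodic_points X f) = topspace X)
     \<longleftrightarrow> \<not> cyclic_irrational_rotations X f"
proof -
  interpret compact_transitive X f
    using assms metrizable_imp_Hausdorff_space by unfold_locales auto
  obtain e where "free_arc X e"
    using assms(3) free_interval_imp_free_arc by blast
  then interpret free_arc X e .
  interpret transitive_arc X f e
    by unfold_locales
  show ?thesis
  proof (cases "\<exists>a b. 0 \<le> a \<and> a < b \<and> b \<le> 1 \<and> (\<forall>x n. a < x \<and> x < b \<and> n \<ge> 1 \<longrightarrow> (f ^^ n) (e x) \<noteq> e x)")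
    case True
    then obtain a b where ab: "0 \<le> a" "a < b" "b \<le> 1"
      and no: "\<And>x n. a < x \<Longrightarrow> x < b \<Longrightarrow> n \<ge> 1 \<Longrightarrow> (f ^^ n) (e x) \<noteq> e x"
      by blast
    interpret sub: transitive_arc X f "\<lambda>x. e (a + (b - a) * x)"
      using transitive_subarc[OF ab] .
    interpret sub: aperiodic_arc X f "\<lambda>x. e (a + (b - a) * x)"
    proof
      fix x :: real and n :: nat assume x: "0 < x" "x < 1" "n \<ge> 1"
      have "a < a + (b - a) * x" "a + (b - a) * x < b"
        using affine_between[OF ab(2) x(1,2)] .
      then show "(f ^^ n) (e (a + (b - a) * x)) \<noteq> e (a + (b - a) * x)"
        using no x(3) by blast
    qed
    have "cyclic_irrational_rotations X f"
      using sub.ex_rotation_circle rotation_circle_imp_cyclic by blast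
    \<comment> \<open>The second alternative holds and makes \<open>f\<close> a homeomorphism, so
      both sides of the equivalence are false.\<close>
    then show ?thesis
      using cyclic_imp_homeomorphic by blast
  next
    case False
    interpret periodic_arc X f e
      by unfold_locales (use False in blast)
    obtain e' where "full_arc X f e'"
      using ex_full_arc by blast
    then interpret full: full_arc X f e' .
    show ?thesis
      using full.relatively_mixing full.not_homeomorphic full.entropy_pos[OF assms(2)]
        full.periodic_points_dense cyclic_imp_homeomorphic by blast
  qed
qed

end
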